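(* The discrete quantum group $\Sigma_4^+$ is non-amenable.
   Context: A quantum permutation of a set $X$ is a pair $\sigma=(\mathcal H_\sigma,u^\sigma)$ of a Hilbert space and a family $(u^\sigma_{xy})_{x,y\in X}$ of projections in $B(\mathcal H_\sigma)$ such that each row and each column consists of pairwise orthogonal projections summing to $1$ (strongly). Intertwiners are bounded operators $T$ with $Tu^\sigma_{xy}=u^\tau_{xy}T$ for all $x,y$. The tensor product of $\sigma,\tau$ has entries $\sum_{z}u^\sigma_{xz}\otimes u^\tau_{zy}$ on $\mathcal H_\sigma\otimes\mathcal H_\tau$, and the contragredient acts on the conjugate Hilbert space by $u^{\overline\sigma}_{xy}(\overline\xi)=\overline{u^\sigma_{yx}(\xi)}$. For $n\in\mathbb N$, $\Sigma_n^+$ is the discrete quantum group obtained via Tannaka-Krein reconstruction from the rigid $C^*$-tensor category of finite dimensional quantum permutations of $\{1,\dots,n\}$ with its tautological fiber functor to Hilbert spaces. Equivalently, its category $\mathrm{Corep}(\Sigma_n^+)$ of finite dimensional corepresentations (i.e. of finite dimensional representations of the dual compact quantum group $\widehat{\Sigma_n^+}$) is the $C^*$-tensor category of finite dimensional unital $*$-representations of the universal $C^*$-algebra $C^{\mathsf f}(S_n^+)$ generated by the entries of an $n\times n$ magic unitary $u=(u_{ij})$ (all $u_{ij}$ projections, all rows and columns summing to $1$), with tensor product $(\pi\otimes\eta)\Delta$, where $\Delta(u_{ij})=\sum_k u_{ik}\otimes u_{kj}$. A discrete quantum group $G$ is amenable iff the canonical map $C^*_{\mathsf f}(G)\to C^*_{\mathsf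 r}(G)$ from the full to the reduced group $C^*$-algebra is an isomorphism, equivalently iff the counit of the Hopf $*$-algebra $\mathcal O(\hat G)$ of the dual compact quantum group extends to a bounded $*$-homomorphism $C^*_{\mathsf r}(G)\to\mathbb C$. *)

theory Defs
  imports Complex_Main "HOL-Algebra.Module"
    "Jordan_Normal_Form.Schur_Decomposition"
begin

section \<open>Finite dimensional quantum permutations\<close>

text \<open>
  A finite dimensional Hilbert space is taken to be \<open>\<complex>\<^sup>d\<close> for some \<open>d\<close>, so that an operator on it
  is a \<open>d \<times> d\<close> matrix; up to unitary equivalence this is no restriction.  The vector product
  \<open>\<eta> \<bullet>c \<xi>\<close> is linear in \<open>\<eta>\<close> and antilinear in \<open>\<xi>\<close>.
\<close>

definition projection_mat :: "nat \<Rightarrow> complex mat \<Rightarrow> bool" where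
  "projection_mat d p \<longleftrightarrow> p \<in> carrier_mat d d \<and> p * p = p \<and> mat_adjoint p = p"

definition sum_mat :: "nat \<Rightarrow> ('x \<Rightarrow> complex mat) \<Rightarrow> 'x set \<Rightarrow> complex mat" where
  "sum_mat d f X = mat d d (\<lambda>(i, j). \<Sum>x\<in>X. f x $$ (i, j))"

definition quantum_permutation ::
  "'x set \<Rightarrow> nat \<Rightarrow> ('x \<Rightarrow> 'x \<Rightarrow> complex mat) \<Rightarrow> bool" where
  "quantum_permutation X d u \<longleftrightarrow>
     (\<forall>x\<in>X. \<forall>y\<in>X. projection_mat d (u x y)) \<and>
     (\<forall>x\<in>X. \<forall>y\<in>X. \<forall>z\<in>X. y \<noteq> z \<longrightarrow> u x y * u x z = 0\<^sub>m d d) \<and>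
     (\<forall>x\<in>X. \<forall>y\<in>X. \<forall>z\<in>X. x \<noteq> z \<longrightarrow> u x y * u z y = 0\<^sub>m d d) \<and>
     (\<forall>x\<in>X. sum_mat d (\<lambda>y. u x y) X = 1\<^sub>m d) \<and>
     (\<forall>y\<in>X. sum_mat d (\<lambda>x. u x y) X = 1\<^sub>m d)"

text \<open>
  The tensor product, where \<open>\<complex>\<^sup>d \<otimes> \<complex>\<^sup>e\<close> is identified with \<open>\<complex>\<^sup>d\<^sup>e\<close> in such a way that the basis vector
  with index \<open>i * e + k\<close> (\<open>i < d\<close>, \<open>k < e\<close>) is the tensor product of those with indices \<open>i\<close> and \<open>k\<close>.
\<close>

definition qp_tensor :: "'x set \<Rightarrow> nat \<Rightarrow> nat \<Rightarrow> ('x \<Rightarrow> 'x \<Rightarrow> complex mat) \<Rightarrow>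
    ('x \<Rightarrow> 'x \<Rightarrow> complex mat) \<Rightarrow> 'x \<Rightarrow> 'x \<Rightarrow> complex mat" where
  "qp_tensor X d e u v x y = mat (d * e) (d * e)
     (\<lambda>(i, j). \<Sum>z\<in>X. u x z $$ (i div e, j div e) * v z y $$ (i mod e, j mod e))"

definition vec_tensor :: "nat \<Rightarrow> nat \<Rightarrow> complex vec \<Rightarrow> complex vec \<Rightarrow> complex vec" where
  "vec_tensor d e \<xi> \<eta> = vec (d * e) (\<lambda>i. \<xi> $ (i div e) * \<eta> $ (i mod e))"

text \<open>
  In the basis conjugate to the standard one, the operator \<open>\<xi>\<^bold>\<bar> \<mapsto> (T \<xi>)\<^bold>\<bar>\<close> on the conjugate Hilbert
  space has the entrywise conjugate matrix.
\<close>

definition qp_contragredient ::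
  "('x \<Rightarrow> 'x \<Rightarrow> complex mat) \<Rightarrow> 'x \<Rightarrow> 'x \<Rightarrow> complex mat" where
  "qp_contragredient u x y = map_mat cnj (u y x)"

definition qp_trivial :: "'x \<Rightarrow> 'x \<Rightarrow> complex mat" where
  "qp_trivial x y = (if x = y then 1\<^sub>m 1 else 0\<^sub>m 1 1)"


section \<open>Matrix coefficients\<close>

text \<open>
  A word \<open>[(x\<^sub>1, y\<^sub>1), \<dots>, (x\<^sub>k, y\<^sub>k)]\<close> over \<open>X \<times> X\<close> stands for the monomial
  \<open>u\<^bsub>x\<^sub>1 y\<^sub>1\<^esub> \<cdots> u\<^bsub>x\<^sub>k y\<^sub>k\<^esub>\<close>.
  The monomials span the dense unital \<open>*\<close>-subalgebra of the universal \<open>C\<^sup>*\<close>-algebra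
  generated by the entries of a magic unitary indexed by \<open>X\<close>, so a matrix coefficient
  \<open>a \<mapsto> \<langle>\<xi>, \<pi>(a) \<eta>\<rangle>\<close> of a finite dimensional \<open>*\<close>-representation \<open>\<pi>\<close> of that algebra
  is determined by its values on them.  Accordingly matrix coefficients are functions on words,
  extended by \<open>0\<close> to words with letters outside \<open>X \<times> X\<close>.
\<close>

type_synonym 'x word = "('x \<times> 'x) list"

fun word_mat :: "nat \<Rightarrow> ('x \<Rightarrow> 'x \<Rightarrow> complex mat) \<Rightarrow> 'x word \<Rightarrow> complex mat" where
  "word_mat d u [] = 1\<^sub>m d"
| "word_mat d u ((x, y) # w) = u x y * word_mat d u w"

definition coefficient :: "'x set \<Rightarrow> nat \<Rightarrow> ('x \<Rightarrow> 'x \<Rightarrow> complex mat) \<Rightarrow>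
    complex vec \<Rightarrow> complex vec \<Rightarrow> 'x word \<Rightarrow> complex" where
  "coefficient X d u \<xi> \<eta> w =
     (if w \<in> lists (X \<times> X) then (word_mat d u w *\<^sub>v \<eta>) \<bullet>c \<xi> else 0)"

text \<open>The linear span of all matrix coefficients.\<close>

inductive_set coefficients :: "'x set \<Rightarrow> ('x word \<Rightarrow> complex) set" for X :: "'x set" where
  zero: "(\<lambda>w. 0) \<in> coefficients X"
| coeff: "quantum_permutation X d u \<Longrightarrow> \<xi> \<in> carrier_vec d \<Longrightarrow> \<eta> \<in> carrier_vec d \<Longrightarrow>
    coefficient X d u \<xi> \<eta> \<in> coefficients X"
| add: "\<phi> \<in> coefficients X \<Longrightarrow> \<psi> \<in> coefficients X \<Longrightarrow> (\<lambda>w. \<phi> w + \<psi> w) \<in> coefficients X"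
| smult: "\<phi> \<in> coefficients X \<Longrightarrow> (\<lambda>w. c * \<phi> w) \<in> coefficients X"

text \<open>
  The product dual to the comultiplication \<open>\<Delta>(u\<^bsub>xy\<^esub>) = (\<Sum>z. u\<^bsub>xz\<^esub> \<otimes> u\<^bsub>zy\<^esub>)\<close>, that is
  \<open>(\<phi> \<psi>)(a) = (\<phi> \<otimes> \<psi>)(\<Delta>(a))\<close>.
\<close>

definition convolution :: "'x set \<Rightarrow> ('x word \<Rightarrow> complex) \<Rightarrow> ('x word \<Rightarrow> complex) \<Rightarrow>
    'x word \<Rightarrow> complex" where
  "convolution X \<phi> \<psi> w =
     (\<Sum>zs | zs \<in> lists X \<and> length zs = length w. \<phi> (zip (map fst w) zs) * \<psi> (zip zs (map snd w)))"

text \<open>The coefficient of the trivial quantum permutation.\<close>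

definition unit_coefficient :: "'x set \<Rightarrow> 'x word \<Rightarrow> complex" where
  "unit_coefficient X w = (if w \<in> lists (X \<times> X) \<and> (\<forall>(x, y) \<in> set w. x = y) then 1 else 0)"

text \<open>
  The antipode \<open>S(u\<^bsub>xy\<^esub>) = u\<^bsub>yx\<^esub>\<close> is antimultiplicative, whence
  \<open>S(u\<^bsub>x\<^sub>1 y\<^sub>1\<^esub> \<cdots> u\<^bsub>x\<^sub>k y\<^sub>k\<^esub>)\<^sup>* = u\<^bsub>y\<^sub>1 x\<^sub>1\<^esub> \<cdots> u\<^bsub>y\<^sub>k x\<^sub>k\<^esub>\<close>.
  The involution on coefficients is \<open>\<phi>\<^sup>*(a) = cnj (\<phi>(S(a)\<^sup>*))\<close>.
\<close>

definition star_coefficient :: "('x word \<Rightarrow> complex) \<Rightarrow> 'x word \<Rightarrow> complex" where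
  "star_coefficient \<phi> w = cnj (\<phi> (map prod.swap w))"

definition antipode_coefficient :: "('x word \<Rightarrow> complex) \<Rightarrow> 'x word \<Rightarrow> complex" where
  "antipode_coefficient \<phi> w = \<phi> (rev (map prod.swap w))"

subsection \<open>Compatibility with tensor products and contragredients\<close>

lemma sum_div_mod:
  fixes f :: "nat \<Rightarrow> nat \<Rightarrow> complex"
  shows "(\<Sum>k<d * e. f (k div e) (k mod e)) = (\<Sum>a<d. \<Sum>b<e. f a b)"
proof (cases "e = 0")
  case False
  have "(\<Sum>k<d * e. f (k div e) (k mod e)) = (\<Sum>(a, b)\<in>{..<d} \<times> {..<e}. f a b)"
  proof (rule sum.reindex_bij_witness[where i = "\<lambda>(a, b). a * e + b" and j = "\<lambda>k. (k div e, k mod e)"])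
    fix p assume p: "p \<in> {..<d} \<times> {..<e}"
    then obtain a b where ab: "p = (a, b)" "a < d" "b < e" by auto
    have "a * e + b < Suc a * e" using ab by simp
    also have "\<dots> \<le> d * e" using ab by (intro mult_le_mono1) simp
    finally show "(case p of (a, b) \<Rightarrow> a * e + b) \<in> {..<d * e}" using ab by simp
    show "((case p of (a, b) \<Rightarrow> a * e + b) div e, (case p of (a, b) \<Rightarrow> a * e + b) mod e) = p"
      using ab by simp
  qed (use False in \<open>auto simp: less_mult_imp_div_less\<close>)
  then show ?thesis by (simp add: sum.cartesian_product)
qed simp

lemma div_mod_less:
  fixes i d e :: nat
  assumes "i < d * e"
  shows "i div e < d" "i mod e < e"
  using assms by (auto simp: less_mult_imp_div_less intro!: mod_less_divisor gr0I)

lemma word_mat_carrier: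
  assumes "\<And>x y. x \<in> X \<Longrightarrow> y \<in> X \<Longrightarrow> u x y \<in> carrier_mat d d" and "w \<in> lists (X \<times> X)"
  shows "word_mat d u w \<in> carrier_mat d d"
  using assms(2)
proof (induction w rule: list.induct)
  case (Cons p w)
  then have "fst p \<in> X" "snd p \<in> X" by (simp_all add: mem_Times_iff)
  then show ?case
    using Cons assms(1)[of "fst p" "snd p"] by (cases p) simp
qed simp

lemma index_mult_sum:
  assumes "A \<in> carrier_mat d d" "B \<in> carrier_mat d d" "i < d" "j < d"
  shows "(A * B) $$ (i, j) = (\<Sum>k<d. A $$ (i, k) * B $$ (k, j))"
  using assms by (simp add: scalar_prod_def lessThan_atLeast0)

lemma words_Suc:
  "{zs. zs \<in> lists X \<and> length zs = Suc n} =
     (\<lambda>(z, zs). z # zs) ` (X \<times> {zs. zs \<in> lists X \<and> length zs = n})"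
  by (force simp: length_Suc_conv image_iff)

lemma sum_words_Suc:
  fixes f :: "'x list \<Rightarrow> complex"
  shows "(\<Sum>zs | zs \<in> lists X \<and> length zs = Suc n. f zs) =
     (\<Sum>z\<in>X. \<Sum>zs | zs \<in> lists X \<and> length zs = n. f (z # zs))"
  unfolding words_Suc
  by (subst sum.reindex) (auto simp: inj_on_def sum.cartesian_product case_prod_beta)

lemma word_mat_tensor:
  assumes u: "\<And>x y. x \<in> X \<Longrightarrow> y \<in> X \<Longrightarrow> u x y \<in> carrier_mat d d"
    and v: "\<And>x y. x \<in> X \<Longrightarrow> y \<in> X \<Longrightarrow> v x y \<in> carrier_mat e e"
    and w: "w \<in> lists (X \<times> X)" and ij: "i < d * e" "j < d * e"
  shows "word_mat (d * e) (qp_tensor X d e u v) w $$ (i, j) =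
    (\<Sum>zs | zs \<in> lists X \<and> length zs = length w.
       word_mat d u (zip (map fst w) zs) $$ (i div e, j div e) *
       word_mat e v (zip zs (map snd w)) $$ (i mod e, j mod e))"
  using w ij
proof (induction w arbitrary: i j rule: list.induct)
  case Nil
  have "{zs. zs \<in> lists X \<and> length zs = 0} = {[]}" by auto
  moreover have "i = j \<longleftrightarrow> i div e = j div e \<and> i mod e = j mod e" by (metis div_mult_mod_eq)
  ultimately show ?case using Nil div_mod_less[of i d e] div_mod_less[of j d e] by (auto)
next
  case (Cons p w)
  obtain x y where p: "p = (x, y)" by (cases p)
  have xy: "x \<in> X" "y \<in> X" and w: "w \<in> lists (X \<times> X)"
    using Cons.prems(1) by (simp_all add: p)
  let ?W = "{zs. zs \<in> lists X \<and> length zs = length w}"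
  let ?i1 = "i div e" and ?i2 = "i mod e" and ?j1 = "j div e" and ?j2 = "j mod e"
  let ?U = "\<lambda>zs. word_mat d u (zip (map fst w) zs)"
  let ?V = "\<lambda>zs. word_mat e v (zip zs (map snd w))"
  have i: "?i1 < d" "?i2 < e" and j: "?j1 < d" "?j2 < e"
    using Cons.prems div_mod_less[of i d e] div_mod_less[of j d e] by auto
  have U: "?U zs \<in> carrier_mat d d" and V: "?V zs \<in> carrier_mat e e" if "zs \<in> ?W" for zs
  proof -
    have "zip (map fst w) zs \<in> lists (X \<times> X)" "zip zs (map snd w) \<in> lists (X \<times> X)"
      using that w by (fastforce dest: set_zip_leftD set_zip_rightD)+
    then show "?U zs \<in> carrier_mat d d" "?V zs \<in> carrier_mat e e"
      using word_mat_carrier[of X u d] word_mat_carrier[of X v e] u v by auto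
  qed
  have T: "qp_tensor X d e u v x' y' \<in> carrier_mat (d * e) (d * e)" for x' y'
    by (simp add: qp_tensor_def)
  have "word_mat (d * e) (qp_tensor X d e u v) (p # w) $$ (i, j) =
      (\<Sum>k<d * e. qp_tensor X d e u v x y $$ (i, k) *
         word_mat (d * e) (qp_tensor X d e u v) w $$ (k, j))"
    unfolding p word_mat.simps
    by (rule index_mult_sum[OF T word_mat_carrier[OF T w]]) (use Cons.prems in auto)
  also have "\<dots> = (\<Sum>k<d * e. (\<Sum>z\<in>X. u x z $$ (?i1, k div e) * v z y $$ (?i2, k mod e)) *
      (\<Sum>zs\<in>?W. ?U zs $$ (k div e, ?j1) * ?V zs $$ (k mod e, ?j2)))"
    using Cons.prems w by (intro sum.cong refl) (simp add: Cons.IH, simp add: qp_tensor_def)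
  also have "\<dots> = (\<Sum>a<d. \<Sum>b<e. (\<Sum>z\<in>X. u x z $$ (?i1, a) * v z y $$ (?i2, b)) *
      (\<Sum>zs\<in>?W. ?U zs $$ (a, ?j1) * ?V zs $$ (b, ?j2)))"
    by (rule sum_div_mod)
  also have "\<dots> = (\<Sum>a<d. \<Sum>b<e. \<Sum>z\<in>X. \<Sum>zs\<in>?W.
      (u x z $$ (?i1, a) * ?U zs $$ (a, ?j1)) * (v z y $$ (?i2, b) * ?V zs $$ (b, ?j2)))"
    unfolding sum_product by (intro sum.cong refl) (simp add: mult_ac)
  also have "\<dots> = (\<Sum>a<d. \<Sum>z\<in>X. \<Sum>b<e. \<Sum>zs\<in>?W.
      (u x z $$ (?i1, a) * ?U zs $$ (a, ?j1)) * (v z y $$ (?i2, b) * ?V zs $$ (b, ?j2)))"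
    by (intro sum.cong refl sum.swap)
  also have "\<dots> = (\<Sum>z\<in>X. \<Sum>a<d. \<Sum>zs\<in>?W. \<Sum>b<e.
      (u x z $$ (?i1, a) * ?U zs $$ (a, ?j1)) * (v z y $$ (?i2, b) * ?V zs $$ (b, ?j2)))"
    by (subst sum.swap) (intro sum.cong refl sum.swap)
  also have "\<dots> = (\<Sum>z\<in>X. \<Sum>zs\<in>?W. \<Sum>a<d. \<Sum>b<e.
      (u x z $$ (?i1, a) * ?U zs $$ (a, ?j1)) * (v z y $$ (?i2, b) * ?V zs $$ (b, ?j2)))"
    by (intro sum.cong refl sum.swap)
  also have "\<dots> = (\<Sum>z\<in>X. \<Sum>zs\<in>?W. (u x z * ?U zs) $$ (?i1, ?j1) * (v z y * ?V zs) $$ (?i2, ?j2))"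
  proof (intro sum.cong refl)
    fix z zs assume z: "z \<in> X" and zs: "zs \<in> ?W"
    show "(\<Sum>a<d. \<Sum>b<e.
        (u x z $$ (?i1, a) * ?U zs $$ (a, ?j1)) * (v z y $$ (?i2, b) * ?V zs $$ (b, ?j2))) =
        (u x z * ?U zs) $$ (?i1, ?j1) * (v z y * ?V zs) $$ (?i2, ?j2)"
      by (simp only: index_mult_sum[OF u[OF xy(1) z] U[OF zs] i(1) j(1)]
          index_mult_sum[OF v[OF z xy(2)] V[OF zs] i(2) j(2)] sum_product)
  qed
  also have "\<dots> = (\<Sum>zs | zs \<in> lists X \<and> length zs = length (p # w).
       word_mat d u (zip (map fst (p # w)) zs) $$ (?i1, ?j1) *
       word_mat e v (zip zs (map snd (p # w))) $$ (?i2, ?j2))"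
    by (simp add: sum_words_Suc p)
  finally show ?case .
qed

lemma quadratic_form_sum:
  assumes "A \<in> carrier_mat d d" "\<xi> \<in> carrier_vec d" "\<eta> \<in> carrier_vec d"
  shows "(A *\<^sub>v \<eta>) \<bullet>c \<xi> = (\<Sum>i<d. \<Sum>j<d. A $$ (i, j) * \<eta> $ j * cnj (\<xi> $ i))"
  using assms by (simp add: scalar_prod_def lessThan_atLeast0 sum_distrib_right)

lemma coefficient_tensor:
  assumes u: "quantum_permutation X d u" and v: "quantum_permutation X e v"
    and \<xi>: "\<xi> \<in> carrier_vec d" "\<xi>' \<in> carrier_vec e"
    and \<eta>: "\<eta> \<in> carrier_vec d" "\<eta>' \<in> carrier_vec e"
  shows "coefficient X (d * e) (qp_tensor X d e u v) (vec_tensor d e \<xi> \<xi>') (vec_tensor d e \<eta> \<eta>') =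
    convolution X (coefficient X d u \<xi> \<eta>) (coefficient X e v \<xi>' \<eta>')"
proof
  fix w :: "'a word"
  let ?W = "{zs. zs \<in> lists X \<and> length zs = length w}"
  show "coefficient X (d * e) (qp_tensor X d e u v) (vec_tensor d e \<xi> \<xi>') (vec_tensor d e \<eta> \<eta>') w =
    convolution X (coefficient X d u \<xi> \<eta>) (coefficient X e v \<xi>' \<eta>') w"
  proof (cases "w \<in> lists (X \<times> X)")
    case True
    have uc: "u x y \<in> carrier_mat d d" and vc: "v x y \<in> carrier_mat e e" if "x \<in> X" "y \<in> X" for x y
      using u v that by (auto simp: quantum_permutation_def projection_mat_def)
    let ?U = "\<lambda>zs. word_mat d u (zip (map fst w) zs)"
    let ?V = "\<lambda>zs. word_mat e v (zip zs (map snd w))"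
    have wU: "zip (map fst w) zs \<in> lists (X \<times> X)" and wV: "zip zs (map snd w) \<in> lists (X \<times> X)"
      if "zs \<in> ?W" for zs
      using that True by (fastforce dest: set_zip_leftD set_zip_rightD)+
    have U: "?U zs \<in> carrier_mat d d" and V: "?V zs \<in> carrier_mat e e" if "zs \<in> ?W" for zs
      using word_mat_carrier[of X u d, OF uc wU[OF that]]
        word_mat_carrier[of X v e, OF vc wV[OF that]] by auto
    have T: "word_mat (d * e) (qp_tensor X d e u v) w \<in> carrier_mat (d * e) (d * e)"
      by (rule word_mat_carrier[OF _ True]) (simp add: qp_tensor_def)
    define f where "f zs a b k l = ?U zs $$ (a, b) * \<eta> $ b * cnj (\<xi> $ a) *
        (?V zs $$ (k, l) * \<eta>' $ l * cnj (\<xi>' $ k))" for zs a b k l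
    have "coefficient X (d * e) (qp_tensor X d e u v) (vec_tensor d e \<xi> \<xi>') (vec_tensor d e \<eta> \<eta>') w =
      (\<Sum>i<d * e. \<Sum>j<d * e. \<Sum>zs\<in>?W. f zs (i div e) (j div e) (i mod e) (j mod e))"
      using True
      by (simp add: coefficient_def quadratic_form_sum[OF T] vec_tensor_def
          word_mat_tensor[of X u d v e, OF uc vc] sum_distrib_left sum_distrib_right f_def mult_ac)
    also have "\<dots> = (\<Sum>i<d * e. \<Sum>zs\<in>?W. \<Sum>j<d * e. f zs (i div e) (j div e) (i mod e) (j mod e))"
      by (intro sum.cong refl sum.swap)
    also have "\<dots> = (\<Sum>zs\<in>?W. \<Sum>i<d * e. \<Sum>j<d * e. f zs (i div e) (j div e) (i mod e) (j mod e))"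
      by (rule sum.swap)
    also have "\<dots> = (\<Sum>zs\<in>?W. \<Sum>a<d. \<Sum>k<e. \<Sum>b<d. \<Sum>l<e. f zs a b k l)"
    proof (rule sum.cong[OF refl])
      fix zs
      have "(\<Sum>i<d * e. \<Sum>j<d * e. f zs (i div e) (j div e) (i mod e) (j mod e)) =
          (\<Sum>i<d * e. \<Sum>b<d. \<Sum>l<e. f zs (i div e) b (i mod e) l)"
        by (intro sum.cong refl sum_div_mod)
      then show "(\<Sum>i<d * e. \<Sum>j<d * e. f zs (i div e) (j div e) (i mod e) (j mod e)) =
          (\<Sum>a<d. \<Sum>k<e. \<Sum>b<d. \<Sum>l<e. f zs a b k l)"
        by (simp only: sum_div_mod[of "\<lambda>a k. \<Sum>b<d. \<Sum>l<e. f zs a b k l"])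
    qed
    also have "\<dots> = (\<Sum>zs\<in>?W. (\<Sum>a<d. \<Sum>b<d. ?U zs $$ (a, b) * \<eta> $ b * cnj (\<xi> $ a)) *
        (\<Sum>k<e. \<Sum>l<e. ?V zs $$ (k, l) * \<eta>' $ l * cnj (\<xi>' $ k)))"
      unfolding sum_product f_def ..
    also have "\<dots> = convolution X (coefficient X d u \<xi> \<eta>) (coefficient X e v \<xi>' \<eta>') w"
      unfolding convolution_def
      by (intro sum.cong refl) (simp only: coefficient_def wU wV if_True
          quadratic_form_sum[OF U \<xi>(1) \<eta>(1)] quadratic_form_sum[OF V \<xi>(2) \<eta>(2)])
    finally show ?thesis .
  next
    case False
    have "coefficient X d u \<xi> \<eta> (zip (map fst w) zs) * coefficient X e v \<xi>' \<eta>' (zip zs (map snd w)) = 0"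
      if zs: "zs \<in> ?W" for zs
    proof -
      obtain k where k: "k < length w" "fst (w ! k) \<notin> X \<or> snd (w ! k) \<notin> X"
        using False by (metis in_lists_conv_set in_set_conv_nth mem_Times_iff)
      then have "zip (map fst w) zs ! k = (fst (w ! k), zs ! k)" "zip zs (map snd w) ! k = (zs ! k, snd (w ! k))"
        "k < length (zip (map fst w) zs)" "k < length (zip zs (map snd w))"
        using zs by auto
      then have "(fst (w ! k), zs ! k) \<in> set (zip (map fst w) zs)"
        "(zs ! k, snd (w ! k)) \<in> set (zip zs (map snd w))"
        by (metis nth_mem)+
      then have "zip (map fst w) zs \<notin> lists (X \<times> X) \<or> zip zs (map snd w) \<notin> lists (X \<times> X)"
        using k(2) by (auto simp: in_lists_conv_set)
      then show ?thesis by (auto simp: coefficient_def)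
    qed
    then have "convolution X (coefficient X d u \<xi> \<eta>) (coefficient X e v \<xi>' \<eta>') w = 0"
      unfolding convolution_def by (intro sum.neutral ballI)
    then show ?thesis using False by (simp add: coefficient_def)
  qed
qed

lemma word_mat_contragredient:
  assumes u: "\<And>x y. x \<in> X \<Longrightarrow> y \<in> X \<Longrightarrow> u x y \<in> carrier_mat d d" and w: "w \<in> lists (X \<times> X)"
  shows "word_mat d (qp_contragredient u) w = map_mat cnj (word_mat d u (map prod.swap w))"
  using w
proof (induction w rule: list.induct)
  case Nil
  show ?case by (rule eq_matI) auto
next
  case (Cons p w)
  obtain x y where p: "p = (x, y)" by (cases p)
  have xy: "x \<in> X" "y \<in> X" and w: "w \<in> lists (X \<times> X)"
    using Cons.prems(1) by (simp_all add: p)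
  have s: "map prod.swap w \<in> lists (X \<times> X)" using w by fastforce
  note c = u[OF xy(2) xy(1)] word_mat_carrier[of X u d, OF u s]
  have "map_mat cnj (u y x * word_mat d u (map prod.swap w)) =
      map_mat cnj (u y x) * map_mat cnj (word_mat d u (map prod.swap w))"
    by (rule eq_matI) (use c in \<open>auto simp: scalar_prod_def\<close>)
  then show ?case using Cons.IH[OF w] by (simp add: p qp_contragredient_def)
qed

lemma coefficient_contragredient:
  assumes u: "quantum_permutation X d u" and \<xi>: "\<xi> \<in> carrier_vec d" and \<eta>: "\<eta> \<in> carrier_vec d"
  shows "coefficient X d (qp_contragredient u) (map_vec cnj \<xi>) (map_vec cnj \<eta>) =
    star_coefficient (coefficient X d u \<xi> \<eta>)"
proof
  fix w :: "'a word"
  have uc: "u x y \<in> carrier_mat d d" if "x \<in> X" "y \<in> X" for x y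
    using u that by (auto simp: quantum_permutation_def projection_mat_def)
  have s: "map prod.swap w \<in> lists (X \<times> X) \<longleftrightarrow> w \<in> lists (X \<times> X)"
    by (force simp: in_lists_conv_set)
  show "coefficient X d (qp_contragredient u) (map_vec cnj \<xi>) (map_vec cnj \<eta>) w =
    star_coefficient (coefficient X d u \<xi> \<eta>) w"
  proof (cases "w \<in> lists (X \<times> X)")
    case True
    have M: "word_mat d u (map prod.swap w) \<in> carrier_mat d d"
      using word_mat_carrier[of X u d, OF uc] s True by blast
    then have M': "map_mat cnj (word_mat d u (map prod.swap w)) \<in> carrier_mat d d" by simp
    show ?thesis
      using True s M \<xi> \<eta>
      by (simp add: coefficient_def star_coefficient_def word_mat_contragredient[of X u d, OF uc]
          quadratic_form_sum[OF M \<xi> \<eta>] quadratic_form_sum[OF M'])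
  qed (use s in \<open>auto simp: coefficient_def star_coefficient_def\<close>)
qed

lemma coefficient_trivial:
  "coefficient X 1 qp_trivial (unit_vec 1 0) (unit_vec 1 0) = unit_coefficient X"
proof
  fix w :: "'a word"
  have z: "(0\<^sub>m (Suc 0) (Suc 0) *\<^sub>v unit_vec (Suc 0) 0) \<bullet>c unit_vec (Suc 0) 0 = (0 :: complex)"
    by (simp add: scalar_prod_def)
  have "word_mat 1 qp_trivial w = (if \<forall>(x, y) \<in> set w. x = y then 1\<^sub>m 1 else 0\<^sub>m 1 1)"
    by (induction w) (auto simp: qp_trivial_def)
  then show "coefficient X 1 qp_trivial (unit_vec 1 0) (unit_vec 1 0) w = unit_coefficient X w"
    by (auto simp: coefficient_def unit_coefficient_def z)
qed

lemma adjoint_entry: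
  assumes "p \<in> carrier_mat d d" "i < d" "j < d"
  shows "mat_adjoint p $$ (i, j) = cnj (p $$ (j, i))"
  using assms by (simp add: mat_adjoint_def mat_of_rows_def)

lemma projection_mat_iff:
  "projection_mat d p \<longleftrightarrow> p \<in> carrier_mat d d \<and> p * p = p \<and>
     (\<forall>i<d. \<forall>j<d. cnj (p $$ (j, i)) = p $$ (i, j))"
proof (cases "p \<in> carrier_mat d d")
  case True
  then have "mat_adjoint p \<in> carrier_mat d d" by (auto simp: mat_adjoint_def)
  then have "mat_adjoint p = p \<longleftrightarrow> (\<forall>i<d. \<forall>j<d. mat_adjoint p $$ (i, j) = p $$ (i, j))"
    using True by (metis carrier_matD eq_matI)
  then show ?thesis using True by (auto simp: projection_mat_def adjoint_entry)
qed (simp add: projection_mat_def)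

lemma qp_tensor_mult:
  assumes u: "quantum_permutation X d u" and v: "quantum_permutation X e v"
    and X: "x \<in> X" "y \<in> X" "x' \<in> X" "y' \<in> X" and ij: "i < d * e" "j < d * e"
  shows "(qp_tensor X d e u v x y * qp_tensor X d e u v x' y') $$ (i, j) =
    (\<Sum>z\<in>X. \<Sum>z'\<in>X. (u x z * u x' z') $$ (i div e, j div e) * (v z y * v z' y') $$ (i mod e, j mod e))"
proof -
  have uc: "u x y \<in> carrier_mat d d" and vc: "v x y \<in> carrier_mat e e" if "x \<in> X" "y \<in> X" for x y
    using u v that by (auto simp: quantum_permutation_def projection_mat_def)
  note b = div_mod_less[OF ij(1)] div_mod_less[OF ij(2)]
  define f where "f z z' a b = (u x z $$ (i div e, a) * u x' z' $$ (a, j div e)) *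
     (v z y $$ (i mod e, b) * v z' y' $$ (b, j mod e))" for z z' a b
  have "(qp_tensor X d e u v x y * qp_tensor X d e u v x' y') $$ (i, j) =
      (\<Sum>k<d * e. qp_tensor X d e u v x y $$ (i, k) * qp_tensor X d e u v x' y' $$ (k, j))"
    by (rule index_mult_sum) (use ij in \<open>auto simp: qp_tensor_def\<close>)
  also have "\<dots> = (\<Sum>k<d * e. \<Sum>z\<in>X. \<Sum>z'\<in>X. f z z' (k div e) (k mod e))"
    using ij by (intro sum.cong refl) (simp add: qp_tensor_def sum_product f_def mult_ac)
  also have "\<dots> = (\<Sum>z\<in>X. \<Sum>k<d * e. \<Sum>z'\<in>X. f z z' (k div e) (k mod e))"
    by (rule sum.swap)
  also have "\<dots> = (\<Sum>z\<in>X. \<Sum>z'\<in>X. \<Sum>k<d * e. f z z' (k div e) (k mod e))"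
    by (intro sum.cong refl sum.swap)
  also have "\<dots> = (\<Sum>z\<in>X. \<Sum>z'\<in>X. \<Sum>a<d. \<Sum>b<e. f z z' a b)"
    by (simp only: sum_div_mod)
  also have "\<dots> = (\<Sum>z\<in>X. \<Sum>z'\<in>X.
      (u x z * u x' z') $$ (i div e, j div e) * (v z y * v z' y') $$ (i mod e, j mod e))"
    unfolding f_def sum_product[symmetric]
    by (intro sum.cong refl) (simp add: index_mult_sum[OF uc uc b(1) b(3)]
        index_mult_sum[OF vc vc b(2) b(4)] X)
  finally show ?thesis .
qed

lemma qp_mult_row:
  assumes "quantum_permutation X d u" "x \<in> X" "y \<in> X" "z \<in> X"
  shows "u x y * u x z = (if y = z then u x y else 0\<^sub>m d d)"
  using assms by (auto simp: quantum_permutation_def projection_mat_def)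

lemma qp_mult_col:
  assumes "quantum_permutation X d u" "x \<in> X" "y \<in> X" "z \<in> X"
  shows "u x y * u z y = (if x = z then u x y else 0\<^sub>m d d)"
  using assms by (auto simp: quantum_permutation_def projection_mat_def)

lemma sum_mat_eq_one_iff:
  "sum_mat d f X = 1\<^sub>m d \<longleftrightarrow> (\<forall>i<d. \<forall>j<d. (\<Sum>x\<in>X. f x $$ (i, j)) = (if i = j then 1 else 0))"
  by (auto simp: sum_mat_def mat_eq_iff)

lemma quantum_permutation_tensor:
  assumes fin: "finite X" and u: "quantum_permutation X d u" and v: "quantum_permutation X e v"
  shows "quantum_permutation X (d * e) (qp_tensor X d e u v)"
proof -
  let ?T = "qp_tensor X d e u v"
  have row: "?T x y * ?T x z = (if y = z then ?T x y else 0\<^sub>m (d * e) (d * e))"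
    if X: "x \<in> X" "y \<in> X" "z \<in> X" for x y z
  proof (rule eq_matI)
    fix i j assume "i < dim_row (if y = z then ?T x y else 0\<^sub>m (d * e) (d * e))"
      "j < dim_col (if y = z then ?T x y else 0\<^sub>m (d * e) (d * e))"
    then have ij: "i < d * e" "j < d * e" by (auto simp: qp_tensor_def split: if_splits)
    note b = div_mod_less[OF ij(1)] div_mod_less[OF ij(2)]
    have "(?T x y * ?T x z) $$ (i, j) = (\<Sum>a\<in>X. \<Sum>c\<in>X. if a = c then
        u x a $$ (i div e, j div e) * (v a y * v c z) $$ (i mod e, j mod e) else 0)"
      unfolding qp_tensor_mult[OF u v X(1,2,1,3) ij]
      by (intro sum.cong refl) (simp add: qp_mult_row[OF u X(1)] b)
    also have "\<dots> = (\<Sum>a\<in>X. u x a $$ (i div e, j div e) * (v a y * v a z) $$ (i mod e, j mod e))"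
      using fin by simp
    also have "\<dots> = (\<Sum>a\<in>X. u x a $$ (i div e, j div e) *
        (if y = z then v a y else 0\<^sub>m e e) $$ (i mod e, j mod e))"
      by (intro sum.cong refl) (simp add: qp_mult_row[OF v _ X(2,3)])
    also have "\<dots> = (if y = z then ?T x y else 0\<^sub>m (d * e) (d * e)) $$ (i, j)"
      using ij b by (simp add: qp_tensor_def)
    finally show "(?T x y * ?T x z) $$ (i, j) = \<dots>" .
  qed (auto simp: qp_tensor_def)
  have col: "?T x y * ?T z y = 0\<^sub>m (d * e) (d * e)"
    if X: "x \<in> X" "y \<in> X" "z \<in> X" "x \<noteq> z" for x y z
  proof (rule eq_matI)
    fix i j assume "i < dim_row (0\<^sub>m (d * e) (d * e) :: complex mat)"
      "j < dim_col (0\<^sub>m (d * e) (d * e) :: complex mat)"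
    then have ij: "i < d * e" "j < d * e" by auto
    note b = div_mod_less[OF ij(1)] div_mod_less[OF ij(2)]
    have "(?T x y * ?T z y) $$ (i, j) = (\<Sum>a\<in>X. \<Sum>c\<in>X. 0)"
      unfolding qp_tensor_mult[OF u v X(1,2,3,2) ij]
    proof (intro sum.cong refl)
      fix a c assume "a \<in> X" "c \<in> X"
      then show "(u x a * u z c) $$ (i div e, j div e) * (v a y * v c y) $$ (i mod e, j mod e) = 0"
        using b X by (cases "a = c") (simp_all add: qp_mult_col[OF u] qp_mult_col[OF v])
    qed
    then show "(?T x y * ?T z y) $$ (i, j) = 0\<^sub>m (d * e) (d * e) $$ (i, j)"
      using ij by simp
  qed (auto simp: qp_tensor_def)
  have proj: "projection_mat (d * e) (?T x y)" if X: "x \<in> X" "y \<in> X" for x y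
  proof -
    have "cnj (?T x y $$ (j, i)) = ?T x y $$ (i, j)" if ij: "i < d * e" "j < d * e" for i j
      using ij X u v div_mod_less[OF ij(1)] div_mod_less[OF ij(2)]
      by (simp add: qp_tensor_def quantum_permutation_def projection_mat_iff)
    then show ?thesis using row[OF X(1,2,2)] by (simp add: projection_mat_iff) (simp add: qp_tensor_def)
  qed
  have sums: "(\<Sum>y\<in>X. u x y $$ (i, j)) = (if i = j then 1 else 0)"
    "(\<Sum>y\<in>X. u y x $$ (i, j)) = (if i = j then 1 else 0)"
    if "quantum_permutation X d u" "x \<in> X" "i < d" "j < d"
    for d x i j and u :: "'a \<Rightarrow> 'a \<Rightarrow> complex mat"
    using that by (auto simp: quantum_permutation_def sum_mat_eq_one_iff)
  have eq: "i = j \<longleftrightarrow> i div e = j div e \<and> i mod e = j mod e" for i j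
    by (metis div_mult_mod_eq)
  have rs: "(\<Sum>y\<in>X. ?T x y $$ (i, j)) = (if i = j then 1 else 0)"
    and cs: "(\<Sum>y\<in>X. ?T y x $$ (i, j)) = (if i = j then 1 else 0)"
    if x: "x \<in> X" and ij: "i < d * e" "j < d * e" for x i j
  proof -
    note b = div_mod_less[OF ij(1)] div_mod_less[OF ij(2)]
    have "(\<Sum>y\<in>X. ?T x y $$ (i, j)) =
        (\<Sum>z\<in>X. \<Sum>y\<in>X. u x z $$ (i div e, j div e) * v z y $$ (i mod e, j mod e))"
      using ij by (subst sum.swap) (simp add: qp_tensor_def)
    also have "\<dots> = (\<Sum>z\<in>X. u x z $$ (i div e, j div e)) * (if i mod e = j mod e then 1 else 0)"
      unfolding sum_distrib_right sum_distrib_left[symmetric]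
      by (intro sum.cong refl arg_cong2[where f = "(*)"] sums(1)[OF v _ b(2,4)])
    also have "\<dots> = (if i = j then 1 else 0)"
      unfolding sums(1)[OF u x b(1,3)] using eq[of i j] by simp
    finally show "(\<Sum>y\<in>X. ?T x y $$ (i, j)) = (if i = j then 1 else 0)" .
    have "(\<Sum>y\<in>X. ?T y x $$ (i, j)) =
        (\<Sum>z\<in>X. \<Sum>y\<in>X. u y z $$ (i div e, j div e) * v z x $$ (i mod e, j mod e))"
      using ij by (subst sum.swap) (simp add: qp_tensor_def)
    also have "\<dots> = (if i div e = j div e then 1 else 0) * (\<Sum>z\<in>X. v z x $$ (i mod e, j mod e))"
      unfolding sum_distrib_left sum_distrib_right[symmetric]
      by (intro sum.cong refl arg_cong2[where f = "(*)"] sums(2)[OF u _ b(1,3)])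
    also have "\<dots> = (if i = j then 1 else 0)"
      unfolding sums(2)[OF v x b(2,4)] using eq[of i j] by simp
    finally show "(\<Sum>y\<in>X. ?T y x $$ (i, j)) = (if i = j then 1 else 0)" .
  qed
  show ?thesis
    unfolding quantum_permutation_def sum_mat_eq_one_iff
    using row col proj rs cs by auto
qed

lemma quantum_permutation_contragredient:
  assumes u: "quantum_permutation X d u"
  shows "quantum_permutation X d (qp_contragredient u)"
proof -
  have uc: "u x y \<in> carrier_mat d d" if "x \<in> X" "y \<in> X" for x y
    using u that by (auto simp: quantum_permutation_def projection_mat_def)
  have m: "map_mat cnj A * map_mat cnj B = map_mat cnj (A * B)"
    if "A \<in> carrier_mat d d" "B \<in> carrier_mat d d" for A B
    by (rule eq_matI) (use that in \<open>auto simp: scalar_prod_def\<close>)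
  have z: "map_mat cnj (0\<^sub>m d d) = 0\<^sub>m d d" by (rule eq_matI) auto
  have p: "projection_mat d (map_mat cnj A)" if "projection_mat d A" for A
    using that m[of A A] by (auto simp: projection_mat_iff)
  have s: "(\<Sum>x\<in>X. map_mat cnj (f x) $$ (i, j)) = cnj (\<Sum>x\<in>X. f x $$ (i, j))"
    if "\<And>x. x \<in> X \<Longrightarrow> f x \<in> carrier_mat d d" "i < d" "j < d" for f i j
    using that by (simp add: carrier_matD[OF that(1)])
  have c01: "cnj (if b then 1 else 0) = (if b then 1 else 0)" for b by simp
  show ?thesis
    using u unfolding quantum_permutation_def qp_contragredient_def sum_mat_eq_one_iff
    by (simp add: p m uc z s c01)
qed

lemma quantum_permutation_trivial: "finite X \<Longrightarrow> quantum_permutation X 1 qp_trivial"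
  by (auto simp: quantum_permutation_def qp_trivial_def projection_mat_iff sum_mat_eq_one_iff
      if_distrib[where f = "\<lambda>A. A $$ _"] cong: if_cong)

lemma coefficients_convolution:
  assumes "finite X" "\<phi> \<in> coefficients X" "\<psi> \<in> coefficients X"
  shows "convolution X \<phi> \<psi> \<in> coefficients X"
  using assms(2)
proof induction
  case (coeff d u \<xi> \<eta>)
  from assms(3) show ?case
  proof induction
    case (coeff e v \<xi>' \<eta>')
    have "vec_tensor d e a b \<in> carrier_vec (d * e)" for a b by (simp add: vec_tensor_def)
    then show ?case
      using coefficients.coeff[OF quantum_permutation_tensor[OF assms(1)]]
        coefficient_tensor coeff.hyps \<open>quantum_permutation X d u\<close> \<open>\<xi> \<in> carrier_vec d\<close>
        \<open>\<eta> \<in> carrier_vec d\<close> by metis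
  next
    case zero
    then show ?case using coefficients.zero by (simp add: convolution_def)
  next
    case (add \<phi> \<psi>)
    then show ?case using coefficients.add[OF add.IH]
      by (simp add: convolution_def distrib_left sum.distrib)
  next
    case (smult \<phi> c)
    then show ?case using coefficients.smult[OF smult.IH, of c]
      by (simp add: convolution_def sum_distrib_left mult_ac)
  qed
next
  case zero
  then show ?case using coefficients.zero by (simp add: convolution_def)
next
  case (add \<phi> \<psi>)
  then show ?case using coefficients.add[OF add.IH]
    by (simp add: convolution_def distrib_right sum.distrib)
next
  case (smult \<phi> c)
  then show ?case using coefficients.smult[OF smult.IH, of c]
    by (simp add: convolution_def sum_distrib_left mult_ac)
qed

lemma coefficients_star:
  assumes "\<phi> \<in> coefficients X"
  shows "star_coefficient \<phi> \<in> coefficients X"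
  using assms
proof induction
  case (coeff d u \<xi> \<eta>)
  then show ?case
    using coefficients.coeff[OF quantum_permutation_contragredient[of X d u],
        of "map_vec cnj \<xi>" "map_vec cnj \<eta>"]
    by (simp add: coefficient_contragredient)
next
  case zero
  then show ?case using coefficients.zero by (simp add: star_coefficient_def)
next
  case (add \<phi> \<psi>)
  then show ?case using coefficients.add[OF add.IH] by (simp add: star_coefficient_def)
next
  case (smult \<phi> c)
  then show ?case using coefficients.smult[OF smult.IH, of "cnj c"] by (simp add: star_coefficient_def)
qed

lemma coefficients_unit: "finite X \<Longrightarrow> unit_coefficient X \<in> coefficients X"
  using coefficients.coeff[OF quantum_permutation_trivial, of X "unit_vec 1 0" "unit_vec 1 0"]
  by (simp add: coefficient_trivial[simplified])


section \<open>Discrete quantum groups\<close>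

text \<open>
  A discrete quantum group \<open>G\<close> is given by the Hopf \<open>*\<close>-algebra \<open>A = \<O>(\<hat>G)\<close> of its compact dual.  An
  element of the algebraic tensor product \<open>A \<otimes> A\<close> is represented by lists
  \<open>[(a\<^sub>1, b\<^sub>1), \<dots>, (a\<^sub>k, b\<^sub>k)]\<close> standing for \<open>\<Sum>i. a\<^sub>i \<otimes> b\<^sub>i\<close>;
  \<open>hcomult A a\<close> is the set of all lists which represent \<open>\<Delta>(a)\<close>.
\<close>

record 'a hopf_star_algebra = "(complex, 'a) module" +
  hstar :: "'a \<Rightarrow> 'a"
  hcomult :: "'a \<Rightarrow> ('a \<times> 'a) list set"
  hcounit :: "'a \<Rightarrow> complex"
  hantipode :: "'a \<Rightarrow> 'a"

text \<open>
  \<open>h\<close> is normalised and satisfies \<open>(h \<otimes> id) \<Delta>(a) = h(a) 1 = (id \<otimes> h) \<Delta>(a)\<close>.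
\<close>

definition is_haar :: "('a, 'm) hopf_star_algebra_scheme \<Rightarrow> ('a \<Rightarrow> complex) \<Rightarrow> bool" where
  "is_haar A h \<longleftrightarrow>
     (\<forall>a\<in>carrier A. \<forall>b\<in>carrier A. h (a \<oplus>\<^bsub>A\<^esub> b) = h a + h b) \<and>
     (\<forall>c. \<forall>a\<in>carrier A. h (c \<odot>\<^bsub>A\<^esub> a) = c * h a) \<and>
     h \<one>\<^bsub>A\<^esub> = 1 \<and>
     (\<forall>a\<in>carrier A. \<forall>ps\<in>hcomult A a.
        foldr (\<lambda>(b, c) s. (h b \<odot>\<^bsub>A\<^esub> c) \<oplus>\<^bsub>A\<^esub> s) ps \<zero>\<^bsub>A\<^esub> = h a \<odot>\<^bsub>A\<^esub> \<one>\<^bsub>A\<^esub> \<and>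
        foldr (\<lambda>(b, c) s. (h c \<odot>\<^bsub>A\<^esub> b) \<oplus>\<^bsub>A\<^esub> s) ps \<zero>\<^bsub>A\<^esub> = h a \<odot>\<^bsub>A\<^esub> \<one>\<^bsub>A\<^esub>)"

text \<open>The conditions determine the Haar state on the carrier, which is all that matters.\<close>

definition haar :: "('a, 'm) hopf_star_algebra_scheme \<Rightarrow> 'a \<Rightarrow> complex" where
  "haar A = (SOME h. is_haar A h)"

definition l2_norm :: "('a, 'm) hopf_star_algebra_scheme \<Rightarrow> 'a \<Rightarrow> real" where
  "l2_norm A a = sqrt (Re (haar A (hstar A a \<otimes>\<^bsub>A\<^esub> a)))"

text \<open>
  The norm of \<open>C\<^sup>*\<^sub>r(G)\<close> on \<open>A\<close>: the operator norm of left multiplication in the GNS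
  representation of the Haar state.
\<close>

definition reduced_norm :: "('a, 'm) hopf_star_algebra_scheme \<Rightarrow> 'a \<Rightarrow> real" where
  "reduced_norm A a = (SUP b \<in> {b \<in> carrier A. l2_norm A b \<le> 1}. l2_norm A (a \<otimes>\<^bsub>A\<^esub> b))"

text \<open>
  The reduced \<open>C\<^sup>*\<close>-algebra is the completion of \<open>A\<close> in the reduced norm.  Its elements are
  represented by Cauchy sequences in \<open>A\<close>, two of which represent the same element if the norm of
  their difference is \<open>0\<close>; the algebraic operations are the pointwise ones.
\<close>

definition reduced_algebra :: "('a, 'm) hopf_star_algebra_scheme \<Rightarrow> (nat \<Rightarrow> 'a) set" where
  "reduced_algebra A = {a. (\<forall>k. a k \<in> carrier A) \<and>
     (\<forall>e>0. \<exists>N. \<forall>k\<ge>N. \<forall>l\<ge>N. reduced_norm A (a k \<ominus>\<^bsub>A\<^esub> a l) < e)}"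

definition reduced_algebra_norm ::
  "('a, 'm) hopf_star_algebra_scheme \<Rightarrow> (nat \<Rightarrow> 'a) \<Rightarrow> real" where
  "reduced_algebra_norm A a = lim (\<lambda>k. reduced_norm A (a k))"

definition bounded_star_hom ::
  "('a, 'm) hopf_star_algebra_scheme \<Rightarrow> ((nat \<Rightarrow> 'a) \<Rightarrow> complex) \<Rightarrow> bool" where
  "bounded_star_hom A F \<longleftrightarrow>
     (\<forall>a\<in>reduced_algebra A. \<forall>b\<in>reduced_algebra A.
        reduced_algebra_norm A (\<lambda>k. a k \<ominus>\<^bsub>A\<^esub> b k) = 0 \<longrightarrow> F a = F b) \<and>
     (\<forall>a\<in>reduced_algebra A. \<forall>b\<in>reduced_algebra A.
        F (\<lambda>k. a k \<oplus>\<^bsub>A\<^esub> b k) = F a + F b \<and> F (\<lambda>k. a k \<otimes>\<^bsub>A\<^esub> b k) = F a * F b) \<and>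
     (\<forall>c. \<forall>a\<in>reduced_algebra A. F (\<lambda>k. c \<odot>\<^bsub>A\<^esub> a k) = c * F a) \<and>
     (\<forall>a\<in>reduced_algebra A. F (\<lambda>k. hstar A (a k)) = cnj (F a)) \<and>
     (\<exists>C. \<forall>a\<in>reduced_algebra A. norm (F a) \<le> C * reduced_algebra_norm A a)"

text \<open>
  \<open>G\<close> is amenable if the counit of \<open>A = \<O>(\<hat>G)\<close> extends to a bounded \<open>*\<close>-homomorphism
  on \<open>C\<^sup>*\<^sub>r(G)\<close>; \<open>a \<in> A\<close> is the class of the constant sequence.
\<close>

definition amenable :: "('a, 'm) hopf_star_algebra_scheme \<Rightarrow> bool" where
  "amenable A \<longleftrightarrow>
     (\<exists>F. bounded_star_hom A F \<and> (\<forall>a\<in>carrier A. F (\<lambda>k. a) = hcounit A a))"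


section \<open>The discrete quantum group of finite dimensional quantum permutations\<close>

text \<open>
  Tannaka-Krein reconstruction from the category of finite dimensional quantum permutations of \<open>X\<close>
  and its forgetful functor: \<open>\<O>(\<hat>G)\<close> is spanned by the matrix coefficients of the objects, with
  product and involution given on coefficients by the tensor product and the contragredient; see
  \<open>coefficient_tensor\<close> and \<open>coefficient_contragredient\<close>.
  The coproduct is dual to the product of the universal algebra, \<open>\<Delta>(\<phi>)(a \<otimes> b) = \<phi>(a b)\<close>, and
  the counit is evaluation at its unit, so \<open>\<langle>\<xi>, u \<eta>\<rangle> \<mapsto> \<langle>\<xi>, \<eta>\<rangle>\<close>.
\<close>

definition coefficient_algebra :: "'x set \<Rightarrow> ('x word \<Rightarrow> complex) hopf_star_algebra" where
  "coefficient_algebra X =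
     \<lparr> carrier = coefficients X,
       monoid.mult = convolution X,
       one = unit_coefficient X,
       zero = (\<lambda>w. 0),
       add = (\<lambda>\<phi> \<psi> w. \<phi> w + \<psi> w),
       module.smult = (\<lambda>c \<phi> w. c * \<phi> w),
       hstar = star_coefficient,
       hcomult = (\<lambda>\<phi>. {ps. set ps \<subseteq> coefficients X \<times> coefficients X \<and>
         (\<forall>v w. \<phi> (v @ w) = (\<Sum>(\<alpha>, \<beta>) \<leftarrow> ps. \<alpha> v * \<beta> w))}),
       hcounit = (\<lambda>\<phi>. \<phi> []),
       hantipode = antipode_coefficient \<rparr>"

definition Sigma_plus :: "nat \<Rightarrow> (nat word \<Rightarrow> complex) hopf_star_algebra" where
  "Sigma_plus n = coefficient_algebra {1..n}"

end

theory Submission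
  imports Defs
begin

text \<open>
  For a quantum permutation \<open>u\<close> the product of the projections \<open>u\<^bsub>xx\<^esub>\<close>, taken back and forth over all
  \<open>x\<close>, has powers converging to the projection onto the fixed vectors of \<open>u\<close>.  Hence the Haar state is
  \<open>h(f) = lim f(W\<^sup>k)\<close> for a diagonal word \<open>W\<close>.  In this form \<open>(f\<^sup>* f)(W\<^sup>k)\<close> is visibly a sum of squares,
  so \<open>h\<close> is positive, and evaluating both coproducts in two ways gives \<open>h(f g\<^sup>*) = h(g\<^sup>* f)\<close>.  For a
  self-adjoint \<open>a\<close>, iterating the Cauchy-Schwarz inequality and using traciality bounds the reduced norm
  of \<open>a\<close> by the growth rate of the moments \<open>h(a\<^sup>n)\<close>.  Under amenability this rate is at least the
  absolute value of the counit of \<open>a\<close>.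

  For \<open>n = 4\<close> every nonzero quaternion \<open>x\<close> yields a quantum permutation by the rank one projections onto
  the lines through \<open>c\<^sub>i x c\<^sub>j\<close>, where \<open>c = (1, i, j, k)\<close>.  Its character \<open>\<chi>\<^sub>x\<close> has counit \<open>4\<close>, and
  \<open>\<chi>\<^sub>x \<chi>\<^sub>y\<close> is the sum of the characters of \<open>x v y\<close> over \<open>v \<in> {1, i, j, k}\<close>.  Take \<open>a = \<chi>\<^sub>x\<close> with
  \<open>x = i + 2j + 2k\<close>.  The words \<open>x v x v' x \<dots>\<close> in which no \<open>v\<close> is \<open>1\<close> are congruent to \<open>x\<close> or \<open>-x\<close> modulo 3,
  so they are never multiples of \<open>1, i, j, k\<close> and \<open>h\<close> vanishes on their characters.  Counting
  cancellations in the powers of \<open>a\<close> gives \<open>\<bar>h(a\<^sup>n)\<bar> \<le> (7/2)\<^sup>n\<close>, whereas the counit of \<open>a\<close> is \<open>4\<close>.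
\<close>

section \<open>The convolution algebra of functions on words\<close>

text \<open>Through \<open>zip\<close>, the values of a function on words of length n over X form a
  matrix indexed by \<open>seqs X n\<close>. Convolution is then the matrix product,
  \<open>star_coefficient\<close> the adjoint and \<open>unit_coefficient\<close> the identity
  matrix.\<close>

definition seqs :: "'x set \<Rightarrow> nat \<Rightarrow> 'x list set" where
  "seqs X n = {zs. zs \<in> lists X \<and> length zs = n}"

lemma finite_seqs: "finite X \<Longrightarrow> finite (seqs X n)"
  using finite_lists_length_eq[of X n] by (simp add: seqs_def lists_eq_set)

lemma seqs_0 [simp]: "seqs X 0 = {[]}"
  by (auto simp: seqs_def)

lemma sum_seqs_Suc:
  "(\<Sum>zs\<in>seqs X (Suc n). f zs) = (\<Sum>z\<in>X. \<Sum>zs\<in>seqs X n. (f (z # zs) :: complex))"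
  unfolding seqs_def by (rule sum_words_Suc)

lemma convolution_seqs:
  "convolution X \<phi> \<psi> w =
     (\<Sum>zs\<in>seqs X (length w). \<phi> (zip (map fst w) zs) * \<psi> (zip zs (map snd w)))"
  by (simp add: convolution_def seqs_def)

lemma length_seqs: "zs \<in> seqs X n \<Longrightarrow> length zs = n"
  by (simp add: seqs_def)

lemma zip_in_lists_iff:
  "length a = length b \<Longrightarrow> zip a b \<in> lists (X \<times> X) \<longleftrightarrow> a \<in> lists X \<and> b \<in> lists X"
  by (induction a b rule: list_induct2) auto

lemma zip_map_fst_snd: "zip (map fst w) (map snd w) = w"
  by (induction w) auto

lemma convolution_assoc:
  "convolution X (convolution X \<phi> \<psi>) \<chi> = convolution X \<phi> (convolution X \<psi> \<chi>)"
proof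
  fix w :: "'a word"
  let ?S = "seqs X (length w)"
  have "convolution X (convolution X \<phi> \<psi>) \<chi> w =
      (\<Sum>zs\<in>?S. \<Sum>ys\<in>?S. \<phi> (zip (map fst w) ys) * \<psi> (zip ys zs) * \<chi> (zip zs (map snd w)))"
    by (simp add: convolution_seqs sum_distrib_right length_seqs)
  also have "\<dots> = (\<Sum>ys\<in>?S. \<Sum>zs\<in>?S. \<phi> (zip (map fst w) ys) * \<psi> (zip ys zs) * \<chi> (zip zs (map snd w)))"
    by (rule sum.swap)
  also have "\<dots> = convolution X \<phi> (convolution X \<psi> \<chi>) w"
    by (simp add: convolution_seqs sum_distrib_left length_seqs mult.assoc)
  finally show "convolution X (convolution X \<phi> \<psi>) \<chi> w = convolution X \<phi> (convolution X \<psi> \<chi>) w" .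
qed

lemma map_swap_zip: "length a = length b \<Longrightarrow> map prod.swap (zip a b) = zip b a"
  by (induction a b rule: list_induct2) auto

lemma star_zip: "length a = length b \<Longrightarrow> star_coefficient \<phi> (zip a b) = cnj (\<phi> (zip b a))"
  by (simp add: star_coefficient_def map_swap_zip)

lemma star_star [simp]: "star_coefficient (star_coefficient \<phi>) = \<phi>"
  by (simp add: star_coefficient_def fun_eq_iff comp_def)

lemma star_convolution:
  "star_coefficient (convolution X \<phi> \<psi>) = convolution X (star_coefficient \<psi>) (star_coefficient \<phi>)"
proof
  fix w :: "'a word"
  have m: "map fst (map prod.swap w) = map snd w" "map snd (map prod.swap w) = map fst w"
    by simp_all
  show "star_coefficient (convolution X \<phi> \<psi>) w =
      convolution X (star_coefficient \<psi>) (star_coefficient \<phi>) w"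
    unfolding convolution_seqs star_coefficient_def[of "convolution X \<phi> \<psi>"] m
    by (simp add: star_zip length_seqs mult.commute)
qed

lemma convolution_sum_left:
  "convolution X (\<lambda>w. \<Sum>i\<in>I. \<phi> i w) \<psi> = (\<lambda>w. \<Sum>i\<in>I. convolution X (\<phi> i) \<psi> w)"
  by (simp add: convolution_seqs sum_distrib_right fun_eq_iff sum.swap[of _ I])

text \<open>Diagonal entries of a matrix product whose left factor is an adjoint are inner products
  of columns. For equal factors they are sums of squares, the source of positivity of the Haar
  state.\<close>

lemma star_convolution_diag:
  "convolution X (star_coefficient \<phi>) \<psi> (zip w w) =
     (\<Sum>zs\<in>seqs X (length w). cnj (\<phi> (zip zs w)) * \<psi> (zip zs w))"
  by (simp add: convolution_seqs star_zip length_seqs)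

lemma convolution_star_diag:
  "convolution X \<phi> (star_coefficient \<psi>) (zip w w) =
     (\<Sum>zs\<in>seqs X (length w). \<phi> (zip w zs) * cnj (\<psi> (zip w zs)))"
  by (simp add: convolution_seqs star_zip length_seqs)

lemma unit_coefficient_zip:
  "length a = length b \<Longrightarrow> unit_coefficient X (zip a b) = (if a = b \<and> a \<in> lists X then 1 else 0)"
proof -
  assume l: "length a = length b"
  then have "(\<forall>(x, y)\<in>set (zip a b). x = y) \<longleftrightarrow> a = b"
    by (induction a b rule: list_induct2) auto
  then show ?thesis using l by (auto simp: unit_coefficient_def zip_in_lists_iff)
qed

section \<open>Coefficients\<close>

lemma word_mat_append:
  assumes "\<And>x y. x \<in> X \<Longrightarrow> y \<in> X \<Longrightarrow> u x y \<in> carrier_mat d d"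
    and "v \<in> lists (X \<times> X)" "w \<in> lists (X \<times> X)"
  shows "word_mat d u (v @ w) = word_mat d u v * word_mat d u w"
  using assms(2)
proof (induction v rule: list.induct)
  case Nil
  have "word_mat d u w \<in> carrier_mat d d" by (rule word_mat_carrier[OF assms(1,3)])
  then show ?case by simp
next
  case (Cons p v)
  obtain x y where p: "p = (x, y)" by (cases p)
  have "x \<in> X" "y \<in> X" "v \<in> lists (X \<times> X)" using Cons.prems by (auto simp: p)
  then have c: "u x y \<in> carrier_mat d d" "word_mat d u v \<in> carrier_mat d d"
    "word_mat d u w \<in> carrier_mat d d" and "word_mat d u (v @ w) = word_mat d u v * word_mat d u w"
    using Cons.IH assms(1)[of x y] word_mat_carrier[of X u d, OF assms(1)] assms(3) by auto
  then show ?case by (simp add: p)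
qed

lemma qp_carrier:
  "quantum_permutation X d u \<Longrightarrow> x \<in> X \<Longrightarrow> y \<in> X \<Longrightarrow> u x y \<in> carrier_mat d d"
  by (simp add: quantum_permutation_def projection_mat_def)

lemma coefficients_outside: "f \<in> coefficients X \<Longrightarrow> w \<notin> lists (X \<times> X) \<Longrightarrow> f w = 0"
  by (induction rule: coefficients.induct) (simp_all add: coefficient_def)

lemma coefficients_sum_list:
  assumes "\<And>p. p \<in> set ps \<Longrightarrow> g p \<in> coefficients X"
  shows "(\<lambda>w. \<Sum>p\<leftarrow>ps. c p * g p w) \<in> coefficients X"
  using assms
proof (induction ps)
  case (Cons p ps)
  then show ?case by (auto intro!: coefficients.add coefficients.smult)
qed (simp add: coefficients.zero)

lemma coefficients_sum:
  assumes "\<And>i. i \<in> I \<Longrightarrow> g i \<in> coefficients X"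
  shows "(\<lambda>w. \<Sum>i\<in>I. g i w) \<in> coefficients X"
  using assms
proof (induction I rule: infinite_finite_induct)
  case (insert i I)
  then show ?case by (simp add: coefficients.add)
qed (simp_all add: coefficients.zero)

text \<open>Inserts the standard basis between the two operators; for the two halves of a word this
  yields the coproduct of a matrix coefficient.\<close>

lemma mult_vec_cscalar_sum:
  fixes A B :: "complex mat"
  assumes "A \<in> carrier_mat d d" "B \<in> carrier_mat d d" "\<xi> \<in> carrier_vec d" "\<eta> \<in> carrier_vec d"
  shows "((A * B) *\<^sub>v \<eta>) \<bullet>c \<xi> =
    (\<Sum>i<d. ((A *\<^sub>v unit_vec d i) \<bullet>c \<xi>) * ((B *\<^sub>v \<eta>) \<bullet>c unit_vec d i))"
proof -
  have B: "(B *\<^sub>v \<eta>) \<bullet>c unit_vec d i = (B *\<^sub>v \<eta>) $ i" if "i < d" for i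
  proof -
    have "conjugate (unit_vec d i :: complex vec) = unit_vec d i"
      by (rule eq_vecI) (auto simp: unit_vec_def)
    then show ?thesis using that assms(2,4) by (simp add: scalar_prod_right_unit[of _ d] del: index_mult_mat_vec)
  qed
  have A: "(A *\<^sub>v unit_vec d i) \<bullet>c \<xi> = (\<Sum>k<d. A $$ (k, i) * cnj (\<xi> $ k))" if "i < d" for i
    using that assms by (simp add: scalar_prod_def lessThan_atLeast0 if_distrib[of "(*) _"] cong: if_cong)
  have "((A * B) *\<^sub>v \<eta>) = A *\<^sub>v (B *\<^sub>v \<eta>)" using assms by simp
  then have "((A * B) *\<^sub>v \<eta>) \<bullet>c \<xi> = (\<Sum>k<d. (\<Sum>i<d. A $$ (k, i) * (B *\<^sub>v \<eta>) $ i) * cnj (\<xi> $ k))"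
    using assms by (simp add: scalar_prod_def lessThan_atLeast0 del: index_mult_mat_vec)
      (simp add: scalar_prod_def lessThan_atLeast0)
  also have "\<dots> = (\<Sum>i<d. (\<Sum>k<d. A $$ (k, i) * cnj (\<xi> $ k)) * (B *\<^sub>v \<eta>) $ i)"
    unfolding sum_distrib_right by (subst sum.swap) (simp add: mult_ac)
  also have "\<dots> = (\<Sum>i<d. ((A *\<^sub>v unit_vec d i) \<bullet>c \<xi>) * ((B *\<^sub>v \<eta>) \<bullet>c unit_vec d i))"
    by (intro sum.cong refl) (simp only: A B lessThan_iff)
  finally show ?thesis .
qed

lemma coefficients_comult:
  assumes "f \<in> coefficients X"
  obtains ps where "set ps \<subseteq> coefficients X \<times> coefficients X"
    "\<And>v w. f (v @ w) = (\<Sum>(\<alpha>, \<beta>)\<leftarrow>ps. \<alpha> v * \<beta> w)"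
proof -
  from assms have "\<exists>ps. set ps \<subseteq> coefficients X \<times> coefficients X \<and>
    (\<forall>v w. f (v @ w) = (\<Sum>(\<alpha>, \<beta>)\<leftarrow>ps. \<alpha> v * \<beta> w))"
  proof induction
    case zero
    then show ?case by (intro exI[of _ "[]"]) simp
  next
    case (coeff d u \<xi> \<eta>)
    note uc = qp_carrier[OF coeff(1)]
    let ?e = "\<lambda>i. unit_vec d i :: complex vec"
    let ?ps = "map (\<lambda>i. (coefficient X d u \<xi> (?e i), coefficient X d u (?e i) \<eta>)) [0..<d]"
    have "coefficient X d u \<xi> \<eta> (v @ w) = (\<Sum>(\<alpha>, \<beta>)\<leftarrow>?ps. \<alpha> v * \<beta> w)" for v w
    proof -
      have s: "(\<Sum>(\<alpha>, \<beta>)\<leftarrow>?ps. \<alpha> v * \<beta> w) =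
          (\<Sum>i<d. coefficient X d u \<xi> (?e i) v * coefficient X d u (?e i) \<eta> w)"
        by (simp add: comp_def interv_sum_list_conv_sum_set_nat lessThan_atLeast0)
      show ?thesis
      proof (cases "v \<in> lists (X \<times> X) \<and> w \<in> lists (X \<times> X)")
        case True
        then show ?thesis
          using mult_vec_cscalar_sum[OF word_mat_carrier[of X u d, OF uc] word_mat_carrier[of X u d, OF uc]
              coeff(2,3), of v w] word_mat_append[of X u d v w, OF uc]
          unfolding s by (simp add: coefficient_def)
      next
        case False
        then show ?thesis unfolding s by (auto simp: coefficient_def)
      qed
    qed
    then show ?case using coeff by (intro exI[of _ ?ps]) (auto intro!: coefficients.coeff)
  next
    case (add \<phi> \<psi>)
    then obtain ps qs where "set ps \<subseteq> coefficients X \<times> coefficients X"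
      "\<forall>v w. \<phi> (v @ w) = (\<Sum>(\<alpha>, \<beta>)\<leftarrow>ps. \<alpha> v * \<beta> w)"
      "set qs \<subseteq> coefficients X \<times> coefficients X"
      "\<forall>v w. \<psi> (v @ w) = (\<Sum>(\<alpha>, \<beta>)\<leftarrow>qs. \<alpha> v * \<beta> w)" by blast
    then show ?case by (intro exI[of _ "ps @ qs"]) simp
  next
    case (smult \<phi> c)
    then obtain ps where ps: "set ps \<subseteq> coefficients X \<times> coefficients X"
      "\<forall>v w. \<phi> (v @ w) = (\<Sum>(\<alpha>, \<beta>)\<leftarrow>ps. \<alpha> v * \<beta> w)" by blast
    have "c * \<phi> (v @ w) = (\<Sum>(\<alpha>, \<beta>)\<leftarrow>map (\<lambda>(\<alpha>, \<beta>). ((\<lambda>w. c * \<alpha> w), \<beta>)) ps. \<alpha> v * \<beta> w)" for v w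
      using ps(2) by (simp add: sum_list_const_mult[symmetric] comp_def case_prod_beta mult.assoc)
    then show ?case using ps(1)
      by (intro exI[of _ "map (\<lambda>(\<alpha>, \<beta>). ((\<lambda>w. c * \<alpha> w), \<beta>)) ps"]) (auto intro!: coefficients.smult)
  qed
  then show thesis using that by blast
qed

text \<open>Evaluating one leg of the coproduct at a fixed word leaves a combination of the other
  legs. Such translates carry the analysis of the Haar state.\<close>

lemma coefficients_prefix:
  assumes "f \<in> coefficients X"
  shows "(\<lambda>w. f (v @ w)) \<in> coefficients X"
proof -
  obtain ps where ps: "set ps \<subseteq> coefficients X \<times> coefficients X"
    "\<And>v w. f (v @ w) = (\<Sum>(\<alpha>, \<beta>)\<leftarrow>ps. \<alpha> v * \<beta> w)" using coefficients_comult[OF assms] by blast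
  show ?thesis unfolding ps(2) case_prod_beta
    by (rule coefficients_sum_list) (use ps(1) in auto)
qed

lemma coefficients_suffix:
  assumes "f \<in> coefficients X"
  shows "(\<lambda>w. f (w @ v)) \<in> coefficients X"
proof -
  obtain ps where ps: "set ps \<subseteq> coefficients X \<times> coefficients X"
    "\<And>v w. f (v @ w) = (\<Sum>(\<alpha>, \<beta>)\<leftarrow>ps. \<alpha> v * \<beta> w)" using coefficients_comult[OF assms] by blast
  show ?thesis unfolding ps(2) case_prod_beta mult.commute[of "fst _ _"]
    by (rule coefficients_sum_list) (use ps(1) in auto)
qed

text \<open>Coefficients are functions on free words, so the magic unitary relations have to be
  recovered for them. Short words suffice, because translates carry the relations to any position in
  a word.\<close>

lemma coefficients_relations:
  assumes "f \<in> coefficients X"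
  shows coefficients_row: "x \<in> X \<Longrightarrow> y \<in> X \<Longrightarrow> z \<in> X \<Longrightarrow>
      f [(x, y), (x, z)] = (if y = z then f [(x, y)] else 0)"
    and coefficients_col: "x \<in> X \<Longrightarrow> y \<in> X \<Longrightarrow> z \<in> X \<Longrightarrow>
      f [(x, y), (z, y)] = (if x = z then f [(x, y)] else 0)"
    and coefficients_sum_row: "x \<in> X \<Longrightarrow> (\<Sum>y\<in>X. f [(x, y)]) = f []"
  using assms
proof induction
  case (coeff d u \<xi> \<eta>)
  note uc = qp_carrier[OF coeff(1)]
  have one: "coefficient X d u \<xi> \<eta> [(x, y)] = (u x y *\<^sub>v \<eta>) \<bullet>c \<xi>" if "x \<in> X" "y \<in> X" for x y
    using that uc[OF that] by (simp add: coefficient_def)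
  have two: "coefficient X d u \<xi> \<eta> [(x, y), (x', y')] = ((u x y * u x' y') *\<^sub>v \<eta>) \<bullet>c \<xi>"
    if "x \<in> X" "y \<in> X" "x' \<in> X" "y' \<in> X" for x y x' y'
    using that uc[OF that(1,2)] uc[OF that(3,4)] by (simp add: coefficient_def)
  have zero: "(0\<^sub>m d d *\<^sub>v \<eta>) \<bullet>c \<xi> = 0"
    using coeff by (simp add: quadratic_form_sum[of _ d])
  {
    case 1
    then show ?case using coeff(1) by (simp add: one two qp_mult_row zero)
  next
    case 2
    then show ?case using coeff(1) by (simp add: one two qp_mult_col zero)
  }
  have sums: "(\<Sum>a\<in>X. (g a *\<^sub>v \<eta>) \<bullet>c \<xi>) = coefficient X d u \<xi> \<eta> []"
    if g: "\<And>a. a \<in> X \<Longrightarrow> g a \<in> carrier_mat d d" and s: "sum_mat d g X = 1\<^sub>m d" for g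
  proof -
    have "(\<Sum>a\<in>X. (g a *\<^sub>v \<eta>) \<bullet>c \<xi>) = (\<Sum>a\<in>X. \<Sum>i<d. \<Sum>j<d. g a $$ (i, j) * \<eta> $ j * cnj (\<xi> $ i))"
      by (intro sum.cong refl quadratic_form_sum g coeff)
    also have "\<dots> = (\<Sum>i<d. \<Sum>a\<in>X. \<Sum>j<d. g a $$ (i, j) * \<eta> $ j * cnj (\<xi> $ i))"
      by (rule sum.swap)
    also have "\<dots> = (\<Sum>i<d. \<Sum>j<d. (\<Sum>a\<in>X. g a $$ (i, j)) * \<eta> $ j * cnj (\<xi> $ i))"
      by (subst sum.swap) (simp add: sum_distrib_right)
    also have "\<dots> = (\<Sum>i<d. \<Sum>j<d. 1\<^sub>m d $$ (i, j) * \<eta> $ j * cnj (\<xi> $ i))"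
      using s unfolding sum_mat_eq_one_iff by (intro sum.cong refl) simp
    also have "\<dots> = coefficient X d u \<xi> \<eta> []"
      by (simp add: coefficient_def quadratic_form_sum[OF one_carrier_mat coeff(2,3)] del: one_mult_mat_vec)
    finally show ?thesis .
  qed
  {
    case 3
    then show ?case
      using sums[of "\<lambda>y. u x y"] coeff(1) uc by (simp add: one quantum_permutation_def)
  }
next
  case zero
  {
    case 1 show ?case by simp
  next
    case 2 show ?case by simp
  next
    case 3 show ?case by simp
  }
next
  case (add \<phi> \<psi>)
  {
    case 1 then show ?case using add by simp
  next
    case 2 then show ?case using add by simp
  next
    case 3 then show ?case using add by (simp add: sum.distrib)
  }
next
  case (smult \<phi> c)
  {
    case 1 then show ?case using smult by simp
  next
    case 2 then show ?case using smult by simp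
  next
    case 3 then show ?case using smult by (simp add: sum_distrib_left[symmetric])
  }
qed

section \<open>The Haar state\<close>

definition diag_word :: "'x list \<Rightarrow> 'x word" where
  "diag_word a = zip a a"

text \<open>With A the product of the diagonal projections along \<open>xs\<close>, the word
  \<open>xs @ rev xs\<close> stands for A times its adjoint, a positive contraction, and
  \<open>pal xs k\<close> for its k-th power. Reversal, which is the adjoint on words, fixes these
  palindromes.\<close>

definition pal :: "'x list \<Rightarrow> nat \<Rightarrow> 'x list" where
  "pal xs k = concat (replicate k (xs @ rev xs))"

definition haar_limit :: "'x list \<Rightarrow> ('x word \<Rightarrow> complex) \<Rightarrow> complex" where
  "haar_limit xs f = lim (\<lambda>k. f (diag_word (pal xs k)))"

lemma diag_word_append [simp]: "diag_word (a @ b) = diag_word a @ diag_word b"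
  by (simp add: diag_word_def)

lemma diag_word_Cons [simp]: "diag_word (x # a) = (x, x) # diag_word a"
  by (simp add: diag_word_def)

lemma diag_word_Nil [simp]: "diag_word [] = []"
  by (simp add: diag_word_def)

lemma rev_diag_word: "rev (diag_word a) = diag_word (rev a)"
  by (simp add: diag_word_def zip_rev)

lemma diag_word_in_lists: "set a \<subseteq> X \<Longrightarrow> diag_word a \<in> lists (X \<times> X)"
  by (induction a) auto

lemma pal_0 [simp]: "pal xs 0 = []"
  by (simp add: pal_def)

lemma pal_Suc: "pal xs (Suc k) = xs @ rev xs @ pal xs k"
  by (simp add: pal_def)

lemma pal_add: "pal xs (m + n) = pal xs m @ pal xs n"
  by (simp add: pal_def replicate_add)

lemma rev_pal [simp]: "rev (pal xs k) = pal xs k"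
proof (induction k)
  case (Suc k)
  have "rev (pal xs (Suc k)) = rev (pal xs k) @ pal xs 1" by (simp add: pal_Suc)
  also have "\<dots> = pal xs (Suc k)" using Suc pal_add[of xs k 1] by simp
  finally show ?case .
qed simp

lemma set_pal: "set (pal xs k) \<subseteq> set xs"
  by (auto simp: pal_def)

lemma diag_pal_in_lists: "diag_word (pal xs k) \<in> lists (set xs \<times> set xs)"
  by (rule diag_word_in_lists) (rule set_pal)

section \<open>Inner products and projections in finite dimension\<close>

lemma cscalar_sum:
  assumes "\<eta> \<in> carrier_vec d" "\<xi> \<in> carrier_vec d"
  shows "\<eta> \<bullet>c \<xi> = (\<Sum>i<d. \<eta> $ i * cnj (\<xi> $ i))"
  using assms by (simp add: scalar_prod_def lessThan_atLeast0)

definition vnorm2 :: "complex vec \<Rightarrow> real" where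
  "vnorm2 \<eta> = (\<Sum>i<dim_vec \<eta>. (cmod (\<eta> $ i))\<^sup>2)"

lemma vnorm2_nonneg: "vnorm2 \<eta> \<ge> 0"
  by (simp add: vnorm2_def sum_nonneg)

lemma sum_mult_cnj: "(\<Sum>i\<in>I. f i * cnj (f i)) = complex_of_real (\<Sum>i\<in>I. (cmod (f i))\<^sup>2)"
  by (simp only: of_real_sum complex_norm_square)

lemma vnorm2_eq: "\<eta> \<bullet>c \<eta> = complex_of_real (vnorm2 \<eta>)"
  unfolding vnorm2_def sum_mult_cnj[symmetric] by (rule cscalar_sum) auto

lemma real_sum_Cauchy_Schwarz:
  fixes f g :: "'i \<Rightarrow> real"
  shows "(\<Sum>i\<in>I. f i * g i)\<^sup>2 \<le> (\<Sum>i\<in>I. (f i)\<^sup>2) * (\<Sum>i\<in>I. (g i)\<^sup>2)"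
proof -
  \<comment> \<open>Lagrange's identity: this double sum is twice the difference of the two
    sides.\<close>
  have "0 \<le> (\<Sum>i\<in>I. \<Sum>j\<in>I. (f i * g j - f j * g i)\<^sup>2)"
    by (intro sum_nonneg) simp
  also have "\<dots> = (\<Sum>i\<in>I. \<Sum>j\<in>I. (f i)\<^sup>2 * (g j)\<^sup>2) + (\<Sum>i\<in>I. \<Sum>j\<in>I. (f j)\<^sup>2 * (g i)\<^sup>2)
      - 2 * (\<Sum>i\<in>I. \<Sum>j\<in>I. (f i * g i) * (f j * g j))"
    by (simp add: power2_diff power_mult_distrib sum.distrib sum_subtractf sum_distrib_left mult_ac)
  also have "(\<Sum>i\<in>I. \<Sum>j\<in>I. (f j)\<^sup>2 * (g i)\<^sup>2) = (\<Sum>i\<in>I. \<Sum>j\<in>I. (f i)\<^sup>2 * (g j)\<^sup>2)"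
    by (rule sum.swap)
  finally show ?thesis
    by (simp add: sum_product power2_eq_square)
qed

lemma sum_Cauchy_Schwarz:
  fixes f g :: "'i \<Rightarrow> complex"
  shows "(cmod (\<Sum>i\<in>I. f i * cnj (g i)))\<^sup>2 \<le> (\<Sum>i\<in>I. (cmod (f i))\<^sup>2) * (\<Sum>i\<in>I. (cmod (g i))\<^sup>2)"
proof -
  have "cmod (\<Sum>i\<in>I. f i * cnj (g i)) \<le> (\<Sum>i\<in>I. cmod (f i) * cmod (g i))"
    by (rule order_trans[OF norm_sum]) (simp add: norm_mult)
  then have "(cmod (\<Sum>i\<in>I. f i * cnj (g i)))\<^sup>2 \<le> (\<Sum>i\<in>I. cmod (f i) * cmod (g i))\<^sup>2"
    by (rule power_mono) simp
  also have "\<dots> \<le> (\<Sum>i\<in>I. (cmod (f i))\<^sup>2) * (\<Sum>i\<in>I. (cmod (g i))\<^sup>2)"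
    by (rule real_sum_Cauchy_Schwarz)
  finally show ?thesis .
qed

lemma cscalar_Cauchy_Schwarz:
  assumes "\<eta> \<in> carrier_vec d" "\<xi> \<in> carrier_vec d"
  shows "(cmod (\<eta> \<bullet>c \<xi>))\<^sup>2 \<le> vnorm2 \<eta> * vnorm2 \<xi>"
  using sum_Cauchy_Schwarz[of "\<lambda>i. \<eta> $ i" "\<lambda>i. \<xi> $ i" "{..<d}"] assms
  by (simp only: cscalar_sum[OF assms] vnorm2_def carrier_vecD)

lemma projection_adjoint:
  assumes p: "projection_mat d p" and v: "\<eta> \<in> carrier_vec d" "\<xi> \<in> carrier_vec d"
  shows "(p *\<^sub>v \<eta>) \<bullet>c \<xi> = \<eta> \<bullet>c (p *\<^sub>v \<xi>)"
proof -
  have pc: "p \<in> carrier_mat d d" and h: "\<And>i j. i < d \<Longrightarrow> j < d \<Longrightarrow> cnj (p $$ (j, i)) = p $$ (i, j)"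
    using p by (auto simp: projection_mat_iff)
  have "\<eta> \<bullet>c (p *\<^sub>v \<xi>) = (\<Sum>j<d. \<Sum>i<d. p $$ (i, j) * \<eta> $ j * cnj (\<xi> $ i))"
    using pc v by (simp add: scalar_prod_def lessThan_atLeast0 sum_distrib_left h mult_ac)
  also have "\<dots> = (p *\<^sub>v \<eta>) \<bullet>c \<xi>"
    by (subst sum.swap) (rule quadratic_form_sum[OF pc v(2,1), symmetric])
  finally show ?thesis ..
qed

lemma projection_pythagoras:
  assumes p: "projection_mat d p" and v: "\<eta> \<in> carrier_vec d"
  shows "vnorm2 (\<eta> - p *\<^sub>v \<eta>) = vnorm2 \<eta> - vnorm2 (p *\<^sub>v \<eta>)"
proof -
  have pc: "p \<in> carrier_mat d d" and pp: "p * p = p" using p by (auto simp: projection_mat_def)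
  have pv: "p *\<^sub>v \<eta> \<in> carrier_vec d" using pc v by simp
  have "p *\<^sub>v (p *\<^sub>v \<eta>) = p *\<^sub>v \<eta>" using pc v pp by (metis assoc_mult_mat_vec)
  then have e: "(p *\<^sub>v \<eta>) \<bullet>c \<eta> = (p *\<^sub>v \<eta>) \<bullet>c (p *\<^sub>v \<eta>)" "\<eta> \<bullet>c (p *\<^sub>v \<eta>) = (p *\<^sub>v \<eta>) \<bullet>c (p *\<^sub>v \<eta>)"
    using projection_adjoint[OF p pv v] projection_adjoint[OF p v pv] by simp_all
  have "(\<eta> - p *\<^sub>v \<eta>) \<bullet>c (\<eta> - p *\<^sub>v \<eta>) = \<eta> \<bullet>c \<eta> - \<eta> \<bullet>c (p *\<^sub>v \<eta>) - (p *\<^sub>v \<eta>) \<bullet>c \<eta> + (p *\<^sub>v \<eta>) \<bullet>c (p *\<^sub>v \<eta>)"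
    using v pv pc by (simp add: cscalar_sum[of _ d] algebra_simps sum.distrib sum_subtractf del: index_mult_mat_vec)
  then have "complex_of_real (vnorm2 (\<eta> - p *\<^sub>v \<eta>)) = complex_of_real (vnorm2 \<eta> - vnorm2 (p *\<^sub>v \<eta>))"
    by (simp add: e vnorm2_eq)
  then show ?thesis by (simp only: of_real_eq_iff)
qed

section \<open>Norms along diagonal words\<close>

definition word_norm2 :: "nat \<Rightarrow> ('x \<Rightarrow> 'x \<Rightarrow> complex mat) \<Rightarrow> complex vec \<Rightarrow> 'x list \<Rightarrow> real" where
  "word_norm2 d u \<eta> a = vnorm2 (word_mat d u (diag_word a) *\<^sub>v \<eta>)"

lemma word_norm2_nonneg: "word_norm2 d u \<eta> a \<ge> 0"
  by (simp add: word_norm2_def vnorm2_nonneg)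

context
  fixes X :: "'x set" and d :: nat and u :: "'x \<Rightarrow> 'x \<Rightarrow> complex mat"
  assumes u: "quantum_permutation X d u"
begin

lemma qp_word_carrier: "w \<in> lists (X \<times> X) \<Longrightarrow> word_mat d u w \<in> carrier_mat d d"
  by (rule word_mat_carrier[of X u d]) (rule qp_carrier[OF u])

lemma qp_projection: "x \<in> X \<Longrightarrow> y \<in> X \<Longrightarrow> projection_mat d (u x y)"
  using u by (simp add: quantum_permutation_def)

lemma qp_word_append:
  "v \<in> lists (X \<times> X) \<Longrightarrow> w \<in> lists (X \<times> X) \<Longrightarrow>
    word_mat d u (v @ w) = word_mat d u v * word_mat d u w"
  by (rule word_mat_append[of X u d]) (rule qp_carrier[OF u])

lemma qp_word_adjoint:
  assumes "w \<in> lists (X \<times> X)" "\<eta> \<in> carrier_vec d" "\<xi> \<in> carrier_vec d"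
  shows "(word_mat d u w *\<^sub>v \<eta>) \<bullet>c \<xi> = \<eta> \<bullet>c (word_mat d u (rev w) *\<^sub>v \<xi>)"
  using assms
proof (induction w arbitrary: \<xi> rule: list.induct)
  case (Cons p w)
  obtain x y where p: "p = (x, y)" by (cases p)
  have xy: "x \<in> X" "y \<in> X" and w: "w \<in> lists (X \<times> X)" "rev w \<in> lists (X \<times> X)"
    using Cons.prems(1) by (auto simp: p)
  have c: "u x y \<in> carrier_mat d d" by (rule qp_carrier[OF u xy])
  have W: "word_mat d u w \<in> carrier_mat d d" "word_mat d u (rev w) \<in> carrier_mat d d"
    using w by (auto intro: qp_word_carrier)
  have "(word_mat d u (p # w) *\<^sub>v \<eta>) \<bullet>c \<xi> = (u x y *\<^sub>v (word_mat d u w *\<^sub>v \<eta>)) \<bullet>c \<xi>"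
    using c W Cons.prems by (simp add: p)
  also have "\<dots> = (word_mat d u w *\<^sub>v \<eta>) \<bullet>c (u x y *\<^sub>v \<xi>)"
    using W Cons.prems by (intro projection_adjoint[OF qp_projection[OF xy]]) auto
  also have "\<dots> = \<eta> \<bullet>c (word_mat d u (rev w) *\<^sub>v (u x y *\<^sub>v \<xi>))"
    using c Cons.prems w by (intro Cons.IH) auto
  also have "\<dots> = \<eta> \<bullet>c (word_mat d u (rev (p # w)) *\<^sub>v \<xi>)"
    using c W Cons.prems w xy qp_word_append[of "rev w" "[(x, y)]"] by (simp add: p)
  finally show ?case .
qed simp

lemma coefficient_adjoint:
  assumes "\<eta> \<in> carrier_vec d" "\<xi> \<in> carrier_vec d"
  shows "coefficient X d u \<eta> \<xi> w = cnj (coefficient X d u \<xi> \<eta> (rev w))"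
proof (cases "w \<in> lists (X \<times> X)")
  case True
  then have "rev w \<in> lists (X \<times> X)" by auto
  then have M: "word_mat d u (rev w) \<in> carrier_mat d d" by (rule qp_word_carrier)
  then show ?thesis using True assms qp_word_adjoint[OF True assms(2,1)]
    by (auto simp: coefficient_def cscalar_sum[of _ d] mult.commute)
next
  case False
  then show ?thesis by (auto simp: coefficient_def)
qed

text \<open>Pythagoras for the projection \<open>u x x\<close>. Once the norms along a growing word
  converge, the displacements caused by single letters must tend to 0.\<close>

lemma word_norm2_Cons_diff:
  assumes "x \<in> X" "set a \<subseteq> X" "\<eta> \<in> carrier_vec d"
  shows "word_norm2 d u \<eta> a - word_norm2 d u \<eta> (x # a) =
    vnorm2 (word_mat d u (diag_word a) *\<^sub>v \<eta> - word_mat d u (diag_word (x # a)) *\<^sub>v \<eta>)"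
proof -
  have c: "word_mat d u (diag_word a) \<in> carrier_mat d d" "u x x \<in> carrier_mat d d"
    using assms qp_word_carrier[OF diag_word_in_lists] qp_carrier[OF u] by auto
  then have "word_mat d u (diag_word (x # a)) *\<^sub>v \<eta> = u x x *\<^sub>v (word_mat d u (diag_word a) *\<^sub>v \<eta>)"
    using assms by simp
  then show ?thesis
    using projection_pythagoras[OF qp_projection, of x x "word_mat d u (diag_word a) *\<^sub>v \<eta>"] c assms
    by (simp add: word_norm2_def)
qed

lemma word_norm2_append_le:
  assumes "set b \<subseteq> X" "set a \<subseteq> X" "\<eta> \<in> carrier_vec d"
  shows "word_norm2 d u \<eta> (b @ a) \<le> word_norm2 d u \<eta> a"
  using assms(1)
proof (induction b)
  case (Cons x b)
  then have "word_norm2 d u \<eta> (x # (b @ a)) \<le> word_norm2 d u \<eta> (b @ a)"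
    using word_norm2_Cons_diff[of x "b @ a" \<eta>] assms vnorm2_nonneg
    by (metis Un_least diff_ge_0_iff_ge insert_subset list.simps(15) set_append)
  then show ?case using Cons by simp
qed simp

text \<open>The word \<open>rev a @ a\<close> represents B* B with B the operator of
  \<open>a\<close>, so the vector state of \<eta> at it is the squared norm of B \<eta>.\<close>

lemma coefficient_rev_append:
  assumes "set a \<subseteq> X" "\<eta> \<in> carrier_vec d"
  shows "coefficient X d u \<eta> \<eta> (diag_word (rev a @ a)) = word_norm2 d u \<eta> a"
proof -
  have l: "diag_word a \<in> lists (X \<times> X)" "diag_word (rev a) \<in> lists (X \<times> X)"
    using assms(1) diag_word_in_lists[of a X] diag_word_in_lists[of "rev a" X] by auto
  note c = qp_word_carrier[OF l(1)] qp_word_carrier[OF l(2)]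
  have "coefficient X d u \<eta> \<eta> (diag_word (rev a @ a)) =
      (word_mat d u (diag_word (rev a)) *\<^sub>v (word_mat d u (diag_word a) *\<^sub>v \<eta>)) \<bullet>c \<eta>"
    using l c assms qp_word_append[OF l(2,1)] by (simp add: coefficient_def)
  also have "\<dots> = (word_mat d u (diag_word a) *\<^sub>v \<eta>) \<bullet>c (word_mat d u (diag_word a) *\<^sub>v \<eta>)"
    using qp_word_adjoint[OF l(2), of "word_mat d u (diag_word a) *\<^sub>v \<eta>" \<eta>] c assms
    by (simp add: rev_diag_word)
  finally show ?thesis by (simp add: vnorm2_eq word_norm2_def)
qed

text \<open>After passing to the adjoint, a letter appended on the right acts last on \<xi>.
  Cauchy-Schwarz then bounds the change by the loss of norm along the word applied to \<xi>.\<close>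

lemma coefficient_step_le:
  assumes "x \<in> X" "set a \<subseteq> X" "\<xi> \<in> carrier_vec d" "\<eta> \<in> carrier_vec d"
  shows "(cmod (coefficient X d u \<xi> \<eta> (diag_word (rev a)) - coefficient X d u \<xi> \<eta> (diag_word (rev a @ [x]))))\<^sup>2
    \<le> (word_norm2 d u \<xi> a - word_norm2 d u \<xi> (x # a)) * vnorm2 \<eta>"
proof -
  let ?A = "\<lambda>a. word_mat d u (diag_word a) *\<^sub>v \<xi>"
  have e: "coefficient X d u \<xi> \<eta> (diag_word (rev a)) = \<eta> \<bullet>c ?A a" and A: "?A a \<in> carrier_vec d"
    if "set a \<subseteq> X" for a
  proof -
    have l: "diag_word a \<in> lists (X \<times> X)" "diag_word (rev a) \<in> lists (X \<times> X)"
      using that diag_word_in_lists[of a X] diag_word_in_lists[of "rev a" X] by auto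
    show "coefficient X d u \<xi> \<eta> (diag_word (rev a)) = \<eta> \<bullet>c ?A a"
      using qp_word_adjoint[OF l(2) assms(4,3)] l by (simp add: coefficient_def rev_diag_word)
    show "?A a \<in> carrier_vec d" using qp_word_carrier[OF l(1)] assms by simp
  qed
  have s: "set (x # a) \<subseteq> X" using assms by simp
  have m: "(?A a - ?A (x # a)) $ i = ?A a $ i - ?A (x # a) $ i" if "i < d" for i
    by (rule index_minus_vec) (use A[OF s] that in \<open>simp only: carrier_vecD\<close>)
  have "coefficient X d u \<xi> \<eta> (diag_word (rev a)) - coefficient X d u \<xi> \<eta> (diag_word (rev a @ [x])) =
      \<eta> \<bullet>c (?A a - ?A (x # a))"
    using e[OF assms(2)] e[OF s] A[OF assms(2)] A[OF s] assms(4)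
    by (simp add: cscalar_sum[of _ d] m right_diff_distrib sum_subtractf
        del: diag_word_Cons diag_word_append index_minus_vec index_mult_mat_vec)
  also have "(cmod (\<eta> \<bullet>c (?A a - ?A (x # a))))\<^sup>2 \<le> vnorm2 \<eta> * vnorm2 (?A a - ?A (x # a))"
    using A[OF assms(2)] A[OF s] assms(4) by (intro cscalar_Cauchy_Schwarz) auto
  finally show ?thesis
    using word_norm2_Cons_diff[OF assms(1,2,3)] by (simp add: mult.commute)
qed

end

section \<open>Convergence along powers of the palindrome\<close>

lemma word_norm2_pal_decseq:
  assumes "quantum_permutation (set xs) d u" "\<eta> \<in> carrier_vec d"
  shows "decseq (\<lambda>k. word_norm2 d u \<eta> (pal xs k))"
proof (rule decseq_SucI)
  fix k
  show "word_norm2 d u \<eta> (pal xs (Suc k)) \<le> word_norm2 d u \<eta> (pal xs k)"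
    using word_norm2_append_le[OF assms(1) _ set_pal assms(2), of "xs @ rev xs" k] by (simp add: pal_Suc)
qed

lemma word_norm2_pal_convergent:
  assumes "quantum_permutation (set xs) d u" "\<eta> \<in> carrier_vec d"
  shows "convergent (\<lambda>k. word_norm2 d u \<eta> (pal xs k))"
proof -
  obtain L where "(\<lambda>k. word_norm2 d u \<eta> (pal xs k)) \<longlonglongrightarrow> L"
    by (rule decseq_convergent[OF word_norm2_pal_decseq[OF assms], of 0]) (auto simp: word_norm2_nonneg)
  then show ?thesis by (rule convergentI)
qed

lemma coefficient_pal_convergent_diag:
  assumes u: "quantum_permutation (set xs) d u" and \<eta>: "\<eta> \<in> carrier_vec d"
  shows "convergent (\<lambda>k. coefficient (set xs) d u \<eta> \<eta> (diag_word (pal xs k)))"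
proof -
  \<comment> \<open>\<open>a k\<close> is the right half of \<open>pal xs k\<close>. The next half
    arises by prepending \<open>rev xs\<close> or \<open>xs\<close>, so the values at the
    palindromes are a decreasing sequence of squared norms.\<close>
  define a where "a k = (if even k then pal xs (k div 2) else rev xs @ pal xs (k div 2))" for k
  have a: "pal xs k = rev (a k) @ a k" for k
  proof -
    have "pal xs (m + m) = rev (pal xs m) @ pal xs m" for m by (simp add: pal_add)
    moreover have "pal xs (Suc (m + m)) = rev (rev xs @ pal xs m) @ rev xs @ pal xs m" for m
      using pal_add[of xs m "Suc m"] by (simp add: pal_Suc)
    moreover obtain m where "k = m + m \<or> k = Suc (m + m)"
      by (metis evenE oddE mult_2 Suc_eq_plus1)
    ultimately show ?thesis by (auto simp: a_def simp flip: mult_2)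
  qed
  have s: "set (a k) \<subseteq> set xs" for k using set_pal[of xs "k div 2"] by (auto simp: a_def)
  have e: "coefficient (set xs) d u \<eta> \<eta> (diag_word (pal xs k)) = word_norm2 d u \<eta> (a k)" for k
    unfolding a by (rule coefficient_rev_append[OF u s \<eta>])
  have "decseq (\<lambda>k. word_norm2 d u \<eta> (a k))"
  proof (rule decseq_SucI)
    fix k
    have "\<exists>b. set b \<subseteq> set xs \<and> a (Suc k) = b @ a k"
    proof (cases "even k")
      case True
      then show ?thesis by (intro exI[of _ "rev xs"]) (simp add: a_def)
    next
      case False
      then obtain m where "k = Suc (2 * m)" by (auto elim: oddE)
      then show ?thesis by (intro exI[of _ xs]) (simp add: a_def pal_Suc)
    qed
    then show "word_norm2 d u \<eta> (a (Suc k)) \<le> word_norm2 d u \<eta> (a k)"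
      using word_norm2_append_le[OF u _ s \<eta>] by metis
  qed
  then obtain L where "(\<lambda>k. word_norm2 d u \<eta> (a k)) \<longlonglongrightarrow> L"
    by (rule decseq_convergent[of "\<lambda>k. word_norm2 d u \<eta> (a k)" 0]) (auto simp: word_norm2_nonneg)
  then show ?thesis unfolding e by (rule convergentI[OF tendsto_of_real])
qed

lemma coefficient_polarization:
  assumes u: "quantum_permutation X d u" and v: "\<xi> \<in> carrier_vec d" "\<eta> \<in> carrier_vec d"
  shows "coefficient X d u \<xi> \<eta> w = (\<Sum>c\<leftarrow>[1, \<i>, -1, -\<i>].
    c / 4 * coefficient X d u (\<eta> + c \<cdot>\<^sub>v \<xi>) (\<eta> + c \<cdot>\<^sub>v \<xi>) w)"
proof (cases "w \<in> lists (X \<times> X)")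
  case True
  define M where "M = word_mat d u w"
  have M: "M \<in> carrier_mat d d" unfolding M_def by (rule qp_word_carrier[OF u True])
  define t where "t c i j = c / 4 * (M $$ (i, j) * (\<eta> $ j + c * \<xi> $ j) * cnj (\<eta> $ i + c * \<xi> $ i))" for c i j
  have t: "c / 4 * coefficient X d u (\<eta> + c \<cdot>\<^sub>v \<xi>) (\<eta> + c \<cdot>\<^sub>v \<xi>) w = (\<Sum>i<d. \<Sum>j<d. t c i j)" for c
  proof -
    have "\<eta> + c \<cdot>\<^sub>v \<xi> \<in> carrier_vec d" using v by simp
    then show ?thesis
      using True v quadratic_form_sum[OF M, of "\<eta> + c \<cdot>\<^sub>v \<xi>" "\<eta> + c \<cdot>\<^sub>v \<xi>"]
      by (simp add: coefficient_def M_def[symmetric] t_def sum_distrib_left)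
  qed
  have "M $$ (i, j) * \<eta> $ j * cnj (\<xi> $ i) = t 1 i j + (t \<i> i j + (t (-1) i j + t (-\<i>) i j))" for i j
    by (simp add: t_def algebra_simps)
  then have "coefficient X d u \<xi> \<eta> w = (\<Sum>i<d. \<Sum>j<d. t 1 i j + (t \<i> i j + (t (-1) i j + t (-\<i>) i j)))"
    using True quadratic_form_sum[OF M v] by (simp add: coefficient_def M_def[symmetric])
  then show ?thesis
    by (simp only: t list.map sum_list.Cons sum_list.Nil sum.distrib add_0_right)
qed (simp add: coefficient_def)

lemma coefficients_pal_convergent:
  assumes "f \<in> coefficients (set xs)"
  shows "convergent (\<lambda>k. f (diag_word (pal xs k)))"
  using assms
proof induction
  case (coeff d u \<xi> \<eta>)
  have c: "\<eta> + c \<cdot>\<^sub>v \<xi> \<in> carrier_vec d" for c using coeff by simp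
  show ?case
    unfolding coefficient_polarization[OF coeff] list.map sum_list.Cons sum_list.Nil
    by (intro convergent_add convergent_const convergent_mult
        coefficient_pal_convergent_diag[OF coeff(1) c])
qed (auto intro: convergent_const convergent_add convergent_mult)

text \<open>The loss of norm at a single letter is at most the loss over the whole block from
  \<open>pal xs k\<close> to \<open>pal xs (Suc k)\<close>, and this tends to 0 because the norms
  converge.\<close>

lemma coefficient_pal_step:
  assumes u: "quantum_permutation (set xs) d u" and v: "\<xi> \<in> carrier_vec d" "\<eta> \<in> carrier_vec d"
    and xs: "xs = a @ x # b"
  shows "(\<lambda>k. coefficient (set xs) d u \<xi> \<eta> (diag_word (pal xs k @ a)) -
    coefficient (set xs) d u \<xi> \<eta> (diag_word (pal xs k @ a @ [x]))) \<longlonglongrightarrow> 0"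
proof -
  let ?N = "\<lambda>k. word_norm2 d u \<xi> (pal xs k)"
  let ?D = "\<lambda>k. coefficient (set xs) d u \<xi> \<eta> (diag_word (pal xs k @ a)) -
    coefficient (set xs) d u \<xi> \<eta> (diag_word (pal xs k @ a @ [x]))"
  have s: "set (rev a @ pal xs k) \<subseteq> set xs" for k using set_pal[of xs k] by (auto simp: xs)
  have le: "(cmod (?D k))\<^sup>2 \<le> (?N k - ?N (Suc k)) * vnorm2 \<eta>" for k
  proof -
    have 1: "word_norm2 d u \<xi> (rev a @ pal xs k) \<le> ?N k"
      by (rule word_norm2_append_le[OF u _ set_pal v(1)]) (auto simp: xs)
    have "?N (Suc k) = word_norm2 d u \<xi> ((xs @ rev b) @ x # rev a @ pal xs k)"
      by (simp add: pal_Suc xs)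
    also have "\<dots> \<le> word_norm2 d u \<xi> (x # rev a @ pal xs k)"
      by (rule word_norm2_append_le[OF u _ _ v(1)]) (use s[of k] in \<open>auto simp: xs[symmetric], auto simp: xs\<close>)
    finally have 2: "?N (Suc k) \<le> word_norm2 d u \<xi> (x # rev a @ pal xs k)" .
    have "(cmod (?D k))\<^sup>2 \<le> (word_norm2 d u \<xi> (rev a @ pal xs k) - word_norm2 d u \<xi> (x # rev a @ pal xs k)) * vnorm2 \<eta>"
      using coefficient_step_le[OF u _ s v, of x k] by (simp add: xs)
    also have "\<dots> \<le> (?N k - ?N (Suc k)) * vnorm2 \<eta>"
      using 1 2 by (intro mult_right_mono vnorm2_nonneg) simp
    finally show ?thesis .
  qed
  obtain L where L: "?N \<longlonglongrightarrow> L"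
    using word_norm2_pal_convergent[OF u v(1)] by (auto simp: convergent_def)
  have "(\<lambda>k. (?N k - ?N (Suc k)) * vnorm2 \<eta>) \<longlonglongrightarrow> (L - L) * vnorm2 \<eta>"
    by (intro tendsto_intros L LIMSEQ_Suc)
  then have "(\<lambda>k. (?N k - ?N (Suc k)) * vnorm2 \<eta>) \<longlonglongrightarrow> 0" by simp
  then have "(\<lambda>k. (cmod (?D k))\<^sup>2) \<longlonglongrightarrow> 0"
    by (rule tendsto_sandwich[OF always_eventually[OF allI[OF zero_le_power2]]
          always_eventually[OF allI[OF le]] tendsto_const])
  then have "(\<lambda>k. sqrt ((cmod (?D k))\<^sup>2)) \<longlonglongrightarrow> sqrt 0" by (rule tendsto_real_sqrt)
  then show ?thesis by (simp add: tendsto_norm_zero_iff)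
qed

lemma coefficients_pal_step:
  assumes "f \<in> coefficients (set xs)" and xs: "xs = a @ x # b"
  shows "(\<lambda>k. f (diag_word (pal xs k @ a)) - f (diag_word (pal xs k @ a @ [x]))) \<longlonglongrightarrow> 0"
  using assms(1)
proof induction
  case (coeff d u \<xi> \<eta>)
  then show ?case by (rule coefficient_pal_step[OF _ _ _ xs])
next
  case (add \<phi> \<psi>)
  then show ?case using tendsto_add[OF add.IH] by (simp add: algebra_simps)
next
  case (smult \<phi> c)
  then show ?case using tendsto_mult_left[OF smult.IH, of c] by (simp add: algebra_simps)
qed simp

lemma haar_limit_tendsto:
  assumes "f \<in> coefficients (set xs)"
  shows "(\<lambda>k. f (diag_word (pal xs k))) \<longlonglongrightarrow> haar_limit xs f"
  unfolding haar_limit_def using coefficients_pal_convergent[OF assms] by (simp add: convergent_LIMSEQ_iff)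

lemma coefficients_pal_prefix:
  assumes "f \<in> coefficients (set xs)" and xs: "xs = a @ b"
  shows "(\<lambda>k. f (diag_word (pal xs k @ a))) \<longlonglongrightarrow> haar_limit xs f"
  using xs
proof (induction a arbitrary: b rule: rev_induct)
  case Nil
  then show ?case using haar_limit_tendsto[OF assms(1)] by simp
next
  case (snoc x a)
  have "(\<lambda>k. f (diag_word (pal xs k @ a)) -
      (f (diag_word (pal xs k @ a)) - f (diag_word (pal xs k @ a @ [x])))) \<longlonglongrightarrow> haar_limit xs f - 0"
    by (rule tendsto_diff[OF snoc.IH coefficients_pal_step[OF assms(1)]]) (use snoc.prems in auto)
  then show ?case by simp
qed

lemma coefficients_row':
  assumes "f \<in> coefficients X" "x \<in> X" "y \<in> X" "z \<in> X"
  shows "f (v @ (x, y) # (x, z) # w) = (if y = z then f (v @ (x, y) # w) else 0)"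
  using coefficients_row[OF coefficients_prefix[OF coefficients_suffix[OF assms(1)]], OF assms(2-4), of v w]
  by simp

lemma coefficients_col':
  assumes "f \<in> coefficients X" "x \<in> X" "y \<in> X" "z \<in> X"
  shows "f (v @ (x, y) # (z, y) # w) = (if x = z then f (v @ (x, y) # w) else 0)"
  using coefficients_col[OF coefficients_prefix[OF coefficients_suffix[OF assms(1)]], OF assms(2-4), of v w]
  by simp

lemma coefficients_sum_row':
  assumes "f \<in> coefficients X" "x \<in> X"
  shows "(\<Sum>y\<in>X. f (v @ (x, y) # w)) = f (v @ w)"
  using coefficients_sum_row[OF coefficients_prefix[OF coefficients_suffix[OF assms(1)]], OF assms(2), of v w]
  by simp

text \<open>Stop inside the next block right after the letter \<open>(x, x)\<close>: there the row
  relation absorbs \<open>(x, y)\<close> or kills it. By \<open>coefficients_pal_prefix\<close>,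
  applied to the translate of f by \<open>(x, y)\<close>, stopping there gives the same limit as
  stopping at the end of a block.\<close>

lemma haar_limit_absorb_letter:
  assumes f: "f \<in> coefficients (set xs)" and x: "x \<in> set xs" and y: "y \<in> set xs"
  shows "(\<lambda>k. f (diag_word (pal xs k) @ [(x, y)])) \<longlonglongrightarrow> (if x = y then haar_limit xs f else 0)"
proof -
  obtain a b where xs: "xs = a @ x # b" using x by (meson split_list)
  have "(\<lambda>k. f (diag_word (pal xs k @ a @ [x]))) \<longlonglongrightarrow> haar_limit xs f"
    by (rule coefficients_pal_prefix[OF f]) (simp add: xs)
  moreover have "f (diag_word (pal xs k @ a @ [x]) @ [(x, y)]) = (if x = y then f (diag_word (pal xs k @ a @ [x])) else 0)" for k
    using coefficients_row'[OF f x x y, of "diag_word (pal xs k @ a)" "[]"] by simp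
  ultimately have 1: "(\<lambda>k. f (diag_word (pal xs k @ a @ [x]) @ [(x, y)])) \<longlonglongrightarrow> (if x = y then haar_limit xs f else 0)"
    by (auto simp del: diag_word_append)
  note g = coefficients_suffix[OF f, of "[(x, y)]"]
  have "(\<lambda>k. f (diag_word (pal xs k @ a @ [x]) @ [(x, y)])) \<longlonglongrightarrow> haar_limit xs (\<lambda>w. f (w @ [(x, y)]))"
    by (rule coefficients_pal_prefix[OF g]) (simp add: xs)
  with 1 have "haar_limit xs (\<lambda>w. f (w @ [(x, y)])) = (if x = y then haar_limit xs f else 0)"
    by (rule LIMSEQ_unique[symmetric])
  then show ?thesis using haar_limit_tendsto[OF g] by (simp only:)
qed

text \<open>One of the two invariance properties of the Haar functional, in terms of evaluation at
  words: the limit in the first leg of the coproduct of f leaves a multiple of the unit.\<close>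

lemma haar_limit_absorb_right:
  assumes f: "f \<in> coefficients (set xs)"
  shows "(\<lambda>k. f (diag_word (pal xs k) @ w)) \<longlonglongrightarrow> unit_coefficient (set xs) w * haar_limit xs f"
proof (cases "w \<in> lists (set xs \<times> set xs)")
  case True
  then show ?thesis
  proof (induction w rule: list.induct)
    case Nil
    then show ?case using haar_limit_tendsto[OF f] by (simp add: unit_coefficient_def)
  next
    case (Cons p w)
    obtain x y where p: "p = (x, y)" by (cases p)
    have xy: "x \<in> set xs" "y \<in> set xs" and w: "w \<in> lists (set xs \<times> set xs)"
      using Cons.prems by (auto simp: p)
    note g = coefficients_suffix[OF f, of w]
    have "haar_limit xs (\<lambda>v. f (v @ w)) = unit_coefficient (set xs) w * haar_limit xs f"
      using Cons.IH[OF w] haar_limit_tendsto[OF g] by (rule LIMSEQ_unique[symmetric])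
    moreover have "unit_coefficient (set xs) (p # w) = (if x = y then unit_coefficient (set xs) w else 0)"
      using xy by (auto simp: unit_coefficient_def p)
    ultimately show ?case using haar_limit_absorb_letter[OF g xy] by (auto simp: p)
  qed
next
  case False
  then have "f (v @ w) = 0" for v using coefficients_outside[OF f] by simp
  then show ?thesis using False by (simp add: unit_coefficient_def)
qed

lemma coefficients_rev:
  "f \<in> coefficients X \<Longrightarrow> (\<lambda>w. cnj (f (rev w))) \<in> coefficients X"
proof (induction rule: coefficients.induct)
  case zero
  then show ?case using coefficients.zero by simp
next
  case (coeff d u \<xi> \<eta>)
  then show ?case
    using coefficients.coeff[OF coeff(1,3,2)] coefficient_adjoint[OF coeff(1,3,2)] by (metis (no_types, lifting) ext)
next
  case (add \<phi> \<psi>)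
  then show ?case using coefficients.add[OF add.IH] by simp
next
  case (smult \<phi> c)
  then show ?case using coefficients.smult[OF smult.IH, of "cnj c"] by simp
qed

text \<open>Reversing words and conjugating values preserves coefficients, fixes the diagonal
  palindromes and exchanges the two sides.\<close>

lemma haar_limit_absorb_left:
  assumes f: "f \<in> coefficients (set xs)"
  shows "(\<lambda>k. f (w @ diag_word (pal xs k))) \<longlonglongrightarrow> unit_coefficient (set xs) w * haar_limit xs f"
proof -
  note g = coefficients_rev[OF f]
  have r: "rev (diag_word (pal xs k)) = diag_word (pal xs k)" for k by (simp add: rev_diag_word)
  have h: "haar_limit xs (\<lambda>w. cnj (f (rev w))) = cnj (haar_limit xs f)"
    using haar_limit_tendsto[OF g] tendsto_cnj[OF haar_limit_tendsto[OF f]] unfolding r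
    by (rule LIMSEQ_unique)
  have u: "unit_coefficient (set xs) (rev w) = cnj (unit_coefficient (set xs) w)"
    by (auto simp: unit_coefficient_def)
  show ?thesis
    using tendsto_cnj[OF haar_limit_absorb_right[OF g, of "rev w"]] by (simp add: r h u)
qed

lemma haar_limitI: "(\<lambda>k. f (diag_word (pal xs k))) \<longlonglongrightarrow> c \<Longrightarrow> haar_limit xs f = c"
  unfolding haar_limit_def by (rule limI)

lemma haar_limit_add:
  "f \<in> coefficients (set xs) \<Longrightarrow> g \<in> coefficients (set xs) \<Longrightarrow>
    haar_limit xs (\<lambda>w. f w + g w) = haar_limit xs f + haar_limit xs g"
  by (intro haar_limitI tendsto_add haar_limit_tendsto)

lemma haar_limit_smult:
  "f \<in> coefficients (set xs) \<Longrightarrow> haar_limit xs (\<lambda>w. c * f w) = c * haar_limit xs f"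
  by (intro haar_limitI tendsto_mult tendsto_const haar_limit_tendsto)

lemma haar_limit_sum:
  assumes "\<And>i. i \<in> I \<Longrightarrow> f i \<in> coefficients (set xs)"
  shows "haar_limit xs (\<lambda>w. \<Sum>i\<in>I. f i w) = (\<Sum>i\<in>I. haar_limit xs (f i))"
  by (intro haar_limitI tendsto_sum haar_limit_tendsto assms)

lemma unit_coefficient_diag: "set a \<subseteq> X \<Longrightarrow> unit_coefficient X (diag_word a) = 1"
  by (auto simp: diag_word_def unit_coefficient_zip)

lemma haar_limit_unit: "haar_limit xs (unit_coefficient (set xs)) = 1"
  by (intro haar_limitI) (simp add: unit_coefficient_diag[OF set_pal])

section \<open>The limit functional is the Haar functional\<close>

lemma foldr_coefficient_algebra:
  "foldr (\<lambda>p s. (c p \<odot>\<^bsub>coefficient_algebra X\<^esub> g p) \<oplus>\<^bsub>coefficient_algebra X\<^esub> s) ps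
     \<zero>\<^bsub>coefficient_algebra X\<^esub> = (\<lambda>w. \<Sum>p\<leftarrow>ps. c p * g p w)"
  by (induction ps) (simp_all add: coefficient_algebra_def)

lemma linear_sum_list:
  assumes "\<And>a b. a \<in> A \<Longrightarrow> b \<in> A \<Longrightarrow> h (\<lambda>w. a w + b w) = h a + h b"
    and "\<And>c a. a \<in> A \<Longrightarrow> h (\<lambda>w. c * a w) = c * h a"
    and "A = coefficients X" and "\<And>p. p \<in> set ps \<Longrightarrow> g p \<in> A"
  shows "h (\<lambda>w. \<Sum>p\<leftarrow>ps. c p * g p w) = (\<Sum>p\<leftarrow>ps. c p * h (g p))"
  using assms(4)
proof (induction ps)
  case Nil
  show ?case using assms(2)[of "\<lambda>w. 0" 0] assms(3) coefficients.zero[of X] by simp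
next
  case (Cons p ps)
  have "(\<lambda>w. c p * g p w) \<in> A" "(\<lambda>w. \<Sum>p\<leftarrow>ps. c p * g p w) \<in> A"
    unfolding assms(3) by (intro coefficients.smult coefficients_sum_list; use Cons.prems assms(3) in simp)+
  then show ?case using assms(1) assms(2)[of "g p" "c p"] Cons by simp
qed

lemma haar_limit_comult:
  assumes f: "f \<in> coefficients (set xs)" and ps: "set ps \<subseteq> coefficients (set xs) \<times> coefficients (set xs)"
    "\<And>v w. f (v @ w) = (\<Sum>(\<alpha>, \<beta>)\<leftarrow>ps. \<alpha> v * \<beta> w)"
  shows "(\<Sum>p\<leftarrow>ps. haar_limit xs (fst p) * snd p w) = haar_limit xs f * unit_coefficient (set xs) w"
    and "(\<Sum>p\<leftarrow>ps. haar_limit xs (snd p) * fst p w) = haar_limit xs f * unit_coefficient (set xs) w"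
proof -
  have l: "(\<lambda>k. \<Sum>p\<leftarrow>ps. g p (diag_word (pal xs k)) * e p) \<longlonglongrightarrow> (\<Sum>p\<leftarrow>ps. haar_limit xs (g p) * e p)"
    if "\<And>p. p \<in> set ps \<Longrightarrow> g p \<in> coefficients (set xs)" for g and e :: "_ \<Rightarrow> complex"
    using that by (induction ps) (auto intro!: tendsto_add tendsto_mult haar_limit_tendsto)
  have "(\<lambda>k. f (diag_word (pal xs k) @ w)) \<longlonglongrightarrow> (\<Sum>p\<leftarrow>ps. haar_limit xs (fst p) * snd p w)"
    unfolding ps(2) case_prod_beta by (rule l) (use ps(1) in auto)
  from LIMSEQ_unique[OF this haar_limit_absorb_right[OF f]]
  show "(\<Sum>p\<leftarrow>ps. haar_limit xs (fst p) * snd p w) = haar_limit xs f * unit_coefficient (set xs) w"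
    by (simp only: mult.commute[of "haar_limit xs f"])
  have "(\<lambda>k. f (w @ diag_word (pal xs k))) \<longlonglongrightarrow> (\<Sum>p\<leftarrow>ps. haar_limit xs (snd p) * fst p w)"
    unfolding ps(2) case_prod_beta mult.commute[of "fst _ _"] by (rule l) (use ps(1) in auto)
  from LIMSEQ_unique[OF this haar_limit_absorb_left[OF f]]
  show "(\<Sum>p\<leftarrow>ps. haar_limit xs (snd p) * fst p w) = haar_limit xs f * unit_coefficient (set xs) w"
    by (simp only: mult.commute[of "haar_limit xs f"])
qed

lemma is_haar_haar_limit: "is_haar (coefficient_algebra (set xs)) (haar_limit xs)"
  unfolding is_haar_def case_prod_beta foldr_coefficient_algebra
  by (auto simp: coefficient_algebra_def haar_limit_add haar_limit_smult haar_limit_unit fun_eq_iff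
      haar_limit_comult)

text \<open>Apply \<open>haar_limit xs\<close> to the first and \<open>h\<close> to the second leg
  of the coproduct of f. Invariance of the former gives \<open>haar_limit xs f\<close>, invariance
  of the latter gives \<open>h f\<close>.\<close>

lemma is_haar_unique:
  assumes h: "is_haar (coefficient_algebra (set xs)) h" and f: "f \<in> coefficients (set xs)"
  shows "h f = haar_limit xs f"
proof -
  let ?A = "coefficients (set xs)"
  have add: "h (\<lambda>w. a w + b w) = h a + h b" if "a \<in> ?A" "b \<in> ?A" for a b
    using h that by (simp add: is_haar_def coefficient_algebra_def)
  have smult: "h (\<lambda>w. c * a w) = c * h a" if "a \<in> ?A" for c a
    using h that by (simp add: is_haar_def coefficient_algebra_def)
  have one: "h (unit_coefficient (set xs)) = 1"
    using h by (simp add: is_haar_def coefficient_algebra_def)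
  obtain ps where ps: "set ps \<subseteq> ?A \<times> ?A" "\<And>v w. f (v @ w) = (\<Sum>(\<alpha>, \<beta>)\<leftarrow>ps. \<alpha> v * \<beta> w)"
    using coefficients_comult[OF f] by blast
  have "(\<lambda>w. \<Sum>p\<leftarrow>ps. haar_limit xs (fst p) * snd p w) = (\<lambda>w. haar_limit xs f * unit_coefficient (set xs) w)"
    using haar_limit_comult(1)[OF f ps] by simp
  then have "h (\<lambda>w. \<Sum>p\<leftarrow>ps. haar_limit xs (fst p) * snd p w) = haar_limit xs f * h (unit_coefficient (set xs))"
    using smult[OF coefficients_unit] by simp
  moreover have "h (\<lambda>w. \<Sum>p\<leftarrow>ps. haar_limit xs (fst p) * snd p w) = (\<Sum>p\<leftarrow>ps. haar_limit xs (fst p) * h (snd p))"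
    by (rule linear_sum_list[OF add smult refl]) (use ps(1) in auto)
  ultimately have 1: "(\<Sum>p\<leftarrow>ps. haar_limit xs (fst p) * h (snd p)) = haar_limit xs f"
    by (simp only: one mult_1_right)
  have "ps \<in> hcomult (coefficient_algebra (set xs)) f"
    using ps by (simp add: coefficient_algebra_def)
  then have "foldr (\<lambda>(b, c) s. (h c \<odot>\<^bsub>coefficient_algebra (set xs)\<^esub> b) \<oplus>\<^bsub>coefficient_algebra (set xs)\<^esub> s) ps
      \<zero>\<^bsub>coefficient_algebra (set xs)\<^esub> = h f \<odot>\<^bsub>coefficient_algebra (set xs)\<^esub> \<one>\<^bsub>coefficient_algebra (set xs)\<^esub>"
    using h f by (auto simp: is_haar_def) (simp_all add: coefficient_algebra_def)
  then have "(\<lambda>w. \<Sum>p\<leftarrow>ps. h (snd p) * fst p w) = (\<lambda>w. h f * unit_coefficient (set xs) w)"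
    unfolding case_prod_beta foldr_coefficient_algebra by (simp add: coefficient_algebra_def)
  then have "haar_limit xs (\<lambda>w. \<Sum>p\<leftarrow>ps. h (snd p) * fst p w) = h f * haar_limit xs (unit_coefficient (set xs))"
    using haar_limit_smult[OF coefficients_unit] by simp
  moreover have "haar_limit xs (\<lambda>w. \<Sum>p\<leftarrow>ps. h (snd p) * fst p w) = (\<Sum>p\<leftarrow>ps. h (snd p) * haar_limit xs (fst p))"
    by (rule linear_sum_list[OF haar_limit_add haar_limit_smult refl]) (use ps(1) in auto)
  ultimately have "(\<Sum>p\<leftarrow>ps. h (snd p) * haar_limit xs (fst p)) = h f"
    by (simp only: haar_limit_unit mult_1_right)
  with 1 show ?thesis by (simp only: mult.commute)
qed

lemma haar_eq_haar_limit:
  "f \<in> coefficients (set xs) \<Longrightarrow> haar (coefficient_algebra (set xs)) f = haar_limit xs f"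
  unfolding haar_def by (rule is_haar_unique[OF someI[of "is_haar _", OF is_haar_haar_limit]])

section \<open>Positivity and traciality of the Haar state\<close>

definition haar_inner :: "'x list \<Rightarrow> ('x word \<Rightarrow> complex) \<Rightarrow> ('x word \<Rightarrow> complex) \<Rightarrow> complex" where
  "haar_inner xs \<phi> \<psi> = haar_limit xs (convolution (set xs) (star_coefficient \<psi>) \<phi>)"

lemma coefficients_star_convolution:
  "\<phi> \<in> coefficients (set xs) \<Longrightarrow> \<psi> \<in> coefficients (set xs) \<Longrightarrow>
    convolution (set xs) (star_coefficient \<psi>) \<phi> \<in> coefficients (set xs)"
  by (intro coefficients_convolution coefficients_star) auto

text \<open>The GNS inner product is a limit of ordinary inner products of matrix columns, so
  sesquilinearity, positivity and Cauchy-Schwarz are inherited from finite sums.\<close>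

lemma haar_inner_tendsto:
  assumes "\<phi> \<in> coefficients (set xs)" "\<psi> \<in> coefficients (set xs)"
  shows "(\<lambda>k. \<Sum>zs\<in>seqs (set xs) (length (pal xs k)). \<phi> (zip zs (pal xs k)) * cnj (\<psi> (zip zs (pal xs k))))
    \<longlonglongrightarrow> haar_inner xs \<phi> \<psi>"
  using haar_limit_tendsto[OF coefficients_star_convolution[OF assms]]
  by (simp add: haar_inner_def diag_word_def star_convolution_diag mult.commute)

lemma haar_inner_sum:
  assumes "\<And>i. i \<in> I \<Longrightarrow> f i \<in> coefficients (set xs)" "\<And>j. j \<in> J \<Longrightarrow> g j \<in> coefficients (set xs)"
  shows "haar_inner xs (\<lambda>w. \<Sum>i\<in>I. a i * f i w) (\<lambda>w. \<Sum>j\<in>J. b j * g j w) =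
    (\<Sum>i\<in>I. \<Sum>j\<in>J. a i * cnj (b j) * haar_inner xs (f i) (g j))"
proof -
  let ?S = "\<lambda>k. seqs (set xs) (length (pal xs k))"
  have e: "(\<Sum>i\<in>I. \<Sum>j\<in>J. a i * cnj (b j) * (\<Sum>zs\<in>?S k. f i (zip zs (pal xs k)) * cnj (g j (zip zs (pal xs k))))) =
      (\<Sum>zs\<in>?S k. (\<Sum>i\<in>I. a i * f i (zip zs (pal xs k))) * cnj (\<Sum>j\<in>J. b j * g j (zip zs (pal xs k))))" for k
  proof -
    define t where "t i j zs = a i * cnj (b j) * (f i (zip zs (pal xs k)) * cnj (g j (zip zs (pal xs k))))" for i j zs
    have "(\<Sum>zs\<in>?S k. \<Sum>i\<in>I. \<Sum>j\<in>J. t i j zs) = (\<Sum>i\<in>I. \<Sum>zs\<in>?S k. \<Sum>j\<in>J. t i j zs)"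
      by (rule sum.swap)
    also have "\<dots> = (\<Sum>i\<in>I. \<Sum>j\<in>J. \<Sum>zs\<in>?S k. t i j zs)"
      by (intro sum.cong refl sum.swap)
    finally have s: "(\<Sum>zs\<in>?S k. \<Sum>i\<in>I. \<Sum>j\<in>J. t i j zs) = (\<Sum>i\<in>I. \<Sum>j\<in>J. \<Sum>zs\<in>?S k. t i j zs)" .
    have r: "(\<Sum>i\<in>I. a i * f i (zip zs (pal xs k))) * cnj (\<Sum>j\<in>J. b j * g j (zip zs (pal xs k))) =
        (\<Sum>i\<in>I. \<Sum>j\<in>J. t i j zs)" for zs
      unfolding cnj_sum sum_product t_def by (simp add: mult_ac)
    show ?thesis unfolding r s by (simp add: t_def sum_distrib_left)
  qed
  have "(\<lambda>k. \<Sum>zs\<in>?S k. (\<Sum>i\<in>I. a i * f i (zip zs (pal xs k))) * cnj (\<Sum>j\<in>J. b j * g j (zip zs (pal xs k))))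
      \<longlonglongrightarrow> (\<Sum>i\<in>I. \<Sum>j\<in>J. a i * cnj (b j) * haar_inner xs (f i) (g j))"
    unfolding e[symmetric] by (intro tendsto_sum tendsto_mult tendsto_const haar_inner_tendsto assms)
  moreover have "(\<lambda>w. \<Sum>i\<in>I. a i * f i w) \<in> coefficients (set xs)" "(\<lambda>w. \<Sum>j\<in>J. b j * g j w) \<in> coefficients (set xs)"
    by (intro coefficients_sum coefficients.smult assms; assumption)+
  ultimately show ?thesis by (intro LIMSEQ_unique[OF haar_inner_tendsto])
qed

lemma haar_inner_self:
  assumes "\<phi> \<in> coefficients (set xs)"
  shows "haar_inner xs \<phi> \<phi> = complex_of_real (Re (haar_inner xs \<phi> \<phi>))" and "Re (haar_inner xs \<phi> \<phi>) \<ge> 0"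
proof -
  note t = haar_inner_tendsto[OF assms assms]
  have "(\<lambda>k. 0 :: real) \<longlonglongrightarrow> Im (haar_inner xs \<phi> \<phi>)" using tendsto_Im[OF t] unfolding sum_mult_cnj by simp
  then have "Im (haar_inner xs \<phi> \<phi>) = 0" by (simp add: LIMSEQ_const_iff)
  then show "haar_inner xs \<phi> \<phi> = complex_of_real (Re (haar_inner xs \<phi> \<phi>))" by (simp add: complex_eq_iff)
  show "Re (haar_inner xs \<phi> \<phi>) \<ge> 0"
    using tendsto_Re[OF t] unfolding sum_mult_cnj Re_complex_of_real
    by (rule LIMSEQ_le_const) (intro exI allI impI sum_nonneg zero_le_power2)
qed

lemma haar_inner_Cauchy_Schwarz:
  assumes "\<phi> \<in> coefficients (set xs)" "\<psi> \<in> coefficients (set xs)"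
  shows "(cmod (haar_inner xs \<phi> \<psi>))\<^sup>2 \<le> Re (haar_inner xs \<phi> \<phi>) * Re (haar_inner xs \<psi> \<psi>)"
proof -
  let ?S = "\<lambda>k. seqs (set xs) (length (pal xs k))"
  have t: "(\<lambda>k. \<Sum>zs\<in>?S k. (cmod (f (zip zs (pal xs k))))\<^sup>2) \<longlonglongrightarrow> Re (haar_inner xs f f)"
    if "f \<in> coefficients (set xs)" for f
    using tendsto_Re[OF haar_inner_tendsto[OF that that]] unfolding sum_mult_cnj Re_complex_of_real .
  show ?thesis
    by (rule LIMSEQ_le[OF tendsto_power[OF tendsto_norm[OF haar_inner_tendsto[OF assms]]]
          tendsto_mult[OF t[OF assms(1)] t[OF assms(2)]]]) (intro exI allI impI sum_Cauchy_Schwarz)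
qed

section \<open>Translation invariance of the inner product\<close>

lemma haar_inner_translate_both:
  assumes \<phi>: "\<phi> \<in> coefficients (set xs)" and \<psi>: "\<psi> \<in> coefficients (set xs)"
    and p: "p \<in> set xs"
  shows "(\<Sum>y\<in>set xs. haar_inner xs (\<lambda>w. \<phi> ((y, p) # w)) (\<lambda>w. \<psi> ((y, p) # w))) = haar_inner xs \<phi> \<psi>"
proof -
  let ?f = "convolution (set xs) (star_coefficient \<psi>) \<phi>"
  let ?S = "\<lambda>k. seqs (set xs) (length (pal xs k))"
  have c: "(\<lambda>w. f ((y, p) # w)) \<in> coefficients (set xs)" if "f \<in> coefficients (set xs)" for f y
    using coefficients_prefix[OF that, of "[(y, p)]"] by simp
  have "(\<lambda>k. \<Sum>y\<in>set xs. \<Sum>zs\<in>?S k. \<phi> ((y, p) # zip zs (pal xs k)) * cnj (\<psi> ((y, p) # zip zs (pal xs k))))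
      \<longlonglongrightarrow> (\<Sum>y\<in>set xs. haar_inner xs (\<lambda>w. \<phi> ((y, p) # w)) (\<lambda>w. \<psi> ((y, p) # w)))"
    by (intro tendsto_sum haar_inner_tendsto c \<phi> \<psi>)
  \<comment> \<open>The sum over y is the sum over the first letter of the intermediate word. By
    invariance, the extra letter \<open>(p, p)\<close> in front has no effect in the limit.\<close>
  moreover have "?f ([(p, p)] @ diag_word (pal xs k)) =
      (\<Sum>y\<in>set xs. \<Sum>zs\<in>?S k. \<phi> ((y, p) # zip zs (pal xs k)) * cnj (\<psi> ((y, p) # zip zs (pal xs k))))" for k
    using star_convolution_diag[of "set xs" \<psi> \<phi> "p # pal xs k"]
    by (simp add: diag_word_def sum_seqs_Suc mult.commute)
  ultimately have "(\<lambda>k. ?f ([(p, p)] @ diag_word (pal xs k)))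
      \<longlonglongrightarrow> (\<Sum>y\<in>set xs. haar_inner xs (\<lambda>w. \<phi> ((y, p) # w)) (\<lambda>w. \<psi> ((y, p) # w)))" by simp
  then have "(\<Sum>y\<in>set xs. haar_inner xs (\<lambda>w. \<phi> ((y, p) # w)) (\<lambda>w. \<psi> ((y, p) # w))) =
      unit_coefficient (set xs) [(p, p)] * haar_limit xs ?f"
    using haar_limit_absorb_left[OF coefficients_star_convolution[OF \<phi> \<psi>]] by (rule LIMSEQ_unique)
  then show ?thesis using p by (simp add: unit_coefficient_def haar_inner_def)
qed

text \<open>Expanding the right hand side over a column by \<open>haar_inner_translate_both\<close>,
  the column relation leaves only the term \<open>z = y\<close>. Hence translation by one entry acts
  as an orthogonal projection.\<close>

lemma haar_inner_translate_left:
  assumes \<phi>: "\<phi> \<in> coefficients (set xs)" and \<psi>: "\<psi> \<in> coefficients (set xs)"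
    and yp: "y \<in> set xs" "p \<in> set xs"
  shows "haar_inner xs (\<lambda>w. \<phi> ((y, p) # w)) (\<lambda>w. \<psi> ((y, p) # w)) = haar_inner xs (\<lambda>w. \<phi> ((y, p) # w)) \<psi>"
proof -
  have "(\<lambda>w. \<phi> ((y, p) # w)) \<in> coefficients (set xs)"
    using coefficients_prefix[OF \<phi>, of "[(y, p)]"] by simp
  from haar_inner_translate_both[OF this \<psi> yp(2)]
  have "haar_inner xs (\<lambda>w. \<phi> ((y, p) # w)) \<psi> =
      (\<Sum>z\<in>set xs. haar_inner xs (\<lambda>w. \<phi> ((y, p) # (z, p) # w)) (\<lambda>w. \<psi> ((z, p) # w)))" ..
  also have "\<dots> = (\<Sum>z\<in>set xs. if z = y then haar_inner xs (\<lambda>w. \<phi> ((y, p) # w)) (\<lambda>w. \<psi> ((y, p) # w)) else 0)"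
  proof (intro sum.cong refl)
    fix z assume z: "z \<in> set xs"
    have "\<phi> ((y, p) # (z, p) # w) = (if y = z then \<phi> ((y, p) # w) else 0)" for w
      using coefficients_col'[OF \<phi> yp z, of "[]"] by simp
    then show "haar_inner xs (\<lambda>w. \<phi> ((y, p) # (z, p) # w)) (\<lambda>w. \<psi> ((z, p) # w)) =
        (if z = y then haar_inner xs (\<lambda>w. \<phi> ((y, p) # w)) (\<lambda>w. \<psi> ((y, p) # w)) else 0)"
      by (auto simp: haar_inner_def convolution_def haar_limit_def)
  qed
  finally show ?thesis using yp by simp
qed

text \<open>Passes from sums over a column to sums over a row: after
  \<open>haar_inner_translate_left\<close> only one argument is translated, and the entries of a row
  sum to 1.\<close>

lemma haar_inner_translate_row:
  assumes \<phi>: "\<phi> \<in> coefficients (set xs)" and \<psi>: "\<psi> \<in> coefficients (set xs)" and x: "x \<in> set xs"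
  shows "(\<Sum>p\<in>set xs. haar_inner xs (\<lambda>w. \<phi> ((x, p) # w)) (\<lambda>w. \<psi> ((x, p) # w))) = haar_inner xs \<phi> \<psi>"
proof -
  have c: "(\<lambda>w. \<phi> ((x, p) # w)) \<in> coefficients (set xs)" for p
    using coefficients_prefix[OF \<phi>, of "[(x, p)]"] by simp
  have "(\<Sum>p\<in>set xs. haar_inner xs (\<lambda>w. \<phi> ((x, p) # w)) (\<lambda>w. \<psi> ((x, p) # w))) =
      (\<Sum>p\<in>set xs. haar_inner xs (\<lambda>w. \<phi> ((x, p) # w)) \<psi>)"
    by (intro sum.cong refl haar_inner_translate_left[OF \<phi> \<psi> x])
  also have "\<dots> = haar_inner xs (\<lambda>w. \<Sum>p\<in>set xs. \<phi> ((x, p) # w)) \<psi>"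
    using haar_inner_sum[of "set xs" "\<lambda>p w. \<phi> ((x, p) # w)" xs "{()}" "\<lambda>_. \<psi>" "\<lambda>_. 1" "\<lambda>_. 1"] c \<psi>
    by simp
  also have "(\<lambda>w. \<Sum>p\<in>set xs. \<phi> ((x, p) # w)) = \<phi>"
    using coefficients_sum_row'[OF \<phi> x, of "[]"] by simp
  finally show ?thesis .
qed

lemma haar_inner_translate_word:
  assumes "\<phi> \<in> coefficients (set xs)" "\<psi> \<in> coefficients (set xs)" "set a \<subseteq> set xs"
  shows "(\<Sum>zs\<in>seqs (set xs) (length a). haar_inner xs (\<lambda>w. \<phi> (zip a zs @ w)) (\<lambda>w. \<psi> (zip a zs @ w))) =
    haar_inner xs \<phi> \<psi>"
  using assms
proof (induction a arbitrary: \<phi> \<psi>)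
  case (Cons x a)
  have c: "(\<lambda>w. f ((x, p) # w)) \<in> coefficients (set xs)" if "f \<in> coefficients (set xs)" for f p
    using coefficients_prefix[OF that, of "[(x, p)]"] by simp
  have "(\<Sum>zs\<in>seqs (set xs) (length (x # a)). haar_inner xs (\<lambda>w. \<phi> (zip (x # a) zs @ w)) (\<lambda>w. \<psi> (zip (x # a) zs @ w)))
    = (\<Sum>p\<in>set xs. \<Sum>zs\<in>seqs (set xs) (length a).
        haar_inner xs (\<lambda>w. \<phi> ((x, p) # zip a zs @ w)) (\<lambda>w. \<psi> ((x, p) # zip a zs @ w)))"
    by (simp add: sum_seqs_Suc)
  also have "\<dots> = (\<Sum>p\<in>set xs. haar_inner xs (\<lambda>w. \<phi> ((x, p) # w)) (\<lambda>w. \<psi> ((x, p) # w)))"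
    using Cons.prems by (intro sum.cong refl Cons.IH c) auto
  also have "\<dots> = haar_inner xs \<phi> \<psi>"
    using Cons.prems by (intro haar_inner_translate_row) auto
  finally show ?case .
qed simp

section \<open>The antipode and the trace property\<close>

lemma coefficients_antipode:
  assumes "f \<in> coefficients X" shows "antipode_coefficient f \<in> coefficients X"
proof -
  have "antipode_coefficient f = star_coefficient (\<lambda>w. cnj (f (rev w)))"
    by (simp add: antipode_coefficient_def star_coefficient_def fun_eq_iff rev_map)
  then show ?thesis using coefficients_star[OF coefficients_rev[OF assms]] by simp
qed

lemma antipode_zip:
  "length a = length b \<Longrightarrow> antipode_coefficient f (zip a b) = f (zip (rev b) (rev a))"
  by (simp add: antipode_coefficient_def map_swap_zip zip_rev)

lemma sum_seqs_rev: "(\<Sum>zs\<in>seqs X n. f (rev zs)) = (\<Sum>zs\<in>seqs X n. (f zs :: complex))"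
  by (rule sum.reindex_bij_witness[where i = rev and j = rev]) (auto simp: seqs_def)

text \<open>Diagonal entries are now inner products of rows. The antipode transposes and reverses
  words, and since \<open>pal xs k\<close> is its own reversal, rows become columns.\<close>

lemma haar_limit_convolution_star:
  assumes "\<phi> \<in> coefficients (set xs)" "\<psi> \<in> coefficients (set xs)"
  shows "haar_limit xs (convolution (set xs) \<phi> (star_coefficient \<psi>)) =
    haar_inner xs (antipode_coefficient \<phi>) (antipode_coefficient \<psi>)"
proof (rule haar_limitI)
  have "convolution (set xs) \<phi> (star_coefficient \<psi>) (diag_word (pal xs k)) =
    (\<Sum>zs\<in>seqs (set xs) (length (pal xs k)). antipode_coefficient \<phi> (zip zs (pal xs k)) *
       cnj (antipode_coefficient \<psi> (zip zs (pal xs k))))" for k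
    unfolding diag_word_def convolution_star_diag
    by (subst sum_seqs_rev[symmetric]) (simp add: antipode_zip length_seqs cong: sum.cong)
  then show "(\<lambda>k. convolution (set xs) \<phi> (star_coefficient \<psi>) (diag_word (pal xs k))) \<longlonglongrightarrow>
      haar_inner xs (antipode_coefficient \<phi>) (antipode_coefficient \<psi>)"
    using haar_inner_tendsto[OF coefficients_antipode coefficients_antipode, OF assms] by simp
qed

lemma coefficients_comult_sum:
  assumes "f \<in> coefficients X"
  obtains n :: nat and \<alpha> \<beta> where "\<And>i. \<alpha> i \<in> coefficients X" "\<And>i. \<beta> i \<in> coefficients X"
    "\<And>v w. f (v @ w) = (\<Sum>i<n. \<alpha> i v * \<beta> i w)"
proof -
  obtain ps where ps: "set ps \<subseteq> coefficients X \<times> coefficients X"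
    "\<And>v w. f (v @ w) = (\<Sum>(\<alpha>, \<beta>)\<leftarrow>ps. \<alpha> v * \<beta> w)"
    using coefficients_comult[OF assms] by blast
  define \<alpha> where "\<alpha> i = (if i < length ps then fst (ps ! i) else (\<lambda>w. 0))" for i
  define \<beta> where "\<beta> i = (if i < length ps then snd (ps ! i) else (\<lambda>w. 0))" for i
  show thesis
  proof (rule that[of \<alpha> \<beta> "length ps"])
    show "\<alpha> i \<in> coefficients X" "\<beta> i \<in> coefficients X" for i
    proof -
      have "i < length ps \<Longrightarrow> ps ! i \<in> coefficients X \<times> coefficients X" using ps(1) nth_mem by blast
      then show "\<alpha> i \<in> coefficients X" "\<beta> i \<in> coefficients X"
        using coefficients.zero by (auto simp: \<alpha>_def \<beta>_def mem_Times_iff)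
    qed
    show "f (v @ w) = (\<Sum>i<length ps. \<alpha> i v * \<beta> i w)" for v w
      unfolding ps(2) by (simp add: sum_list_sum_nth case_prod_beta \<alpha>_def \<beta>_def lessThan_atLeast0)
  qed
qed

text \<open>The right hand side is symmetric in the two legs of the coproduct, up to the antipode; this forces
  the trace property below.\<close>

lemma haar_inner_comult:
  assumes \<phi>: "\<phi> \<in> coefficients (set xs)" and \<psi>: "\<psi> \<in> coefficients (set xs)"
    and \<alpha>: "\<And>i. \<alpha> i \<in> coefficients (set xs)" "\<And>i. \<beta> i \<in> coefficients (set xs)"
      "\<And>v w. \<phi> (v @ w) = (\<Sum>i<(m :: nat). \<alpha> i v * \<beta> i w)"
    and \<gamma>: "\<And>i. \<gamma> i \<in> coefficients (set xs)" "\<And>i. \<delta> i \<in> coefficients (set xs)"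
      "\<And>v w. \<psi> (v @ w) = (\<Sum>j<(n :: nat). \<gamma> j v * \<delta> j w)"
  shows "haar_inner xs \<phi> \<psi> = (\<Sum>i<m. \<Sum>j<n.
    haar_inner xs (antipode_coefficient (\<alpha> i)) (antipode_coefficient (\<gamma> j)) * haar_inner xs (\<beta> i) (\<delta> j))"
proof -
  let ?S = "\<lambda>k. seqs (set xs) (length (pal xs k))"
  \<comment> \<open>The left hand side does not depend on k: translation along
    \<open>pal xs k\<close> preserves the inner product, and summing over the second coordinates
    turns the first legs into diagonal values. Letting k grow replaces these by values of the Haar
    functional.\<close>
  have e: "haar_inner xs \<phi> \<psi> = (\<Sum>i<m. \<Sum>j<n.
      convolution (set xs) (\<alpha> i) (star_coefficient (\<gamma> j)) (diag_word (pal xs k)) * haar_inner xs (\<beta> i) (\<delta> j))" for k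
  proof -
    have "haar_inner xs \<phi> \<psi> = (\<Sum>zs\<in>?S k. haar_inner xs (\<lambda>w. \<phi> (zip (pal xs k) zs @ w)) (\<lambda>w. \<psi> (zip (pal xs k) zs @ w)))"
      using haar_inner_translate_word[OF \<phi> \<psi> set_pal] ..
    also have "\<dots> = (\<Sum>zs\<in>?S k. \<Sum>i<m. \<Sum>j<n. \<alpha> i (zip (pal xs k) zs) * cnj (\<gamma> j (zip (pal xs k) zs)) *
        haar_inner xs (\<beta> i) (\<delta> j))"
      unfolding \<alpha>(3) \<gamma>(3) by (intro sum.cong refl haar_inner_sum \<alpha> \<gamma>)
    also have "\<dots> = (\<Sum>i<m. \<Sum>j<n. \<Sum>zs\<in>?S k. \<alpha> i (zip (pal xs k) zs) * cnj (\<gamma> j (zip (pal xs k) zs)) *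
        haar_inner xs (\<beta> i) (\<delta> j))"
      by (subst sum.swap) (intro sum.cong refl sum.swap)
    finally show ?thesis by (simp add: diag_word_def convolution_star_diag sum_distrib_right)
  qed
  have "(\<lambda>k. \<Sum>i<m. \<Sum>j<n.
      convolution (set xs) (\<alpha> i) (star_coefficient (\<gamma> j)) (diag_word (pal xs k)) * haar_inner xs (\<beta> i) (\<delta> j))
    \<longlonglongrightarrow> (\<Sum>i<m. \<Sum>j<n.
      haar_limit xs (convolution (set xs) (\<alpha> i) (star_coefficient (\<gamma> j))) * haar_inner xs (\<beta> i) (\<delta> j))"
    by (intro tendsto_sum tendsto_mult tendsto_const haar_limit_tendsto
        coefficients_convolution coefficients_star \<alpha> \<gamma> finite_set)
  then have "haar_inner xs \<phi> \<psi> = (\<Sum>i<m. \<Sum>j<n.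
      haar_limit xs (convolution (set xs) (\<alpha> i) (star_coefficient (\<gamma> j))) * haar_inner xs (\<beta> i) (\<delta> j))"
    by (simp only: e[symmetric] LIMSEQ_const_iff)
  then show ?thesis by (simp add: haar_limit_convolution_star \<alpha> \<gamma>)
qed

lemma antipode_append: "antipode_coefficient f (v @ w) = f (rev (map prod.swap w) @ rev (map prod.swap v))"
  by (simp add: antipode_coefficient_def)

lemma antipode_antipode [simp]: "antipode_coefficient (antipode_coefficient f) = f"
  by (simp add: antipode_coefficient_def fun_eq_iff rev_map comp_def)

lemma haar_limit_tracial:
  assumes \<phi>: "\<phi> \<in> coefficients (set xs)" and \<psi>: "\<psi> \<in> coefficients (set xs)"
  shows "haar_limit xs (convolution (set xs) \<phi> (star_coefficient \<psi>)) =
    haar_limit xs (convolution (set xs) (star_coefficient \<psi>) \<phi>)"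
proof -
  obtain m :: nat and \<alpha> \<beta> where \<alpha>: "\<And>i. \<alpha> i \<in> coefficients (set xs)" "\<And>i. \<beta> i \<in> coefficients (set xs)"
    "\<And>v w. \<phi> (v @ w) = (\<Sum>i<m. \<alpha> i v * \<beta> i w)" using coefficients_comult_sum[OF \<phi>] by metis
  obtain n :: nat and \<gamma> \<delta> where \<gamma>: "\<And>i. \<gamma> i \<in> coefficients (set xs)" "\<And>i. \<delta> i \<in> coefficients (set xs)"
    "\<And>v w. \<psi> (v @ w) = (\<Sum>i<n. \<gamma> i v * \<delta> i w)" using coefficients_comult_sum[OF \<psi>] by metis
  let ?S = antipode_coefficient
  \<comment> \<open>The antipode exchanges the legs of the coproduct, so the preceding formula
    applies with \<beta>, \<delta> in the place of \<alpha>, \<gamma>. As the antipode is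
    involutive, the same double sum results.\<close>
  have "haar_inner xs (?S \<phi>) (?S \<psi>) = (\<Sum>i<m. \<Sum>j<n.
      haar_inner xs (?S (?S (\<beta> i))) (?S (?S (\<delta> j))) * haar_inner xs (?S (\<alpha> i)) (?S (\<gamma> j)))"
    using \<alpha> \<gamma> by (intro haar_inner_comult)
      (auto intro: coefficients_antipode \<phi> \<psi> simp: antipode_append antipode_coefficient_def mult.commute)
  also have "\<dots> = haar_inner xs \<phi> \<psi>"
    unfolding haar_inner_comult[OF \<phi> \<psi> \<alpha> \<gamma>] by (simp add: mult.commute)
  finally show ?thesis
    by (simp add: haar_limit_convolution_star[OF \<phi> \<psi>] haar_inner_def)
qed

section \<open>The norm of a self-adjoint element from its moments\<close>

lemma coefficient_algebra_simps [simp]: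
  "carrier (coefficient_algebra X) = coefficients X"
  "\<phi> \<otimes>\<^bsub>coefficient_algebra X\<^esub> \<psi> = convolution X \<phi> \<psi>"
  "\<one>\<^bsub>coefficient_algebra X\<^esub> = unit_coefficient X"
  "\<zero>\<^bsub>coefficient_algebra X\<^esub> = (\<lambda>w. 0)"
  "\<phi> \<oplus>\<^bsub>coefficient_algebra X\<^esub> \<psi> = (\<lambda>w. \<phi> w + \<psi> w)"
  "hstar (coefficient_algebra X) = star_coefficient"
  "hcounit (coefficient_algebra X) \<phi> = \<phi> []"
  by (simp_all add: coefficient_algebra_def)

lemma convolution_zero [simp]:
  "convolution X (\<lambda>w. 0) \<psi> = (\<lambda>w. 0)" "convolution X \<phi> (\<lambda>w. 0) = (\<lambda>w. 0)"
  by (simp_all add: convolution_def fun_eq_iff)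

lemma convolution_unit_left:
  assumes "finite X" "f \<in> coefficients X"
  shows "convolution X (unit_coefficient X) f = f"
proof
  fix w :: "'a word"
  have "convolution X (unit_coefficient X) f w =
      (\<Sum>zs\<in>seqs X (length w). if map fst w = zs then f w else 0)"
    unfolding convolution_seqs
  proof (intro sum.cong refl)
    fix zs assume "zs \<in> seqs X (length w)"
    then have "length (map fst w) = length zs" "zs \<in> lists X" by (simp_all add: seqs_def)
    then show "unit_coefficient X (zip (map fst w) zs) * f (zip zs (map snd w)) = (if map fst w = zs then f w else 0)"
      by (auto simp: unit_coefficient_zip zip_map_fst_snd)
  qed
  also have "\<dots> = (if map fst w \<in> lists X then f w else 0)"
    using finite_seqs[OF assms(1)] by (simp add: seqs_def)
  also have "\<dots> = f w"
    using coefficients_outside[OF assms(2), of w] zip_in_lists_iff[of "map fst w" "map snd w" X]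
    by (simp add: zip_map_fst_snd)
  finally show "convolution X (unit_coefficient X) f w = f w" .
qed

lemma star_unit_coefficient: "star_coefficient (unit_coefficient X) = unit_coefficient X"
  by (auto simp: star_coefficient_def unit_coefficient_def fun_eq_iff)

lemma cmod_power2_le:
  assumes "(cmod z)\<^sup>2 \<le> a * b" "a \<ge> 0" "b \<ge> 0" shows "cmod z \<le> sqrt a * sqrt b"
  using real_le_rsqrt[OF assms(1)] by (simp add: real_sqrt_mult)

text \<open>Removes a constant factor from a geometric bound. The exponents are powers of 2 because
  repeated squaring supplies only those.\<close>

lemma power2_chain_le_one:
  fixes q C :: real
  assumes "\<And>i. q ^ (2 ^ i) \<le> C" shows "q \<le> 1"
proof (rule ccontr)
  assume "\<not> q \<le> 1"
  then have q: "q > 1" by simp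
  then obtain n where "C < q ^ n" using real_arch_pow by blast
  also have "q ^ n \<le> q ^ (2 ^ n)" using q by (intro power_increasing) (auto simp: less_imp_le)
  finally show False using assms[of n] by simp
qed

context
  fixes xs :: "'x list" and a :: "'x word \<Rightarrow> complex" and K \<theta> :: real
  assumes a: "a \<in> coefficients (set xs)" and star_a: "star_coefficient a = a"
    and moments: "\<And>n. cmod (haar_limit xs ((convolution (set xs) a ^^ n) (unit_coefficient (set xs)))) \<le> K * \<theta> ^ n"
    and \<theta>: "\<theta> > 0"
begin

abbreviation "act \<equiv> convolution (set xs) a"

lemma act_coefficients: "b \<in> coefficients (set xs) \<Longrightarrow> (act ^^ n) b \<in> coefficients (set xs)"
  by (induction n) (auto intro: coefficients_convolution a)

lemma act_convolution: "convolution (set xs) ((act ^^ n) b) c = (act ^^ n) (convolution (set xs) b c)"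
  by (induction n) (simp_all add: convolution_assoc)

lemma act_adjoint: "haar_inner xs ((act ^^ n) b) c = haar_inner xs b ((act ^^ n) c)"
proof (induction n arbitrary: b)
  case (Suc n)
  have "haar_inner xs (act b') c' = haar_inner xs b' (act c')" for b' c'
    by (simp add: haar_inner_def star_convolution star_a convolution_assoc)
  then show ?case using Suc by (simp del: funpow.simps add: funpow_Suc_right) (simp add: funpow_swap1)
qed simp

definition moment :: "('x word \<Rightarrow> complex) \<Rightarrow> nat \<Rightarrow> real" where
  "moment b n = Re (haar_inner xs ((act ^^ n) b) ((act ^^ n) b))"

lemma moment_nonneg: "b \<in> coefficients (set xs) \<Longrightarrow> moment b n \<ge> 0"
  unfolding moment_def by (intro haar_inner_self act_coefficients)

text \<open>Since a is self-adjoint, its powers move freely between the two arguments; only the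
  total exponent \<open>2 * (m + n)\<close> matters.\<close>

lemma moment_inner: "moment b (m + n) = Re (haar_inner xs ((act ^^ (2 * m)) b) ((act ^^ (2 * n)) b))"
proof -
  have funpow_act: "(act ^^ m) ((act ^^ n) b) = (act ^^ (m + n)) b" for m n by (simp add: funpow_add)
  have "haar_inner xs ((act ^^ (2 * m)) b) ((act ^^ (2 * n)) b) = haar_inner xs ((act ^^ (2 * n)) ((act ^^ (2 * m)) b)) b"
    by (simp add: act_adjoint)
  also have "(act ^^ (2 * n)) ((act ^^ (2 * m)) b) = (act ^^ (m + n)) ((act ^^ (m + n)) b)"
    unfolding funpow_act by (simp add: mult_2 add_ac)
  finally show ?thesis by (simp add: moment_def act_adjoint)
qed

text \<open>Cauchy-Schwarz for b and a^(2n) b, whose inner product is the squared norm of a^n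
  b.\<close>

lemma moment_power2:
  assumes "b \<in> coefficients (set xs)"
  shows "(moment b n)\<^sup>2 \<le> moment b 0 * moment b (2 * n)"
proof -
  have "(moment b n)\<^sup>2 \<le> (cmod (haar_inner xs b ((act ^^ (2 * n)) b)))\<^sup>2"
    using moment_inner[of b 0 n] abs_Re_le_cmod[of "haar_inner xs b ((act ^^ (2 * n)) b)"]
    by (simp add: abs_le_square_iff[symmetric])
  also have "\<dots> \<le> Re (haar_inner xs b b) * Re (haar_inner xs ((act ^^ (2 * n)) b) ((act ^^ (2 * n)) b))"
    by (intro haar_inner_Cauchy_Schwarz act_coefficients assms)
  finally show ?thesis by (simp add: moment_def)
qed

text \<open>By traciality \<open>\<langle>a\<^sup>2\<^sup>n b, b\<rangle>\<close> is the pairing of \<open>a\<^sup>2\<^sup>n\<close> with \<open>b b\<^sup>*\<close>, so its growth is governed by the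
  moments of \<open>a\<close>.\<close>

lemma moment_growth:
  assumes b: "b \<in> coefficients (set xs)"
  obtains C where "\<And>n. moment b n \<le> C * (\<theta>\<^sup>2) ^ n"
proof -
  let ?e = "unit_coefficient (set xs)"
  let ?c = "convolution (set xs) b (star_coefficient b)"
  let ?D = "Re (haar_inner xs ?c ?c)"
  have e: "?e \<in> coefficients (set xs)" by (rule coefficients_unit) simp
  have c: "?c \<in> coefficients (set xs)" by (intro coefficients_convolution coefficients_star b) simp
  have "moment b n \<le> sqrt ?D * sqrt K * (\<theta>\<^sup>2) ^ n" for n
  proof -
    let ?m = "2 * n"
    have "haar_inner xs ((act ^^ ?m) b) b = haar_limit xs (convolution (set xs) ((act ^^ ?m) b) (star_coefficient b))"
      unfolding haar_inner_def by (rule haar_limit_tracial[symmetric]) (intro act_coefficients b)+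
    also have "\<dots> = haar_inner xs ((act ^^ ?m) ?c) ?e"
      unfolding haar_inner_def star_unit_coefficient act_convolution
      by (simp add: convolution_unit_left act_coefficients c)
    also have "\<dots> = haar_inner xs ?c ((act ^^ ?m) ?e)" by (rule act_adjoint)
    finally have "moment b n = Re (haar_inner xs ?c ((act ^^ ?m) ?e))"
      using moment_inner[of b n 0] by simp
    also have "\<dots> \<le> cmod (haar_inner xs ?c ((act ^^ ?m) ?e))" by (rule complex_Re_le_cmod)
    \<comment> \<open>After this separation b enters only through the constant factor
      \<open>sqrt ?D\<close>; the growth in n comes from the powers of a alone.\<close>
    also have "\<dots> \<le> sqrt ?D * sqrt (moment ?e ?m)"
      unfolding moment_def using c e
      by (intro cmod_power2_le haar_inner_Cauchy_Schwarz haar_inner_self act_coefficients)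
    also have "\<dots> \<le> sqrt ?D * sqrt (K * \<theta> ^ (4 * n))"
    proof (intro mult_left_mono real_sqrt_le_mono)
      \<comment> \<open>The squared norm of a^(2n) is the moment of order 4n.\<close>
      have "moment ?e ?m = Re (haar_inner xs ((act ^^ (4 * n)) ?e) ?e)"
        using moment_inner[of ?e ?m 0] by simp
      also have "haar_inner xs ((act ^^ (4 * n)) ?e) ?e = haar_limit xs ((act ^^ (4 * n)) ?e)"
        unfolding haar_inner_def star_unit_coefficient by (simp add: convolution_unit_left act_coefficients e)
      finally show "moment ?e ?m \<le> K * \<theta> ^ (4 * n)"
        using order_trans[OF complex_Re_le_cmod moments] by simp
    qed (use haar_inner_self[OF c] in simp)
    also have "sqrt (K * \<theta> ^ (4 * n)) = sqrt K * (\<theta>\<^sup>2) ^ n"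
    proof -
      have "\<theta> ^ (4 * n) = ((\<theta>\<^sup>2) ^ n)\<^sup>2" by (simp add: power_mult[symmetric] mult.commute)
      then show ?thesis using \<theta> by (simp add: real_sqrt_mult)
    qed
    finally show ?thesis by (simp add: mult.assoc)
  qed
  then show thesis by (rule that)
qed

text \<open>Amplification: iterating \<open>moment_power2\<close> bounds the 2^i-th power of
  \<open>moment b n / moment b 0\<close> by \<open>moment b (2 ^ i * n) / moment b 0\<close>. The
  constant of \<open>moment_growth\<close>, which depends on b, disappears in the 2^i-th
  root.\<close>

lemma moment_le:
  assumes b: "b \<in> coefficients (set xs)"
  shows "moment b n \<le> (\<theta>\<^sup>2) ^ n * moment b 0"
proof (cases "moment b 0 = 0")
  case True
  then show ?thesis using moment_power2[OF b, of n] by simp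
next
  case False
  then have pos: "moment b 0 > 0" using moment_nonneg[OF b, of 0] by simp
  obtain C where C: "\<And>n. moment b n \<le> C * (\<theta>\<^sup>2) ^ n" using moment_growth[OF b] by blast
  define q where "q = moment b n / (moment b 0 * (\<theta>\<^sup>2) ^ n)"
  have chain: "(moment b n / moment b 0) ^ (2 ^ i) \<le> moment b (2 ^ i * n) / moment b 0" for i
  proof (induction i)
    case (Suc i)
    have "(moment b n / moment b 0) ^ (2 ^ Suc i) = ((moment b n / moment b 0) ^ (2 ^ i))\<^sup>2"
      by (simp add: power_mult[symmetric] mult.commute)
    also have "\<dots> \<le> (moment b (2 ^ i * n) / moment b 0)\<^sup>2"
      using Suc moment_nonneg[OF b] by (intro power_mono) simp_all
    also have "\<dots> \<le> (moment b 0 * moment b (2 * (2 ^ i * n))) / (moment b 0)\<^sup>2"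
      unfolding power_divide by (intro divide_right_mono moment_power2[OF b]) simp
    also have "\<dots> = moment b (2 ^ Suc i * n) / moment b 0"
      using pos by (simp add: power2_eq_square mult.assoc)
    finally show ?case .
  qed simp
  have "q ^ (2 ^ i) \<le> C / moment b 0" for i
  proof -
    have "q ^ (2 ^ i) = (moment b n / moment b 0) ^ (2 ^ i) / (\<theta>\<^sup>2) ^ (2 ^ i * n)"
      by (simp add: q_def power_divide power_mult_distrib power_mult mult.commute[of _ n])
    also have "\<dots> \<le> (C * (\<theta>\<^sup>2) ^ (2 ^ i * n) / moment b 0) / (\<theta>\<^sup>2) ^ (2 ^ i * n)"
      using \<theta> pos by (intro divide_right_mono order_trans[OF chain] C) simp_all
    also have "\<dots> = C / moment b 0" using \<theta> by simp
    finally show ?thesis .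
  qed
  then have "q \<le> 1" by (rule power2_chain_le_one)
  then show ?thesis using pos \<theta> by (simp add: q_def pos_divide_le_eq mult.commute)
qed

section \<open>From moments to the reduced norm and amenability\<close>

abbreviation "alg \<equiv> coefficient_algebra (set xs)"

lemma l2_norm_coefficient:
  assumes "b \<in> coefficients (set xs)"
  shows "l2_norm alg b = sqrt (Re (haar_inner xs b b))"
proof -
  have "l2_norm alg b = sqrt (Re (haar alg (convolution (set xs) (star_coefficient b) b)))"
    by (simp add: l2_norm_def)
  then show ?thesis
    using assms by (simp add: haar_eq_haar_limit coefficients_star_convolution haar_inner_def)
qed

lemma l2_norm_act:
  assumes b: "b \<in> coefficients (set xs)"
  shows "l2_norm alg ((act ^^ n) b) \<le> \<theta> ^ n * l2_norm alg b"
proof -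
  have "l2_norm alg ((act ^^ n) b) = sqrt (moment b n)"
    by (simp add: l2_norm_coefficient act_coefficients b moment_def)
  also have "\<dots> \<le> sqrt ((\<theta> ^ n)\<^sup>2 * moment b 0)"
    using moment_le[OF b, of n] by (simp add: power_mult[symmetric] mult.commute)
  also have "\<dots> = \<theta> ^ n * l2_norm alg b"
    using \<theta> by (simp add: real_sqrt_mult l2_norm_coefficient b moment_def)
  finally show ?thesis .
qed

lemma l2_norm_zero: "l2_norm alg (\<lambda>w. 0) = 0"
proof -
  have "haar_inner xs (\<lambda>w. 0) (\<lambda>w. 0) = 0"
    unfolding haar_inner_def by (rule haar_limitI) (simp add: convolution_def)
  then show ?thesis using l2_norm_coefficient[OF coefficients.zero] by simp
qed

lemma reduced_norm_act:
  "reduced_norm alg ((act ^^ n) (unit_coefficient (set xs))) \<le> \<theta> ^ n"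
  "reduced_norm alg ((act ^^ n) (unit_coefficient (set xs))) \<ge> 0"
proof -
  let ?c = "(act ^^ n) (unit_coefficient (set xs))"
  let ?B = "{b \<in> carrier alg. l2_norm alg b \<le> 1}"
  have B: "l2_norm alg (?c \<otimes>\<^bsub>alg\<^esub> b) \<le> \<theta> ^ n" if "b \<in> ?B" for b
  proof -
    have b: "b \<in> coefficients (set xs)" "l2_norm alg b \<le> 1" using that by (auto)
    have "?c \<otimes>\<^bsub>alg\<^esub> b = (act ^^ n) b"
      using b by (simp add: act_convolution convolution_unit_left)
    then have "l2_norm alg (?c \<otimes>\<^bsub>alg\<^esub> b) \<le> \<theta> ^ n * l2_norm alg b" using l2_norm_act[OF b(1)] by simp
    also have "\<dots> \<le> \<theta> ^ n" using b \<theta> by (simp add: mult_left_le)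
    finally show ?thesis .
  qed
  have z: "(\<lambda>w. 0) \<in> ?B" using l2_norm_zero coefficients.zero by simp
  show "reduced_norm alg ?c \<le> \<theta> ^ n"
    unfolding reduced_norm_def using z B by (intro cSUP_least) auto
  \<comment> \<open>The zero vector lies in the unit ball; since the supremum is over a bounded set,
    it dominates the value 0 attained there.\<close>
  have "0 = l2_norm alg (?c \<otimes>\<^bsub>alg\<^esub> (\<lambda>w. 0))"
    using l2_norm_zero by simp
  also have "\<dots> \<le> reduced_norm alg ?c"
    unfolding reduced_norm_def using z by (rule cSUP_upper) (use B in \<open>auto intro!: bdd_aboveI\<close>)
  finally show "reduced_norm alg ?c \<ge> 0" .
qed

text \<open>The additive inverse is a definite description in the additive monoid and is computed
  directly here. This is what makes constant sequences Cauchy.\<close>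

lemma coefficient_algebra_minus_self:
  assumes "c \<in> coefficients (set xs)"
  shows "c \<ominus>\<^bsub>alg\<^esub> c = (\<lambda>w. 0)"
proof -
  have "(\<lambda>w. - c w) \<in> coefficients (set xs)" using coefficients.smult[OF assms, of "-1"] by simp
  then have neg: "\<ominus>\<^bsub>alg\<^esub> c = (\<lambda>w. - c w)"
    unfolding a_inv_def m_inv_def
  proof (intro the_equality)
    fix y
    assume "y \<in> carrier (add_monoid alg) \<and> c \<otimes>\<^bsub>add_monoid alg\<^esub> y = \<one>\<^bsub>add_monoid alg\<^esub> \<and>
      y \<otimes>\<^bsub>add_monoid alg\<^esub> c = \<one>\<^bsub>add_monoid alg\<^esub>"
    then have "(\<lambda>w. c w + y w) = (\<lambda>w. 0)" by simp
    then have "c w + y w = 0" for w by (rule fun_cong)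
    then show "y = (\<lambda>w. - c w)" by (intro ext minus_unique[symmetric])
  qed simp
  show ?thesis by (simp add: a_minus_def neg)
qed

lemma reduced_norm_zero: "reduced_norm alg (\<lambda>w. 0) = 0"
proof -
  let ?B = "{b \<in> carrier alg. l2_norm alg b \<le> 1}"
  have "(\<lambda>w. 0) \<in> ?B" using l2_norm_zero coefficients.zero by simp
  moreover have "l2_norm alg ((\<lambda>w. 0) \<otimes>\<^bsub>alg\<^esub> b) = 0" for b
    using l2_norm_zero by simp
  ultimately show ?thesis unfolding reduced_norm_def by (auto intro!: cSUP_const)
qed

lemma constant_reduced_algebra:
  "c \<in> coefficients (set xs) \<Longrightarrow> (\<lambda>k. c) \<in> reduced_algebra alg"
  by (simp add: reduced_algebra_def coefficient_algebra_minus_self reduced_norm_zero)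

lemma act_counit: "(act ^^ n) (unit_coefficient (set xs)) [] = a [] ^ n"
  by (induction n) (simp_all add: convolution_seqs unit_coefficient_def)

text \<open>The counit is multiplicative, so its bounded extension gives
  \<open>cmod (a []) ^ n \<le> C * \<theta> ^ n\<close> up to the sign of C; taking roots removes
  the constant.\<close>

lemma amenable_counit_le:
  assumes "amenable alg"
  shows "cmod (a []) \<le> \<theta>"
proof -
  obtain F C where F: "\<And>c. c \<in> coefficients (set xs) \<Longrightarrow> F (\<lambda>k. c) = c []"
    and C: "\<And>b. b \<in> reduced_algebra alg \<Longrightarrow> norm (F b) \<le> C * reduced_algebra_norm alg b"
  proof -
    from assms obtain F where F: "bounded_star_hom alg F" "\<forall>c\<in>carrier alg. F (\<lambda>k. c) = hcounit alg c"
      unfolding amenable_def by blast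
    from F(1) obtain C where "\<forall>b\<in>reduced_algebra alg. norm (F b) \<le> C * reduced_algebra_norm alg b"
      unfolding bounded_star_hom_def by blast
    then show thesis using F(2) by (intro that[of F C]) simp_all
  qed
  have "(cmod (a []) / \<theta>) ^ n \<le> \<bar>C\<bar>" for n
  proof -
    let ?c = "(act ^^ n) (unit_coefficient (set xs))"
    have c: "?c \<in> coefficients (set xs)" by (intro act_coefficients coefficients_unit) simp
    have "cmod (a []) ^ n = norm (F (\<lambda>k. ?c))" by (simp add: F[OF c] act_counit norm_power)
    also have "\<dots> \<le> C * reduced_norm alg ?c"
      using C[OF constant_reduced_algebra[OF c]] by (simp add: reduced_algebra_norm_def)
    \<comment> \<open>The constant in \<open>bounded_star_hom\<close> is not assumed nonnegative,
      hence the absolute value.\<close>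
    also have "\<dots> \<le> \<bar>C\<bar> * \<theta> ^ n"
      using reduced_norm_act[of n] by (intro mult_mono) auto
    finally show ?thesis using \<theta> by (simp add: power_divide pos_divide_le_eq)
  qed
  then have "cmod (a []) / \<theta> \<le> 1" by (intro power2_chain_le_one)
  then show ?thesis using \<theta> by simp
qed

end

section \<open>Quaternions\<close>

datatype quat = Quat (q0: real) (q1: real) (q2: real) (q3: real)

fun qmult :: "quat \<Rightarrow> quat \<Rightarrow> quat" (infixl "\<star>" 70) where
  "Quat a b c d \<star> Quat a' b' c' d' =
     Quat (a * a' - b * b' - c * c' - d * d') (a * b' + b * a' + c * d' - d * c')
       (a * c' - b * d' + c * a' + d * b') (a * d' + b * c' - c * b' + d * a')"

fun qconj :: "quat \<Rightarrow> quat" where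
  "qconj (Quat a b c d) = Quat a (- b) (- c) (- d)"

fun qdot :: "quat \<Rightarrow> quat \<Rightarrow> real" where
  "qdot (Quat a b c d) (Quat a' b' c' d') = a * a' + b * b' + c * c' + d * d'"

fun qscale :: "real \<Rightarrow> quat \<Rightarrow> quat" where
  "qscale t (Quat a b c d) = Quat (t * a) (t * b) (t * c) (t * d)"

definition qcoord :: "quat \<Rightarrow> nat \<Rightarrow> real" where
  "qcoord p a = (if a = 0 then q0 p else if a = 1 then q1 p else if a = 2 then q2 p else q3 p)"

text \<open>The units 1, i, j, k carry the indices 1 to 4, matching the points of
  \<open>Sigma_plus 4\<close>; coordinates in \<open>qcoord\<close> run from 0 to 3 like matrix
  indices. Any other index yields k.\<close>

definition qbasis :: "nat \<Rightarrow> quat" where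
  "qbasis i = (if i = 1 then Quat 1 0 0 0 else if i = 2 then Quat 0 1 0 0
     else if i = 3 then Quat 0 0 1 0 else Quat 0 0 0 1)"

lemma qmult_assoc: "p \<star> q \<star> r = p \<star> (q \<star> r)"
  by (cases p; cases q; cases r) (simp add: algebra_simps)

lemma qdot_mult_left: "qdot (p \<star> q) r = qdot q (qconj p \<star> r)"
  by (cases p; cases q; cases r) (simp add: algebra_simps)

lemma qdot_mult_right: "qdot (p \<star> q) r = qdot p (r \<star> qconj q)"
  by (cases p; cases q; cases r) (simp add: algebra_simps)

lemma qdot_commute: "qdot p q = qdot q p"
  by (cases p; cases q) (simp add: mult.commute)

lemma qdot_mult_cancel_left: "qdot (p \<star> q) (p \<star> r) = qdot p p * qdot q r"
  by (cases p; cases q; cases r) (simp add: algebra_simps)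

lemma qdot_mult_cancel_right: "qdot (q \<star> p) (r \<star> p) = qdot p p * qdot q r"
  by (cases p; cases q; cases r) (simp add: algebra_simps)

lemma qdot_scale: "qdot (qscale s p) (qscale t q) = s * t * qdot p q"
  by (cases p; cases q) (simp add: algebra_simps)

lemma qmult_scale: "qscale t p \<star> q = qscale t (p \<star> q)" "p \<star> qscale t q = qscale t (p \<star> q)"
  by (cases p; cases q; simp add: algebra_simps)+

lemma qscale_qscale: "qscale s (qscale t p) = qscale (s * t) p"
  by (cases p) simp

lemma qscale_1 [simp]: "qscale 1 p = p"
  by (cases p) simp

lemma qdot_Cauchy_Schwarz: "(qdot p q)\<^sup>2 \<le> qdot p p * qdot q q"
proof (cases p; cases q)
  fix a b c d a' b' c' d'
  assume p: "p = Quat a b c d" "q = Quat a' b' c' d'"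
  have "qdot p p * qdot q q - (qdot p q)\<^sup>2 = (a * b' - b * a')\<^sup>2 + (a * c' - c * a')\<^sup>2 + (a * d' - d * a')\<^sup>2
      + (b * c' - c * b')\<^sup>2 + (b * d' - d * b')\<^sup>2 + (c * d' - d * c')\<^sup>2"
    by (simp add: p power2_eq_square algebra_simps)
  moreover have "\<dots> \<ge> 0" by simp
  ultimately show ?thesis by linarith
qed

lemma sum_less_4: "(\<Sum>a<(4 :: nat). f a) = f 0 + f 1 + f 2 + (f 3 :: 'a :: comm_monoid_add)"
  by (simp add: numeral_eq_Suc add.assoc)

lemma sum_1_4: "(\<Sum>i\<in>{1..4 :: nat}. f i) = f 1 + f 2 + f 3 + (f 4 :: 'a :: comm_monoid_add)"
proof -
  have "{1..4 :: nat} = {1, 2, 3, 4}" by auto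
  then show ?thesis by (simp add: add.assoc)
qed

lemma in_1_4: "i \<in> {1..4 :: nat} \<longleftrightarrow> i = 1 \<or> i = 2 \<or> i = 3 \<or> i = 4"
  by auto

lemma qdot_coord: "qdot p q = (\<Sum>a<4. qcoord p a * qcoord q a)"
  by (cases p; cases q) (simp add: sum_less_4 qcoord_def)

lemma qbasis_orthonormal:
  "i \<in> {1..4} \<Longrightarrow> j \<in> {1..4} \<Longrightarrow> qdot (qbasis i) (qbasis j) = (if i = j then 1 else 0)"
  unfolding in_1_4 by (auto simp: qbasis_def)

text \<open>For nonzero p, multiplication by p on either side is a similarity and sends the units to
  an orthogonal basis. This is its completeness relation in coordinates, the source of the row and
  column sums.\<close>

lemma qbasis_complete:
  assumes "a < 4" "b < 4"
  shows "(\<Sum>j\<in>{1..4}. qcoord (p \<star> qbasis j) a * qcoord (p \<star> qbasis j) b) = (if a = b then qdot p p else 0)"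
    and "(\<Sum>j\<in>{1..4}. qcoord (qbasis j \<star> p) a * qcoord (qbasis j \<star> p) b) = (if a = b then qdot p p else 0)"
proof -
  have ab: "a = 0 \<or> a = 1 \<or> a = 2 \<or> a = 3" "b = 0 \<or> b = 1 \<or> b = 2 \<or> b = 3" using assms by auto
  show "(\<Sum>j\<in>{1..4}. qcoord (p \<star> qbasis j) a * qcoord (p \<star> qbasis j) b) = (if a = b then qdot p p else 0)"
    using ab unfolding sum_1_4 by (cases p) (elim disjE; simp add: qcoord_def qbasis_def algebra_simps)
  show "(\<Sum>j\<in>{1..4}. qcoord (qbasis j \<star> p) a * qcoord (qbasis j \<star> p) b) = (if a = b then qdot p p else 0)"
    using ab unfolding sum_1_4 by (cases p) (elim disjE; simp add: qcoord_def qbasis_def algebra_simps)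
qed

section \<open>Quantum permutations of four points from quaternions\<close>

definition qvec :: "quat \<Rightarrow> nat \<times> nat \<Rightarrow> quat" where
  "qvec x l = qbasis (fst l) \<star> x \<star> qbasis (snd l)"

definition pauli :: "quat \<Rightarrow> nat \<Rightarrow> nat \<Rightarrow> complex mat" where
  "pauli x i j = mat 4 4 (\<lambda>(a, b). complex_of_real (qcoord (qvec x (i, j)) a * qcoord (qvec x (i, j)) b / qdot x x))"

text \<open>The Gram matrix of the vectors spanning the lines, normalised to unit length.\<close>

definition kernel :: "quat \<Rightarrow> nat \<times> nat \<Rightarrow> nat \<times> nat \<Rightarrow> real" where
  "kernel x l l' = qdot (qvec x l) (qvec x l') / qdot x x"

lemma pauli_carrier: "pauli x i j \<in> carrier_mat 4 4"
  by (simp add: pauli_def)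

lemma qvec_norm:
  "i \<in> {1..4} \<Longrightarrow> j \<in> {1..4} \<Longrightarrow> qdot (qvec x (i, j)) (qvec x (i, j)) = qdot x x"
  by (simp add: qvec_def qdot_mult_cancel_left qdot_mult_cancel_right qbasis_orthonormal)

lemma pauli_mult:
  assumes "a < 4" "b < 4"
  shows "(pauli x i j * pauli x i' j') $$ (a, b) = complex_of_real
    (qcoord (qvec x (i, j)) a * qcoord (qvec x (i', j')) b * kernel x (i, j) (i', j') / qdot x x)"
proof -
  have "(pauli x i j * pauli x i' j') $$ (a, b) = (\<Sum>c<4. pauli x i j $$ (a, c) * pauli x i' j' $$ (c, b))"
    by (rule index_mult_sum[OF pauli_carrier pauli_carrier assms])
  also have "\<dots> = complex_of_real (\<Sum>c<4. (qcoord (qvec x (i, j)) a * qcoord (qvec x (i', j')) b / qdot x x / qdot x x) *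
      (qcoord (qvec x (i, j)) c * qcoord (qvec x (i', j')) c))"
    unfolding of_real_sum using assms by (intro sum.cong refl) (simp add: pauli_def)
  also have "\<dots> = complex_of_real
    (qcoord (qvec x (i, j)) a * qcoord (qvec x (i', j')) b * kernel x (i, j) (i', j') / qdot x x)"
    unfolding sum_distrib_left[symmetric] by (simp add: kernel_def qdot_coord)
  finally show ?thesis .
qed

text \<open>Vectors in a row share the left factor c_i x, those in a column the right factor x c_j.
  Multiplication by a common factor is a similarity, so orthogonality reduces to that of the
  units.\<close>

lemma quantum_permutation_pauli:
  assumes x: "qdot x x > 0"
  shows "quantum_permutation {1..4} 4 (pauli x)"
proof -
  have proj: "projection_mat 4 (pauli x i j)" if "i \<in> {1..4}" "j \<in> {1..4}" for i j
  proof -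
    have "pauli x i j * pauli x i j = pauli x i j"
    proof (rule eq_matI)
      fix a b assume "a < dim_row (pauli x i j)" "b < dim_col (pauli x i j)"
      then have ab: "a < 4" "b < 4" by (simp_all add: pauli_def)
      then show "(pauli x i j * pauli x i j) $$ (a, b) = pauli x i j $$ (a, b)"
        using x that by (simp add: pauli_mult kernel_def qvec_norm) (simp add: pauli_def)
    qed (simp_all add: pauli_def)
    then show ?thesis by (simp add: projection_mat_iff pauli_carrier) (simp add: pauli_def mult.commute)
  qed
  have row: "kernel x (i, j) (i, j') = 0" if "i \<in> {1..4}" "j \<in> {1..4}" "j' \<in> {1..4}" "j \<noteq> j'" for i j j'
    using that by (simp add: kernel_def qvec_def qmult_assoc qdot_mult_cancel_left qbasis_orthonormal)
  have col: "kernel x (i, j) (i', j) = 0" if "i \<in> {1..4}" "i' \<in> {1..4}" "j \<in> {1..4}" "i \<noteq> i'" for i i' j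
    using that by (simp add: kernel_def qvec_def qdot_mult_cancel_right qbasis_orthonormal)
  have zero: "pauli x i j * pauli x i' j' = 0\<^sub>m 4 4" if "kernel x (i, j) (i', j') = 0" for i j i' j'
    by (rule eq_matI) (use that in \<open>simp_all add: pauli_mult\<close>, simp_all add: pauli_def)
  have sums: "(\<Sum>j\<in>{1..4}. pauli x i j $$ (a, b)) = (if a = b then 1 else 0)"
    "(\<Sum>j\<in>{1..4}. pauli x j i $$ (a, b)) = (if a = b then 1 else 0)"
    if i: "i \<in> {1..4}" and ab: "a < 4" "b < 4" for i a b
  proof -
    have n: "qdot (qbasis i \<star> x) (qbasis i \<star> x) = qdot x x" "qdot (x \<star> qbasis i) (x \<star> qbasis i) = qdot x x"
      using i by (simp_all add: qdot_mult_cancel_left qdot_mult_cancel_right qbasis_orthonormal)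
    have "(\<Sum>j\<in>{1..4}. pauli x i j $$ (a, b)) = complex_of_real
        ((\<Sum>j\<in>{1..4}. qcoord (qbasis i \<star> x \<star> qbasis j) a * qcoord (qbasis i \<star> x \<star> qbasis j) b) / qdot x x)"
      using ab by (simp add: pauli_def qvec_def sum_divide_distrib)
    then show "(\<Sum>j\<in>{1..4}. pauli x i j $$ (a, b)) = (if a = b then 1 else 0)"
      unfolding qbasis_complete[OF ab] using x n by simp
    have "(\<Sum>j\<in>{1..4}. pauli x j i $$ (a, b)) = complex_of_real
        ((\<Sum>j\<in>{1..4}. qcoord (qbasis j \<star> (x \<star> qbasis i)) a * qcoord (qbasis j \<star> (x \<star> qbasis i)) b) / qdot x x)"
      using ab by (simp add: pauli_def qvec_def sum_divide_distrib qmult_assoc)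
    then show "(\<Sum>j\<in>{1..4}. pauli x j i $$ (a, b)) = (if a = b then 1 else 0)"
      unfolding qbasis_complete[OF ab] using x n by simp
  qed
  show ?thesis
    unfolding quantum_permutation_def sum_mat_eq_one_iff
    using proj zero[OF row] zero[OF col] sums by blast
qed

fun path :: "quat \<Rightarrow> nat \<times> nat \<Rightarrow> nat word \<Rightarrow> nat \<times> nat \<Rightarrow> real" where
  "path x l [] l' = kernel x l l'"
| "path x l (m # w) l' = kernel x l m * path x m w l'"

text \<open>The trace of a product of rank one projections is the cyclic product of the Gram matrix,
  a closed \<open>path\<close>. The empty word gives the trace of the identity, which is the
  counit.\<close>

definition character :: "quat \<Rightarrow> nat word \<Rightarrow> complex" where
  "character x w = (if w \<in> lists ({1..4} \<times> {1..4}) then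
     case w of [] \<Rightarrow> 4 | l # w' \<Rightarrow> complex_of_real (path x l w' l) else 0)"

lemma word_mat_path:
  assumes "w \<in> lists ({1..4} \<times> {1..4})" and x: "qdot x x > 0"
  shows "(\<Sum>a<4. \<Sum>b<4. complex_of_real (qcoord (qvec x l) a) * word_mat 4 (pauli x) w $$ (a, b) *
      complex_of_real (qcoord (qvec x l') b)) = complex_of_real (path x l w l' * qdot x x)"
  using assms(1)
proof (induction w arbitrary: l rule: list.induct)
  case Nil
  have "(\<Sum>a<4. \<Sum>b<4. complex_of_real (qcoord (qvec x l) a) * word_mat 4 (pauli x) [] $$ (a, b) *
      complex_of_real (qcoord (qvec x l') b)) = complex_of_real (qdot (qvec x l) (qvec x l'))"
    by (simp add: sum_less_4 qdot_coord)
  then show ?case using x by (simp add: kernel_def)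
next
  case (Cons m w)
  obtain i j where m: "m = (i, j)" by (cases m)
  have w: "w \<in> lists ({1..4} \<times> {1..4})" using Cons.prems by simp
  have M: "word_mat 4 (pauli x) w \<in> carrier_mat 4 4"
    by (rule word_mat_carrier[OF _ w]) (rule pauli_carrier)
  let ?V = "\<lambda>l a. complex_of_real (qcoord (qvec x l) a)"
  let ?M = "\<lambda>a b. word_mat 4 (pauli x) w $$ (a, b)"
  have "word_mat 4 (pauli x) (m # w) $$ (a, b) = (\<Sum>c<4. ?V m a * ?V m c / complex_of_real (qdot x x) * ?M c b)"
    if "a < 4" "b < 4" for a b
  proof -
    have "word_mat 4 (pauli x) (m # w) $$ (a, b) = (\<Sum>c<4. pauli x i j $$ (a, c) * ?M c b)"
      unfolding m word_mat.simps by (rule index_mult_sum[OF pauli_carrier M that])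
    also have "\<dots> = (\<Sum>c<4. ?V m a * ?V m c / complex_of_real (qdot x x) * ?M c b)"
      using that by (intro sum.cong refl) (simp add: pauli_def m)
    finally show ?thesis .
  qed
  then have "(\<Sum>a<4. \<Sum>b<4. ?V l a * word_mat 4 (pauli x) (m # w) $$ (a, b) * ?V l' b) =
      (\<Sum>a<4. \<Sum>b<4. ?V l a * (\<Sum>c<4. ?V m a * ?V m c / complex_of_real (qdot x x) * ?M c b) * ?V l' b)"
    by (simp del: word_mat.simps)
  also have "\<dots> = (\<Sum>a<4. ?V l a * ?V m a / complex_of_real (qdot x x)) * (\<Sum>c<4. \<Sum>b<4. ?V m c * ?M c b * ?V l' b)"
    unfolding sum_less_4 by (simp add: divide_inverse algebra_simps)
  also have "(\<Sum>a<4. ?V l a * ?V m a / complex_of_real (qdot x x)) = complex_of_real (kernel x l m)"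
    by (simp add: kernel_def qdot_coord sum_divide_distrib)
  also have "(\<Sum>c<4. \<Sum>b<4. ?V m c * ?M c b * ?V l' b) = complex_of_real (path x m w l' * qdot x x)"
    by (rule Cons.IH[OF w])
  finally show ?case by simp
qed

lemma character_coefficients:
  assumes x: "qdot x x > 0"
  shows "character x \<in> coefficients {1..4}"
proof -
  have "character x w = (\<Sum>a<4. coefficient {1..4} 4 (pauli x) (unit_vec 4 a) (unit_vec 4 a) w)" for w
  proof (cases "w \<in> lists ({1..4} \<times> {1..4})")
    case True
    have M: "word_mat 4 (pauli x) w \<in> carrier_mat 4 4" if "w \<in> lists ({1..4} \<times> {1..4})" for w
      by (rule word_mat_carrier[OF _ that]) (rule pauli_carrier)
    have c: "conjugate (unit_vec 4 a :: complex vec) = unit_vec 4 a" for a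
      by (rule eq_vecI) (auto simp: unit_vec_def)
    have "coefficient {1..4} 4 (pauli x) (unit_vec 4 a) (unit_vec 4 a) w = word_mat 4 (pauli x) w $$ (a, a)"
      if "a < 4" for a
      using True M[OF True] that by (simp add: coefficient_def c)
    then have e: "(\<Sum>a<4. coefficient {1..4} 4 (pauli x) (unit_vec 4 a) (unit_vec 4 a) w) =
        (\<Sum>a<4. word_mat 4 (pauli x) w $$ (a, a))" by simp
    show ?thesis
    proof (cases w)
      case Nil
      then show ?thesis unfolding e by (simp add: character_def sum_less_4)
    next
      case (Cons l w')
      obtain i j where l: "l = (i, j)" by (cases l)
      have w': "w' \<in> lists ({1..4} \<times> {1..4})" using True Cons by simp
      let ?V = "\<lambda>l a. complex_of_real (qcoord (qvec x l) a)"
      have "(\<Sum>a<4. word_mat 4 (pauli x) w $$ (a, a)) =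
          (\<Sum>a<4. \<Sum>c<4. pauli x i j $$ (a, c) * word_mat 4 (pauli x) w' $$ (c, a))"
        unfolding Cons l word_mat.simps
        by (intro sum.cong refl index_mult_sum[OF pauli_carrier M[OF w']]) auto
      also have "\<dots> = (\<Sum>a<4. \<Sum>c<4. ?V l c * word_mat 4 (pauli x) w' $$ (c, a) * ?V l a) / complex_of_real (qdot x x)"
        unfolding sum_divide_distrib by (intro sum.cong refl) (simp add: pauli_def l)
      also have "\<dots> = complex_of_real (path x l w' l)"
        using x by (subst sum.swap) (simp add: word_mat_path[OF w' x])
      finally show ?thesis unfolding e using True Cons by (simp add: character_def)
    qed
  qed (simp add: character_def coefficient_def)
  then have "character x = (\<lambda>w. \<Sum>a<4. coefficient {1..4} 4 (pauli x) (unit_vec 4 a) (unit_vec 4 a) w)" by blast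
  then show ?thesis
    by (simp only:) (intro coefficients_sum coefficients.coeff quantum_permutation_pauli x unit_vec_carrier)
qed

subsection \<open>Fusion rules\<close>

text \<open>For units, c_z c_v c_z is c_v up to sign. The matrix of these signs is a 4 by 4 Hadamard
  matrix; its half is the orthogonal change of basis on the middle index z which splits the tensor
  product.\<close>

definition qsign :: "nat \<Rightarrow> nat \<Rightarrow> real" where
  "qsign z v = qdot (qbasis z \<star> qbasis v \<star> qbasis z) (qbasis v) / 2"

lemma qsign_eq: "z \<in> {1..4} \<Longrightarrow> v \<in> {1..4} \<Longrightarrow>
    qsign z v = (if z = 1 then 1 / 2 else if v = 1 \<or> v = z then - 1 / 2 else 1 / 2)"
  unfolding in_1_4 by (elim disjE) (simp_all add: qsign_def qbasis_def)

lemma qsign_orthogonal: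
  "v \<in> {1..4} \<Longrightarrow> v' \<in> {1..4} \<Longrightarrow> (\<Sum>z\<in>{1..4}. qsign z v * qsign z v') = (if v = v' then 1 else 0)"
  unfolding in_1_4 sum_1_4 by (elim disjE) (simp_all add: qsign_def qbasis_def)

lemma qdot_fusion:
  assumes "z \<in> {1..4}" "z' \<in> {1..4}"
  shows "qdot (A \<star> qbasis z) (qbasis z') * qdot (qbasis z \<star> B) (qbasis z') =
    (\<Sum>v\<in>{1..4}. qsign z v * qsign z' v * qdot (A \<star> qbasis v \<star> B) (qbasis v))"
proof -
  obtain a0 a1 a2 a3 where A: "A = Quat a0 a1 a2 a3" by (cases A)
  obtain b0 b1 b2 b3 where B: "B = Quat b0 b1 b2 b3" by (cases B)
  have v: "qdot (A \<star> qbasis 1 \<star> B) (qbasis 1) = a0 * b0 - a1 * b1 - a2 * b2 - a3 * b3"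
    "qdot (A \<star> qbasis 2 \<star> B) (qbasis 2) = a0 * b0 - a1 * b1 + a2 * b2 + a3 * b3"
    "qdot (A \<star> qbasis 3 \<star> B) (qbasis 3) = a0 * b0 + a1 * b1 - a2 * b2 + a3 * b3"
    "qdot (A \<star> qbasis 4 \<star> B) (qbasis 4) = a0 * b0 + a1 * b1 + a2 * b2 - a3 * b3"
    by (simp_all add: A B qbasis_def)
  show ?thesis
    using assms unfolding in_1_4 sum_1_4 v
    by (elim disjE) (simp_all add: qsign_eq A B qbasis_def algebra_simps)
qed

lemma kernel_fusion:
  assumes "z \<in> {1..4}" "z' \<in> {1..4}" and x: "qdot x x > 0" and y: "qdot y y > 0"
  shows "kernel x (i, z) (i', z') * kernel y (z, j) (z', j') =
    (\<Sum>v\<in>{1..4}. qsign z v * qsign z' v * kernel (x \<star> qbasis v \<star> y) (i, j) (i', j'))"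
proof -
  \<comment> \<open>The outer factors move to one side as conjugates: A collects those depending on
    x, i, i' and B those depending on y, j, j', which leaves the units in the middle to
    \<open>qdot_fusion\<close>.\<close>
  define A where "A = qconj x \<star> (qconj (qbasis i') \<star> (qbasis i \<star> x))"
  define B where "B = y \<star> (qbasis j \<star> (qconj (qbasis j') \<star> qconj y))"
  have 1: "qdot (qvec x (i, z)) (qvec x (i', z')) = qdot (A \<star> qbasis z) (qbasis z')"
    unfolding qdot_commute[of "qvec x (i, z)"] qdot_commute[of "A \<star> qbasis z"]
    by (simp only: qvec_def fst_conv snd_conv qmult_assoc qdot_mult_left A_def)
  have 2: "qdot (qvec y (z, j)) (qvec y (z', j')) = qdot (qbasis z \<star> B) (qbasis z')"
    unfolding qdot_commute[of "qvec y (z, j)"] qdot_commute[of "qbasis z \<star> B"]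
    by (simp only: qvec_def fst_conv snd_conv qdot_mult_right) (simp only: qmult_assoc B_def)
  have 3: "qdot (qvec (x \<star> qbasis v \<star> y) (i, j)) (qvec (x \<star> qbasis v \<star> y) (i', j')) =
      qdot (A \<star> qbasis v \<star> B) (qbasis v)" for v
    unfolding qdot_commute[of "qvec (x \<star> qbasis v \<star> y) (i, j)"] qdot_commute[of "A \<star> qbasis v \<star> B"]
    by (simp only: qvec_def fst_conv snd_conv, subst qdot_mult_right, subst qdot_mult_left,
        subst qdot_mult_right, subst qdot_mult_left) (simp only: qmult_assoc A_def B_def)
  have n: "qdot (x \<star> qbasis v \<star> y) (x \<star> qbasis v \<star> y) = qdot x x * qdot y y" if "v \<in> {1..4}" for v
    using that by (simp add: qdot_mult_cancel_left qdot_mult_cancel_right qbasis_orthonormal)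
  have "kernel x (i, z) (i', z') * kernel y (z, j) (z', j') =
      (\<Sum>v\<in>{1..4}. qsign z v * qsign z' v * qdot (A \<star> qbasis v \<star> B) (qbasis v)) / (qdot x x * qdot y y)"
    unfolding kernel_def 1 2 qdot_fusion[OF assms(1,2), symmetric] by simp
  also have "\<dots> = (\<Sum>v\<in>{1..4}. qsign z v * qsign z' v * kernel (x \<star> qbasis v \<star> y) (i, j) (i', j'))"
    unfolding sum_divide_distrib by (intro sum.cong refl) (simp add: kernel_def 3 n)
  finally show ?thesis .
qed

text \<open>Each letter contributes one \<open>kernel_fusion\<close>. Summing over the intermediate
  index, orthogonality of \<open>qsign\<close> forces the same v along the whole path.\<close>

lemma path_fusion:
  assumes "w \<in> lists ({1..4} \<times> {1..4})" "z \<in> {1..4}" "z' \<in> {1..4}"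
    and x: "qdot x x > 0" and y: "qdot y y > 0"
  shows "(\<Sum>zs\<in>seqs {1..4} (length w). complex_of_real (path x (i, z) (zip (map fst w) zs) (i', z')) *
      complex_of_real (path y (z, j) (zip zs (map snd w)) (z', j'))) =
    complex_of_real (\<Sum>v\<in>{1..4}. qsign z v * qsign z' v * path (x \<star> qbasis v \<star> y) (i, j) w (i', j'))"
  using assms(1,2)
proof (induction w arbitrary: i j z rule: list.induct)
  case Nil
  then show ?case using kernel_fusion[OF _ assms(3) x y] by (simp flip: of_real_mult)
next
  case (Cons m w)
  obtain i1 j1 where m: "m = (i1, j1)" by (cases m)
  have w: "w \<in> lists ({1..4} \<times> {1..4})" using Cons.prems by simp
  let ?k = "\<lambda>v. kernel (x \<star> qbasis v \<star> y) (i, j) (i1, j1)"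
  let ?p = "\<lambda>v. path (x \<star> qbasis v \<star> y) (i1, j1) w (i', j')"
  have "(\<Sum>zs\<in>seqs {1..4} (length (m # w)). complex_of_real (path x (i, z) (zip (map fst (m # w)) zs) (i', z')) *
      complex_of_real (path y (z, j) (zip zs (map snd (m # w))) (z', j'))) =
    (\<Sum>z1\<in>{1..4}. complex_of_real (kernel x (i, z) (i1, z1) * kernel y (z, j) (z1, j1)) *
      (\<Sum>zs\<in>seqs {1..4} (length w). complex_of_real (path x (i1, z1) (zip (map fst w) zs) (i', z')) *
      complex_of_real (path y (z1, j1) (zip zs (map snd w)) (z', j'))))"
    by (simp add: m sum_seqs_Suc sum_distrib_left mult_ac)
  also have "\<dots> = complex_of_real (\<Sum>z1\<in>{1..4}. (\<Sum>v\<in>{1..4}. qsign z v * qsign z1 v * ?k v) *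
      (\<Sum>v\<in>{1..4}. qsign z1 v * qsign z' v * ?p v))"
    unfolding of_real_sum of_real_mult
  proof (intro sum.cong refl arg_cong2[where f = "(*)"])
    fix z1 :: nat assume z1: "z1 \<in> {1..4}"
    show "complex_of_real (kernel x (i, z) (i1, z1)) * complex_of_real (kernel y (z, j) (z1, j1)) =
        (\<Sum>v\<in>{1..4}. complex_of_real (qsign z v) * complex_of_real (qsign z1 v) * complex_of_real (?k v))"
      using kernel_fusion[OF Cons.prems(2) z1 x y, of i i1 j j1] by (simp flip: of_real_mult of_real_sum)
    show "(\<Sum>zs\<in>seqs {1..4} (length w). complex_of_real (path x (i1, z1) (zip (map fst w) zs) (i', z')) *
        complex_of_real (path y (z1, j1) (zip zs (map snd w)) (z', j'))) =
        (\<Sum>v\<in>{1..4}. complex_of_real (qsign z1 v) * complex_of_real (qsign z' v) * complex_of_real (?p v))"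
      using Cons.IH[OF w z1] by simp
  qed
  also have "(\<Sum>z1\<in>{1..4}. (\<Sum>v\<in>{1..4}. qsign z v * qsign z1 v * ?k v) *
      (\<Sum>v\<in>{1..4}. qsign z1 v * qsign z' v * ?p v)) =
    (\<Sum>v\<in>{1..4}. qsign z v * qsign z' v * (?k v * ?p v))"
  proof -
    have "(\<Sum>z1\<in>{1..4}. (\<Sum>v\<in>{1..4}. qsign z v * qsign z1 v * ?k v) * (\<Sum>v\<in>{1..4}. qsign z1 v * qsign z' v * ?p v)) =
        (\<Sum>z1\<in>{1..4}. \<Sum>v\<in>{1..4}. \<Sum>v'\<in>{1..4}. (qsign z v * ?k v) * (qsign z' v' * ?p v') * (qsign z1 v * qsign z1 v'))"
      unfolding sum_product by (intro sum.cong refl) (simp add: mult_ac)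
    also have "\<dots> = (\<Sum>v\<in>{1..4}. \<Sum>v'\<in>{1..4}. \<Sum>z1\<in>{1..4}. (qsign z v * ?k v) * (qsign z' v' * ?p v') * (qsign z1 v * qsign z1 v'))"
      by (subst sum.swap) (intro sum.cong refl sum.swap)
    also have "\<dots> = (\<Sum>v\<in>{1..4}. \<Sum>v'\<in>{1..4}. if v = v' then (qsign z v * ?k v) * (qsign z' v' * ?p v') else 0)"
      by (intro sum.cong refl) (simp only: sum_distrib_left[symmetric] qsign_orthogonal, simp)
    also have "\<dots> = (\<Sum>v\<in>{1..4}. qsign z v * qsign z' v * (?k v * ?p v))"
      by (simp add: mult_ac)
    finally show ?thesis .
  qed
  finally show ?case by (simp add: m)
qed

lemma character_zip:
  assumes "length a = length b"
  shows "character x (zip a b) = (if a \<in> lists {1..4} \<and> b \<in> lists {1..4} then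
    case zip a b of [] \<Rightarrow> 4 | l # w' \<Rightarrow> complex_of_real (path x l w' l) else 0)"
  using zip_in_lists_iff[OF assms, of "{1..4}"] by (simp add: character_def)

lemma character_fusion:
  assumes x: "qdot x x > 0" and y: "qdot y y > 0"
  shows "convolution {1..4} (character x) (character y) = (\<lambda>w. \<Sum>v\<in>{1..4}. character (x \<star> qbasis v \<star> y) w)"
proof
  fix w :: "nat word"
  have L: "w \<in> lists ({1..4} \<times> {1..4}) \<longleftrightarrow> map fst w \<in> lists {1..4} \<and> map snd w \<in> lists {1..4}"
    using zip_in_lists_iff[of "map fst w" "map snd w" "{1..4}"] by (simp add: zip_map_fst_snd)
  show "convolution {1..4} (character x) (character y) w = (\<Sum>v\<in>{1..4}. character (x \<star> qbasis v \<star> y) w)"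
  proof (cases "w \<in> lists ({1..4} \<times> {1..4})")
    case False
    have "convolution {1..4} (character x) (character y) w = (\<Sum>zs\<in>seqs {1..4 :: nat} (length w). 0)"
      unfolding convolution_seqs
    proof (intro sum.cong refl)
      fix zs :: "nat list" assume "zs \<in> seqs {1..4} (length w)"
      then have "length (map fst w) = length zs" "length zs = length (map snd w)" by (simp_all add: seqs_def)
      then show "character x (zip (map fst w) zs) * character y (zip zs (map snd w)) = 0"
        using False unfolding L by (auto simp: character_zip)
    qed
    then show ?thesis using False by (simp add: character_def)
  next
    case True
    show ?thesis
    proof (cases w)
      case Nil
      then show ?thesis by (simp add: convolution_seqs character_def)
    next
      case (Cons l w')
      obtain i j where l: "l = (i, j)" by (cases l)
      have w': "w' \<in> lists ({1..4} \<times> {1..4})" and ij: "i \<in> {1..4}" "j \<in> {1..4}" using True Cons l by auto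
      have L': "map fst w' \<in> lists {1..4}" "map snd w' \<in> lists {1..4}"
        using zip_in_lists_iff[of "map fst w'" "map snd w'" "{1..4}"] w' by (simp_all add: zip_map_fst_snd)
      have "convolution {1..4} (character x) (character y) w =
        (\<Sum>z\<in>{1..4}. \<Sum>zs\<in>seqs {1..4} (length w').
          complex_of_real (path x (i, z) (zip (map fst w') zs) (i, z)) *
          complex_of_real (path y (z, j) (zip zs (map snd w')) (z, j)))"
        unfolding convolution_seqs Cons list.size(4) add_Suc_right add_0_right sum_seqs_Suc
      proof (intro sum.cong refl)
        fix z :: nat and zs :: "nat list" assume z: "z \<in> {1..4}" and "zs \<in> seqs {1..4} (length w')"
        then have "length (map fst w') = length zs" "length zs = length (map snd w')" "zs \<in> lists {1..4}"
          by (simp_all add: seqs_def)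
        then have "zip (map fst w') zs \<in> lists ({1..4} \<times> {1..4})" "zip zs (map snd w') \<in> lists ({1..4} \<times> {1..4})"
          using L' zip_in_lists_iff[of "map fst w'" zs "{1..4}"] zip_in_lists_iff[of zs "map snd w'" "{1..4}"] by simp_all
        then show "character x (zip (map fst (l # w')) (z # zs)) * character y (zip (z # zs) (map snd (l # w'))) =
          complex_of_real (path x (i, z) (zip (map fst w') zs) (i, z)) *
          complex_of_real (path y (z, j) (zip zs (map snd w')) (z, j))"
          using z ij by (simp add: l character_def)
      qed
      also have "\<dots> = (\<Sum>z\<in>{1..4}. complex_of_real (\<Sum>v\<in>{1..4}. qsign z v * qsign z v * path (x \<star> qbasis v \<star> y) (i, j) w' (i, j)))"
        by (intro sum.cong refl path_fusion w' x y)
      also have "\<dots> = complex_of_real (\<Sum>v\<in>{1..4}. \<Sum>z\<in>{1..4}. qsign z v * qsign z v * path (x \<star> qbasis v \<star> y) (i, j) w' (i, j))"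
        unfolding of_real_sum by (rule sum.swap)
      \<comment> \<open>Closing the path sets z' = z, and each column of \<open>qsign\<close> has
        squared length 1.\<close>
      also have "(\<Sum>v\<in>{1..4}. \<Sum>z\<in>{1..4}. qsign z v * qsign z v * path (x \<star> qbasis v \<star> y) (i, j) w' (i, j)) =
          (\<Sum>v\<in>{1..4}. path (x \<star> qbasis v \<star> y) (i, j) w' (i, j))"
        by (intro sum.cong refl) (simp only: sum_distrib_right[symmetric] qsign_orthogonal, simp)
      also have "\<dots> = (\<Sum>v\<in>{1..4}. character (x \<star> qbasis v \<star> y) w)"
        unfolding of_real_sum by (intro sum.cong refl) (use True in \<open>simp add: character_def Cons l\<close>)
      finally show ?thesis .
    qed
  qed
qed

text \<open>In a closed path every letter occurs twice, so signs attached to the letters cancel.\<close>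

lemma path_sign:
  assumes k: "\<And>l l'. l \<in> X \<Longrightarrow> l' \<in> X \<Longrightarrow> kernel x' (f l) (f l') = g l * g l' * kernel x l l'"
    and g: "\<And>l. l \<in> X \<Longrightarrow> g l * g l = (1 :: real)"
    and "l \<in> X" "l' \<in> X" "w \<in> lists X"
  shows "path x' (f l) (map f w) (f l') = g l * g l' * path x l w l'"
  using assms(5,3)
proof (induction w arbitrary: l rule: list.induct)
  case (Cons m w)
  then have "path x' (f l) (map f (m # w)) (f l') = g l * g m * kernel x l m * (g m * g l' * path x m w l')"
    using k by simp
  also have "\<dots> = (g m * g m) * (g l * g l' * (kernel x l m * path x m w l'))" by (simp add: mult_ac)
  finally show ?case using g Cons by simp
qed (use k assms in simp)

text \<open>The relabelling \<open>f\<close> is \<open>id\<close> when x is changed by a unit or a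
  scalar, and \<open>prod.swap\<close> for the involution.\<close>

lemma character_sign:
  assumes k: "\<And>l l'. l \<in> {1..4} \<times> {1..4} \<Longrightarrow> l' \<in> {1..4} \<times> {1..4} \<Longrightarrow>
      kernel x' (f l) (f l') = g l * g l' * kernel x l l'"
    and g: "\<And>l. l \<in> {1..4} \<times> {1..4} \<Longrightarrow> g l * g l = (1 :: real)"
    and f: "\<And>l. f l \<in> {1..4} \<times> {1..4} \<longleftrightarrow> l \<in> {1..4} \<times> {1..4}"
  shows "character x' (map f w) = character x w"
proof -
  have "map f w \<in> lists ({1..4} \<times> {1..4}) \<longleftrightarrow> w \<in> lists ({1..4} \<times> {1..4})"
    using f by (auto simp: in_lists_conv_set)
  then show ?thesis
    using path_sign[of "{1..4} \<times> {1..4}" x' f g x, OF k g] g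
    by (cases w) (simp_all add: character_def)
qed

section \<open>Characters of quaternions differing by units and scalars\<close>

definition qflip :: "nat \<Rightarrow> nat \<Rightarrow> real" where
  "qflip v i = (if v = 1 \<or> i = 1 \<or> i = v then 1 else - 1)"

lemma qbasis_commute:
  "v \<in> {1..4} \<Longrightarrow> i \<in> {1..4} \<Longrightarrow> qbasis i \<star> qbasis v = qscale (qflip v i) (qbasis v \<star> qbasis i)"
  unfolding in_1_4 by (elim disjE) (simp_all add: qbasis_def qflip_def)

text \<open>Moving c_v to the outside past c_i costs a sign depending on the letter only, and left
  multiplication by c_v is an isometry, so the Gram matrix changes by signs on letters.\<close>

lemma character_qbasis_left:
  assumes v: "v \<in> {1..4}"
  shows "character (qbasis v \<star> x) = character x"
proof
  fix w
  have q: "qvec (qbasis v \<star> x) (i, j) = qscale (qflip v i) (qbasis v \<star> qvec x (i, j))" if "i \<in> {1..4}" for i j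
    unfolding qvec_def fst_conv snd_conv qmult_assoc[symmetric] qbasis_commute[OF v that] by (simp only: qmult_scale)
  have "character (qbasis v \<star> x) (map id w) = character x w"
  proof (rule character_sign[where g = "\<lambda>l. qflip v (fst l)"])
    show "kernel (qbasis v \<star> x) (id l) (id l') = qflip v (fst l) * qflip v (fst l') * kernel x l l'"
      if "l \<in> {1..4} \<times> {1..4}" "l' \<in> {1..4} \<times> {1..4}" for l l'
      using that v q[of "fst l" "snd l"] q[of "fst l'" "snd l'"]
      by (auto simp: kernel_def qdot_scale qdot_mult_cancel_left qbasis_orthonormal)
  qed (auto simp: qflip_def)
  then show "character (qbasis v \<star> x) w = character x w" by simp
qed

lemma character_qbasis_right:
  assumes v: "v \<in> {1..4}"
  shows "character (x \<star> qbasis v) = character x"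
proof
  fix w
  have q: "qvec (x \<star> qbasis v) (i, j) = qscale (qflip j v) (qvec x (i, j) \<star> qbasis v)" if "j \<in> {1..4}" for i j
    unfolding qvec_def fst_conv snd_conv qmult_assoc qbasis_commute[OF that v] by (simp only: qmult_scale)
  have "character (x \<star> qbasis v) (map id w) = character x w"
  proof (rule character_sign[where g = "\<lambda>l. qflip (snd l) v"])
    show "kernel (x \<star> qbasis v) (id l) (id l') = qflip (snd l) v * qflip (snd l') v * kernel x l l'"
      if "l \<in> {1..4} \<times> {1..4}" "l' \<in> {1..4} \<times> {1..4}" for l l'
      using that v q[of "snd l" "fst l"] q[of "snd l'" "fst l'"]
      by (auto simp: kernel_def qdot_scale qdot_mult_cancel_right qbasis_orthonormal)
  qed (auto simp: qflip_def)
  then show "character (x \<star> qbasis v) w = character x w" by simp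
qed

lemma character_scale:
  assumes "t \<noteq> 0"
  shows "character (qscale t x) = character x"
proof
  fix w
  have "character (qscale t x) (map id w) = character x w"
    by (rule character_sign[where g = "\<lambda>l. 1"])
      (use assms in \<open>auto simp: kernel_def qvec_def qmult_scale qdot_scale\<close>)
  then show "character (qscale t x) w = character x w" by simp
qed

section \<open>The quaternion \<open>i + 2j + 2k\<close>\<close>

text \<open>Being imaginary of norm 9, X0 has square -9, and X0 v X0 = -2 t X0 + 9 v for an
  imaginary unit v with t the inner product of X0 and v. As t is 1 or 2, modulo 3 this is X0 up to
  sign.\<close>

definition X0 :: quat where
  "X0 = Quat 0 1 2 2"

text \<open>Conjugation reverses c_i X0 c_j and sends X0 and the units to themselves up to sign.
  Exchanging the indices of a letter thus conjugates its vector up to a sign.\<close>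

lemma star_character_X0: "star_coefficient (character X0) = character X0"
proof
  fix w :: "nat word"
  define s where "s i = (if i = 1 then 1 else - 1 :: real)" for i :: nat
  have c: "qconj (qbasis i) = qscale (s i) (qbasis i)" for i by (simp add: qbasis_def s_def)
  have conj: "qconj (p \<star> q) = qconj q \<star> qconj p" for p q by (cases p; cases q) (simp add: algebra_simps)
  have dot: "qdot (qconj p) (qconj q) = qdot p q" for p q by (cases p; cases q) simp
  have X0: "qconj X0 = qscale (- 1) X0" by (simp add: X0_def)
  have q: "qvec X0 (j, i) = qscale (- (s i * s j)) (qconj (qvec X0 (i, j)))" for i j
    by (simp add: qvec_def conj c X0 qmult_scale qmult_assoc qscale_qscale s_def)
  have "character X0 (map prod.swap w) = character X0 w"
  proof (rule character_sign[where g = "\<lambda>l. s (fst l) * s (snd l)"])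
    show "kernel X0 (prod.swap l) (prod.swap l') = s (fst l) * s (snd l) * (s (fst l') * s (snd l')) * kernel X0 l l'" for l l'
    proof -
      obtain i j i' j' where l: "l = (i, j)" "l' = (i', j')" by (cases l; cases l') blast
      show ?thesis unfolding l swap_simp kernel_def q[of j i] q[of j' i'] by (simp add: qdot_scale dot)
    qed
  qed (auto simp: s_def)
  then show "star_coefficient (character X0) w = character X0 w"
    by (auto simp: star_coefficient_def character_def split: list.split)
qed

text \<open>The index counts the factors X0. The rule \<open>step\<close> starts from
  \<open>Suc m\<close> because no separator precedes the first X0.\<close>

inductive reduced :: "nat \<Rightarrow> quat \<Rightarrow> bool" where
  one: "reduced 0 (qbasis 1)"
| X0: "reduced 1 X0"
| step: "reduced (Suc m) q \<Longrightarrow> v \<in> {2..4} \<Longrightarrow> reduced (Suc (Suc m)) (q \<star> qbasis v \<star> X0)"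

text \<open>Modulo 3 one has \<open>X0 v X0 = \<plusminus> X0\<close> for \<open>v \<in> {i, j, k}\<close>, so a nonempty reduced word is congruent to
  \<open>\<plusminus> X0\<close>.  In particular it is not a multiple of an element of \<open>{1, i, j, k}\<close>.\<close>

lemma reduced_mod_3:
  assumes "reduced m q" "m > 0"
  obtains a b c d :: int where "q = Quat (of_int a) (of_int b) (of_int c) (of_int d)"
    "3 dvd a" "3 dvd (c - 2 * b)" "3 dvd (d - 2 * b)" "\<not> 3 dvd b"
proof -
  from assms have "\<exists>a b c d :: int. q = Quat (of_int a) (of_int b) (of_int c) (of_int d) \<and>
    3 dvd a \<and> 3 dvd (c - 2 * b) \<and> 3 dvd (d - 2 * b) \<and> \<not> 3 dvd b"
  proof induction
    case X0
    show ?case by (rule exI[of _ 0], rule exI[of _ 1], rule exI[of _ 2], rule exI[of _ 2]) (simp add: X0_def)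
  next
    case (step m q v)
    then obtain a b c d :: int where q: "q = Quat (of_int a) (of_int b) (of_int c) (of_int d)"
      and d: "3 dvd a" "3 dvd (c - 2 * b)" "3 dvd (d - 2 * b)" "\<not> 3 dvd b" by auto
    have "v = 2 \<or> v = 3 \<or> v = 4" using step.hyps by auto
    moreover have "Quat (of_int a) (of_int b) (of_int c) (of_int d) \<star> qbasis 2 \<star> X0 =
        Quat (of_int (2 * c - a - 2 * d)) (of_int (2 * c + 2 * d - b)) (of_int (- 2 * a - 2 * b - c)) (of_int (2 * a - 2 * b - d))"
      "Quat (of_int a) (of_int b) (of_int c) (of_int d) \<star> qbasis 3 \<star> X0 =
        Quat (of_int (d - 2 * a - 2 * b)) (of_int (2 * a - 2 * b - c)) (of_int (b - 2 * c + 2 * d)) (of_int (- a - 2 * c - 2 * d))"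
      "Quat (of_int a) (of_int b) (of_int c) (of_int d) \<star> qbasis 4 \<star> X0 =
        Quat (of_int (2 * b - 2 * a - c)) (of_int (- 2 * a - 2 * b - d)) (of_int (a - 2 * c - 2 * d)) (of_int (b + 2 * c - 2 * d))"
      by (simp_all add: qbasis_def X0_def)
    ultimately obtain a' b' c' d' :: int where "q \<star> qbasis v \<star> X0 = Quat (of_int a') (of_int b') (of_int c') (of_int d')"
      and "(a', b', c', d') = (2 * c - a - 2 * d, 2 * c + 2 * d - b, - 2 * a - 2 * b - c, 2 * a - 2 * b - d) \<or>
        (a', b', c', d') = (d - 2 * a - 2 * b, 2 * a - 2 * b - c, b - 2 * c + 2 * d, - a - 2 * c - 2 * d) \<or>
        (a', b', c', d') = (2 * b - 2 * a - c, - 2 * a - 2 * b - d, a - 2 * c - 2 * d, b + 2 * c - 2 * d)"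
      unfolding q by metis
    moreover from this(2) have "3 dvd a'" "3 dvd (c' - 2 * b')" "3 dvd (d' - 2 * b')" "\<not> 3 dvd b'"
      using d by (elim disjE; simp only: prod.inject; elim conjE; hypsubst; presburger)+
    ultimately show ?case by blast
  qed simp
  then show thesis using that by blast
qed

lemma reduced_norm_pos: "reduced m q \<Longrightarrow> qdot q q > 0"
proof (induction rule: reduced.induct)
  case one
  show ?case by (simp add: qbasis_def)
next
  case X0
  show ?case by (simp add: X0_def)
next
  case (step m q v)
  then show ?case by (simp add: qdot_mult_cancel_left qdot_mult_cancel_right qbasis_orthonormal X0_def)
qed

section \<open>The Haar state on characters\<close>

lemma kernel_le_1:
  assumes "l \<in> {1..4} \<times> {1..4}" "l' \<in> {1..4} \<times> {1..4}" and x: "qdot x x > 0"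
  shows "\<bar>kernel x l l'\<bar> \<le> 1"
proof -
  have "(qdot (qvec x l) (qvec x l'))\<^sup>2 \<le> qdot x x * qdot x x"
    using qdot_Cauchy_Schwarz[of "qvec x l" "qvec x l'"] qvec_norm[of "fst l" "snd l" x] qvec_norm[of "fst l'" "snd l'" x] assms
    by (simp add: mem_Times_iff)
  then have "\<bar>qdot (qvec x l) (qvec x l')\<bar> \<le> \<bar>qdot x x\<bar>"
    by (simp only: power2_eq_square[symmetric] abs_le_square_iff)
  then show ?thesis using x by (simp add: kernel_def)
qed

lemma path_le_1:
  assumes "l \<in> {1..4} \<times> {1..4}" "l' \<in> {1..4} \<times> {1..4}" "w \<in> lists ({1..4} \<times> {1..4})" and x: "qdot x x > 0"
  shows "\<bar>path x l w l'\<bar> \<le> 1"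
  using assms(3,1)
proof (induction w arbitrary: l rule: list.induct)
  case Nil
  then show ?case using kernel_le_1[OF _ assms(2) x] by simp
next
  case (Cons m w)
  then show ?case
    using mult_mono[of "\<bar>kernel x l m\<bar>" 1 "\<bar>path x m w l'\<bar>" 1] kernel_le_1[of l m x] x by (simp add: abs_mult)
qed

abbreviation points :: "nat list" where
  "points \<equiv> [1, 2, 3, 4]"

lemma set_points: "set points = {1..4}"
  by auto

text \<open>Each block of the palindrome passes once from \<open>(1, 1)\<close> to
  \<open>(2, 2)\<close>; this factor is kept and all others are bounded by 1.\<close>

lemma path_pal_le:
  assumes x: "qdot x x > 0" and l: "l \<in> {1..4} \<times> {1..4}" "l' \<in> {1..4} \<times> {1..4}"
  shows "\<bar>path x l (diag_word (pal points k)) l'\<bar> \<le> \<bar>kernel x (1, 1) (2, 2)\<bar> ^ k"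
  using l(1)
proof (induction k arbitrary: l)
  case 0
  then show ?case using kernel_le_1[OF _ l(2) x] by simp
next
  case (Suc k)
  note K = kernel_le_1[OF _ _ x]
  let ?r = "path x (1, 1) (diag_word (pal points k)) l'"
  have eq: "path x l (diag_word (pal points (Suc k))) l' = kernel x (1, 1) (2, 2) * ?r *
      (kernel x l (1, 1) * kernel x (2, 2) (3, 3) * kernel x (3, 3) (4, 4) * kernel x (4, 4) (4, 4) *
       kernel x (4, 4) (3, 3) * kernel x (3, 3) (2, 2) * kernel x (2, 2) (1, 1))"
    by (simp add: pal_Suc)
  have m: "\<bar>a * b\<bar> \<le> 1" if "\<bar>a\<bar> \<le> 1" "\<bar>b\<bar> \<le> 1" for a b :: real
    using mult_mono[of "\<bar>a\<bar>" 1 "\<bar>b\<bar>" 1] that by (simp add: abs_mult)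
  have "\<bar>kernel x l (1, 1) * kernel x (2, 2) (3, 3) * kernel x (3, 3) (4, 4) * kernel x (4, 4) (4, 4) *
       kernel x (4, 4) (3, 3) * kernel x (3, 3) (2, 2) * kernel x (2, 2) (1, 1)\<bar> \<le> 1"
    using Suc.prems by (intro m K) auto
  then have "\<bar>path x l (diag_word (pal points (Suc k))) l'\<bar> \<le> \<bar>kernel x (1, 1) (2, 2) * ?r\<bar>"
    unfolding eq abs_mult[of "kernel x (1, 1) (2, 2) * ?r"] by (simp add: mult_left_le)
  also have "\<dots> \<le> \<bar>kernel x (1, 1) (2, 2)\<bar> ^ Suc k"
    using Suc.IH[of "(1, 1)"] by (simp add: abs_mult mult_left_mono)
  finally show ?case .
qed

lemma diag_pal_points_in_lists: "diag_word (pal points k) \<in> lists ({1..4} \<times> {1..4})"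
  using diag_pal_in_lists[of points k] unfolding set_points .

lemma character_pal:
  "\<exists>w \<in> lists ({1..4} \<times> {1..4}). diag_word (pal points (Suc k)) = (1, 1) # w"
  using diag_pal_points_in_lists[of "Suc k"] by (simp add: pal_Suc)

lemma haar_limit_character_le:
  assumes x: "qdot x x > 0"
  shows "cmod (haar_limit points (character x)) \<le> 1"
proof -
  have "character x \<in> coefficients (set points)" unfolding set_points by (rule character_coefficients[OF x])
  \<comment> \<open>The shift discards the empty word, where the character is 4.\<close>
  from LIMSEQ_Suc[OF tendsto_norm[OF haar_limit_tendsto[OF this]]] show ?thesis
  proof (rule LIMSEQ_le_const2, intro exI allI impI)
    fix k
    obtain w where w: "w \<in> lists ({1..4} \<times> {1..4})" "diag_word (pal points (Suc k)) = (1, 1) # w"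
      using character_pal by blast
    then show "cmod (character x (diag_word (pal points (Suc k)))) \<le> 1"
      using path_le_1[of "(1, 1)" "(1, 1)" w x] x by (simp add: character_def)
  qed
qed

text \<open>The kernel value differs from 1 and -1, hence is smaller than 1 in absolute value, and
  the values along the palindromes decay geometrically.\<close>

lemma haar_limit_character_zero:
  assumes "kernel x (1, 1) (2, 2) \<noteq> 1" "kernel x (1, 1) (2, 2) \<noteq> - 1" and x: "qdot x x > 0"
  shows "haar_limit points (character x) = 0"
proof -
  let ?r = "\<bar>kernel x (1, 1) (2, 2)\<bar>"
  have r: "?r < 1" using kernel_le_1[of "(1, 1)" "(2, 2)" x] assms by auto
  have "character x \<in> coefficients (set points)" unfolding set_points by (rule character_coefficients[OF x])
  from haar_limit_tendsto[OF this] have lim: "(\<lambda>k. character x (diag_word (pal points k))) \<longlonglongrightarrow> haar_limit points (character x)" .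
  have "(\<lambda>k. character x (diag_word (pal points (Suc k)))) \<longlonglongrightarrow> 0"
  proof (rule tendsto_0_le[where f = "\<lambda>k. ?r ^ k" and K = 1])
    show "\<forall>\<^sub>F k in sequentially. norm (character x (diag_word (pal points (Suc k)))) \<le> norm (?r ^ k) * 1"
    proof (intro always_eventually allI)
      fix k
      obtain w where w: "w \<in> lists ({1..4} \<times> {1..4})" "diag_word (pal points (Suc k)) = (1, 1) # w"
        using character_pal by blast
      \<comment> \<open>Inserting this factor 1 turns the closed path at \<open>(1, 1)\<close> into
        a path along the entire diagonal word, as \<open>path_pal_le\<close> requires.\<close>
      have k11: "kernel x (1, 1) (1, 1) = 1" using x by (simp add: kernel_def qvec_norm)
      have "norm (character x (diag_word (pal points (Suc k)))) = \<bar>path x (1, 1) ((1, 1) # w) (1, 1)\<bar>"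
        using w k11 by (simp add: character_def)
      also have "\<dots> \<le> ?r ^ Suc k" unfolding w(2)[symmetric] by (rule path_pal_le[OF x]) auto
      also have "\<dots> \<le> ?r ^ k" using r by (simp add: mult_le_cancel_right1 mult_left_le_one_le)
      finally show "norm (character x (diag_word (pal points (Suc k)))) \<le> norm (?r ^ k) * 1" by (simp add: power_abs)
    qed
    show "(\<lambda>k. ?r ^ k) \<longlonglongrightarrow> 0" using r by (intro LIMSEQ_power_zero) simp
  qed
  with LIMSEQ_Suc[OF lim] show ?thesis by (rule LIMSEQ_unique)
qed

text \<open>A kernel value of 1 or -1 would force a = b = 0 or c = d = 0, but modulo 3 neither b nor
  c vanishes.\<close>

lemma haar_limit_reduced:
  assumes q: "reduced m q" "m > 0"
  shows "haar_limit points (character q) = 0"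
proof -
  obtain a b c d :: int where e: "q = Quat (of_int a) (of_int b) (of_int c) (of_int d)"
    and d: "3 dvd (c - 2 * b)" "\<not> 3 dvd b" by (rule reduced_mod_3[OF q]) blast
  have "b \<noteq> 0" "c \<noteq> 0" using d by presburger+
  then have pos: "(real_of_int b)\<^sup>2 > 0" "(real_of_int c)\<^sup>2 > 0" by simp_all
  have N: "qdot q q > 0" by (rule reduced_norm_pos[OF q(1)])
  have n: "qdot q q = (real_of_int a)\<^sup>2 + (real_of_int b)\<^sup>2 + (real_of_int c)\<^sup>2 + (real_of_int d)\<^sup>2"
    by (simp add: e power2_eq_square)
  have v: "qdot (qvec q (1, 1)) (qvec q (2, 2)) = - (real_of_int a)\<^sup>2 - (real_of_int b)\<^sup>2 + (real_of_int c)\<^sup>2 + (real_of_int d)\<^sup>2"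
    by (simp add: e qvec_def qbasis_def power2_eq_square)
  have "qdot (qvec q (1, 1)) (qvec q (2, 2)) \<noteq> qdot q q" "qdot (qvec q (1, 1)) (qvec q (2, 2)) \<noteq> - qdot q q"
    unfolding n v using pos zero_le_power2[of "real_of_int a"] zero_le_power2[of "real_of_int d"] by linarith+
  then show ?thesis
    using N by (intro haar_limit_character_zero) (simp_all add: kernel_def divide_eq_eq)
qed

section \<open>Non-amenability\<close>

abbreviation "chi \<equiv> convolution {1..4} (character X0)"

lemma convolution_unit_right:
  assumes "finite X" "f \<in> coefficients X"
  shows "convolution X f (unit_coefficient X) = f"
proof -
  have "star_coefficient (convolution X f (unit_coefficient X)) = star_coefficient f"
    by (simp add: star_convolution star_unit_coefficient convolution_unit_left coefficients_star assms)
  then show ?thesis by (metis star_star)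
qed

text \<open>With separator 1 the last two factors X0 meet and give the scalar -9. What remains is q'
  times a unit, so one factor X0 is lost.\<close>

lemma reduced_step_one:
  assumes "reduced (Suc (Suc m)) q"
  obtains q' where "reduced (Suc m) q'" "character (q \<star> qbasis 1 \<star> X0) = character q'"
  using assms
proof cases
  case (step q' v)
  have "v \<in> {1..4}" using step by auto
  have "q \<star> qbasis 1 \<star> X0 = qscale (- 9) (q' \<star> qbasis v)"
  proof -
    have 1: "X0 \<star> X0 = qscale (- 9) (qbasis 1)" by (simp add: X0_def qbasis_def)
    have 2: "p \<star> qbasis 1 = p" for p by (cases p) (simp add: qbasis_def)
    show ?thesis
      by (simp only: step 2 qmult_assoc[of _ X0 X0] 1 qmult_scale)
  qed
  then have "character (q \<star> qbasis 1 \<star> X0) = character q'"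
    using character_scale[of "- 9"] character_qbasis_right[OF \<open>v \<in> {1..4}\<close>] by simp
  then show thesis using that step by blast
qed simp

text \<open>Multiplication by the character of X0 leads from length m > 0 once to length m - 1 and
  three times to m + 1. Weighting length m by t^(-m) gives the growth rate t + 3/t, which is below 4
  for 1 < t < 3; the choice t = 2 gives 7/2.\<close>

lemma haar_limit_character_power:
  assumes "reduced m q"
  shows "cmod (haar_limit points (convolution {1..4} (character q) ((chi ^^ n) (unit_coefficient {1..4})))) \<le> (7 / 2) ^ n / 2 ^ m"
  using assms
proof (induction n arbitrary: m q)
  case 0
  have "convolution {1..4} (character q) (unit_coefficient {1..4}) = character q"
    by (intro convolution_unit_right character_coefficients reduced_norm_pos[OF 0]) simp
  then show ?case
    using haar_limit_character_le[OF reduced_norm_pos[OF 0]] haar_limit_reduced[OF 0] by (cases m) simp_all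
next
  case (Suc n)
  let ?c = "(chi ^^ n) (unit_coefficient {1..4})"
  let ?h = "\<lambda>q. haar_limit points (convolution {1..4} (character q) ?c)"
  define g where "g v = cmod (?h (q \<star> qbasis v \<star> X0))" for v
  have X0: "qdot X0 X0 > 0" by (simp add: X0_def)
  have q: "qdot q q > 0" by (rule reduced_norm_pos[OF Suc.prems])
  have c: "?c \<in> coefficients {1..4}"
    by (induction n) (simp_all add: coefficients_unit coefficients_convolution character_coefficients X0 del: One_nat_def)
  have pos: "qdot (q \<star> qbasis v \<star> X0) (q \<star> qbasis v \<star> X0) > 0" if "v \<in> {1..4}" for v
    using that q X0 by (simp add: qdot_mult_cancel_left qdot_mult_cancel_right qbasis_orthonormal)
  have "convolution {1..4} (character q) ((chi ^^ Suc n) (unit_coefficient {1..4})) =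
      (\<lambda>w. \<Sum>v\<in>{1..4}. convolution {1..4} (character (q \<star> qbasis v \<star> X0)) ?c w)"
    by (simp add: character_fusion[OF q X0] convolution_sum_left del: One_nat_def flip: convolution_assoc)
  then have "haar_limit points (convolution {1..4} (character q) ((chi ^^ Suc n) (unit_coefficient {1..4}))) =
      (\<Sum>v\<in>{1..4}. ?h (q \<star> qbasis v \<star> X0))"
    using haar_limit_sum[of "{1..4}" "\<lambda>v. convolution {1..4} (character (q \<star> qbasis v \<star> X0)) ?c" points]
      coefficients_convolution[OF _ character_coefficients[OF pos] c]
    unfolding set_points by simp
  then have "cmod (haar_limit points (convolution {1..4} (character q) ((chi ^^ Suc n) (unit_coefficient {1..4})))) =
      cmod (\<Sum>v\<in>{1..4}. ?h (q \<star> qbasis v \<star> X0))" by (rule arg_cong)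
  also have "\<dots> \<le> (\<Sum>v\<in>{1..4}. cmod (?h (q \<star> qbasis v \<star> X0)))" by (rule norm_sum)
  also have "\<dots> = g 1 + g 2 + g 3 + g 4" unfolding g_def sum_1_4 ..
  also have "\<dots> \<le> (7 / 2) ^ Suc n / 2 ^ m"
    using Suc.prems
  proof (cases rule: reduced.cases)
    case one
    \<comment> \<open>From the empty word all four separators lead to X0 up to a unit on the left,
      with total weight 2 in place of 7/2.\<close>
    have "qbasis 1 \<star> p = p" for p by (cases p) (simp add: qbasis_def)
    then have "g v = cmod (?h X0)" if "v \<in> {1..4}" for v
      unfolding g_def one(2) by (simp only: character_qbasis_left[OF that])
    then have "g v \<le> (7 / 2) ^ n / 2 ^ 1" if "v \<in> {1..4}" for v
      using Suc.IH[OF reduced.X0] that by (simp only:)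
    from this[of 1] this[of 2] this[of 3] this[of 4]
    have "g 1 + g 2 + g 3 + g 4 \<le> 2 * (7 / 2) ^ n" by simp
    also have "\<dots> \<le> (7 / 2) ^ Suc n / 2 ^ m" by (simp add: one(1))
    finally show ?thesis .
  next
    case X0
    have "X0 \<star> qbasis 1 \<star> X0 = qscale (- 9) (qbasis 1)" by (simp add: X0_def qbasis_def)
    then have "g 1 = cmod (?h (qbasis 1))"
      unfolding g_def X0(2) by (simp only: character_scale[of "- 9"])
    then have 1: "g 1 \<le> (7 / 2) ^ n / 2 ^ 0"
      using Suc.IH[OF reduced.one] by (simp only:)
    have v: "g v \<le> (7 / 2) ^ n / 2 ^ Suc (Suc 0)" if "v \<in> {2..4}" for v
      unfolding g_def by (rule Suc.IH[OF reduced.step[OF _ that]]) (use X0 reduced.X0 in simp)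
    show ?thesis unfolding X0(1) using 1 v[of 2] v[of 3] v[of 4] by simp
  next
    case (step k p u)
    obtain q' where q': "reduced (Suc k) q'" "character (q \<star> qbasis 1 \<star> X0) = character q'"
      by (rule reduced_step_one[of k q]) (use Suc.prems step in auto)
    have 1: "g 1 \<le> (7 / 2) ^ n / 2 ^ Suc k"
      unfolding g_def q'(2) by (rule Suc.IH[OF q'(1)])
    have v: "g v \<le> (7 / 2) ^ n / 2 ^ Suc (Suc (Suc k))" if "v \<in> {2..4}" for v
      unfolding g_def by (rule Suc.IH[OF reduced.step[OF _ that]]) (use Suc.prems step in simp)
    show ?thesis unfolding step(1) using 1 v[of 2] v[of 3] v[of 4] by (simp add: field_simps)
  qed
  finally show ?case .
qed

theorem theorem5p6:
  shows "\<not> amenable (Sigma_plus 4)"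
proof
  assume "amenable (Sigma_plus 4)"
  then have am: "amenable (coefficient_algebra (set points))"
    unfolding Sigma_plus_def set_points .
  have X0: "qdot X0 X0 > 0" by (simp add: X0_def)
  have "cmod (character X0 []) \<le> 7 / 2"
  proof (rule amenable_counit_le[OF _ _ _ _ am])
    show "character X0 \<in> coefficients (set points)"
      unfolding set_points by (rule character_coefficients[OF X0])
    show "cmod (haar_limit points ((convolution (set points) (character X0) ^^ n) (unit_coefficient (set points)))) \<le> 1 * (7 / 2) ^ n" for n
    proof (cases n)
      case 0
      then show ?thesis using haar_limit_unit[of points] by simp
    next
      \<comment> \<open>The power of order k + 1 is the character of the reduced word X0 of length 1
        convolved with the k-th power.\<close>
      case (Suc k)
      have "cmod (haar_limit points ((chi ^^ n) (unit_coefficient {1..4}))) \<le> (7 / 2) ^ k / 2 ^ 1"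
        using haar_limit_character_power[OF reduced.X0, of k] Suc by simp
      also have "\<dots> \<le> 1 * (7 / 2) ^ n" unfolding Suc by simp
      finally show ?thesis unfolding set_points .
    qed
  qed (simp_all add: star_character_X0)
  \<comment> \<open>The counit of the character is 4, which exceeds 7/2.\<close>
  then show False by (simp add: character_def)
qed

end
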